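(* Let $(P^5,\eta,\omega_1,\omega_2,\omega_3)$ be a compact $5$-dimensional manifold endowed with a hypo $SU(2)$ structure such that $d\eta=0=d\omega_2$. Then on the $6$-dimensional manifold $M^6=P^5\times S^1$ there exist solutions to the SUSY equations IIA and IIB. More precisely, let $\beta$ be a global nonvanishing $1$-form on $S^1$, and let $k_{||},k_\perp\in(0,1)$ be constants with $k_{||}^2+k_\perp^2=1$. Then $(\alpha,Re(\Omega)_{||},Re(\Omega)_\perp,Im(\Omega))$ given by $$Re(\alpha)=\beta,\quad Im(\alpha)=\frac1{k_{||}}\eta,\quad Re(\Omega)_{||}=-k_{||}\,\omega_3,\quad Re(\Omega)_\perp=k_\perp\,\omega_1,\quad Im(\Omega)=\omega_2$$ solves the SUSY equations IIA, and $(\alpha,Re(\Omega)_{||},Re(\Omega)_\perp,Im(\Omega))$ given by $$Re(\alpha)=\frac1{k_{||}}\beta,\quad Im(\alpha)=\eta,\quad Re(\Omega)_{||}=k_\perp\,\omega_3,\quad Re(\Omega)_\perp=k_{||}\,\omega_1,\quad Im(\Omega)=\omega_2$$ solves the SUSY equations IIB.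
   Context: An $SU(2)$ structure on a $5$-manifold $P^5$ is an $SU(2)$-reduction of the bundle of linear frames, equivalently a triple $(\eta,\omega_1,\Phi)$ with $\eta$ a $1$-form, $\omega_1$ a $2$-form and $\Phi=\omega_2+i\,\omega_3$ a complex $2$-form such that $\eta\wedge\omega_1\wedge\omega_1\neq0$, $\Phi^2=0$, $\omega_1\wedge\Phi=0$, $\Phi\wedge\overline\Phi=2\,\omega_1\wedge\omega_1$, and $\Phi$ is of type $(2,0)$ with respect to $\omega_1$. It is hypo if $d\omega_1=d(\omega_2\wedge\eta)=d(\omega_3\wedge\eta)=0$. Forms on the factors are pulled back to $M^6$. An $SU(2)$ structure $(J,g,\alpha,\omega,\Omega)$ on a $6$-manifold $M^6$ consists of an almost Hermitian structure $(J,g)$, a $(1,0)$-form $\alpha$ with $\|\alpha\|^2=i_{\overline\alpha}\alpha=2$, a real $2$-form $\omega$ and a $(2,0)$-form $\Omega$ with $\omega^2=\frac12\Omega\wedge\overline\Omega\neq0$, $\omega\wedge\Omega=0$, $\Omega\wedge\Omega=0$, $i_\alpha\Omega=0$, $i_\alpha\omega=0$, where $i_\alpha$ denotes contraction by the vector field dual to $\alpha$; the fundamental $2$-form $F(X,Y)=g(JX,Y)$ of $(J,g)$ is $F=\omega+\frac i2\alpha\wedge\overline\alpha$. The pair $(J,g)$ is determined by $(\alpha,\omega,\Omega)$. Projection forms: given an $SU(2)$ structure on $M^6$ and the constants $k_{||},k_\perp$, put $$Re(\Omega)_{||}=\tfrac12\big((1-\cos2\phi)Re(\Omega)+\sin(2\phi)\,\omega\big),\quad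 Re(\Omega)_\perp=\tfrac12\big((1+\cos2\phi)Re(\Omega)-\sin(2\phi)\,\omega\big),$$ where for type IIA $\phi\in(-\frac\pi2,0)$ is defined by $k_{||}=-\sin\phi$, $k_\perp=\cos\phi$, and for type IIB $\phi\in(0,\frac\pi2)$ is defined by $k_{||}=\cos\phi$, $k_\perp=\sin\phi$. Forms $(\alpha,Re(\Omega)_{||},Re(\Omega)_\perp,Im(\Omega))$ arising in this way from an $SU(2)$ structure solve the SUSY equations IIA, resp. IIB, if the following hold for the $3$-form $H$ determined by $k_{||}H=k_\perp d(Im(\Omega))$. SUSY equations IIA: $$d(Re(\alpha))=0,\qquad k_{||}H=k_\perp d(Im(\Omega)),\qquad d(Re(\Omega)_\perp)=k_{||}k_\perp Re(\alpha)\wedge d(Im(\alpha)),$$ $$H\wedge Re(\alpha)=-\frac{k_\perp}{k_{||}}\,d\big(Im(\alpha)\wedge Re(\Omega)_{||}\big).$$ SUSY equations IIB: $$d(Re(\alpha))=0,\qquad d(Im(\alpha))=0,\qquad k_{||}H=k_\perp d(Im(\Omega)),$$ $$Re(\alpha)\wedge H=-\frac{k_\perp}{k_{||}}Im(\alpha)\wedge d(Re(\Omega)_\perp),\qquad Im(\alpha)\wedge H=\frac{k_\perp}{k_{||}}Re(\alpha)\wedge d(Re(\Omega)_\perp),$$ $$Re(\alpha)\wedge Im(\alpha)\wedge d(Re(\Omega)_{||})=-H\wedge Im(\Omega).$$ *)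

theory Defs
  imports "HOL-Analysis.Analysis" "HOL-Library.Function_Algebras"
begin

section \<open>Smooth manifolds\<close>

primrec C_k_on :: "nat \<Rightarrow> 'e::euclidean_space set \<Rightarrow> ('e \<Rightarrow> 'v::real_normed_vector) \<Rightarrow> bool" where
  "C_k_on 0 S f \<longleftrightarrow> continuous_on S f"
| "C_k_on (Suc k) S f \<longleftrightarrow>
     (\<forall>x\<in>S. f differentiable at x) \<and> (\<forall>v. C_k_on k S (\<lambda>x. frechet_derivative f (at x) v))"

text \<open>Meant for open \<open>S\<close>.\<close>
definition smooth_on :: "'e::euclidean_space set \<Rightarrow> ('e \<Rightarrow> 'v::real_normed_vector) \<Rightarrow> bool" where
  "smooth_on S f \<longleftrightarrow> (\<forall>k. C_k_on k S f)"

text \<open>A chart is its domain together with its coordinate map; the values of the map outside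
  the domain are irrelevant.\<close>
type_synonym ('a, 'e) chart = "'a set \<times> ('a \<Rightarrow> 'e)"

definition cdom :: "('a, 'e) chart \<Rightarrow> 'a set" where "cdom c = fst c"
definition cmap :: "('a, 'e) chart \<Rightarrow> 'a \<Rightarrow> 'e" where "cmap c = snd c"
definition cimg :: "('a, 'e) chart \<Rightarrow> 'e set" where "cimg c = cmap c ` cdom c"
definition cinv :: "('a, 'e) chart \<Rightarrow> 'e \<Rightarrow> 'a" where "cinv c = inv_into (cdom c) (cmap c)"

record ('a, 'e) manifold =
  mtop :: "'a topology"
  atlas :: "('a, 'e) chart set"

definition smooth_manifold :: "('a, 'e::euclidean_space) manifold \<Rightarrow> bool" where
  "smooth_manifold M \<longleftrightarrow>
     Hausdorff_space (mtop M) \<and> second_countable (mtop M) \<and>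
     (\<Union>c\<in>atlas M. cdom c) = topspace (mtop M) \<and>
     (\<forall>c\<in>atlas M. openin (mtop M) (cdom c) \<and> open (cimg c) \<and>
        homeomorphic_map (subtopology (mtop M) (cdom c)) (top_of_set (cimg c)) (cmap c)) \<and>
     (\<forall>c\<in>atlas M. \<forall>c'\<in>atlas M.
        smooth_on (cmap c ` (cdom c \<inter> cdom c')) (\<lambda>x. cmap c' (cinv c x)))"

text \<open>Jacobian at the point \<open>p\<close> of the coordinate change from \<open>c\<close> to \<open>c'\<close>.\<close>
definition jac :: "('a, 'e::euclidean_space) chart \<Rightarrow> ('a, 'e) chart \<Rightarrow> 'a \<Rightarrow> 'e \<Rightarrow> 'e" where
  "jac c c' p = frechet_derivative (\<lambda>x. cmap c' (cinv c x)) (at (cmap c p))"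

definition prod_chart :: "('a, 'e) chart \<Rightarrow> ('b, 'f) chart \<Rightarrow> ('a \<times> 'b, 'e \<times> 'f) chart" where
  "prod_chart c c' = (cdom c \<times> cdom c', map_prod (cmap c) (cmap c'))"

definition prod_manifold ::
  "('a, 'e) manifold \<Rightarrow> ('b, 'f) manifold \<Rightarrow> ('a \<times> 'b, 'e \<times> 'f) manifold" where
  "prod_manifold M N =
     \<lparr> mtop = prod_topology (mtop M) (mtop N),
       atlas = {prod_chart c c' | c c'. c \<in> atlas M \<and> c' \<in> atlas N} \<rparr>"

text \<open>The unit circle, with the two angle functions with values in \<open>(-\<pi>, \<pi>)\<close> and \<open>(0, 2\<pi>)\<close>.\<close>
definition circle :: "(complex, real) manifold" where
  "circle = \<lparr> mtop = top_of_set (sphere 0 1),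
              atlas = {(sphere 0 1 - {-1}, Arg), (sphere 0 1 - {1}, Arg2pi)} \<rparr>"

section \<open>Differential forms\<close>

text \<open>A form is given by its coordinate expressions, one for every chart, which transform by
  pullback under coordinate changes. A coordinate expression maps a point of the chart image and
  a list of vectors to a number. A \<open>k\<close>-form is zero by convention on lists whose length is
  not \<open>k\<close>, off the chart images, and for charts outside the atlas; thus forms are equal iff they are equal
  as functions, and the operations below need neither the degrees nor the manifold as arguments.
  Sums, differences and zero are those of \<^theory>\<open>HOL-Library.Function_Algebras\<close>.\<close>
type_synonym ('a, 'e, 'v) form = "('a, 'e) chart \<Rightarrow> 'e \<Rightarrow> 'e list \<Rightarrow> 'v"

definition is_form ::
  "('a, 'e::euclidean_space) manifold \<Rightarrow> nat \<Rightarrow> ('a, 'e, 'v::real_normed_field) form \<Rightarrow> bool" where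
  "is_form M k \<omega> \<longleftrightarrow>
     (\<forall>c x vs. \<not> (c \<in> atlas M \<and> x \<in> cimg c \<and> length vs = k) \<longrightarrow> \<omega> c x vs = 0) \<and>
     (\<forall>c\<in>atlas M. \<forall>x\<in>cimg c. \<forall>vs. length vs = k \<longrightarrow>
        (\<forall>i<k. linear (\<lambda>v. \<omega> c x (vs[i := v]))) \<and>
        (\<forall>i<k. \<forall>j<k. i \<noteq> j \<and> vs ! i = vs ! j \<longrightarrow> \<omega> c x vs = 0)) \<and>
     (\<forall>c\<in>atlas M. \<forall>vs. smooth_on (cimg c) (\<lambda>x. \<omega> c x vs)) \<and>
     (\<forall>c\<in>atlas M. \<forall>c'\<in>atlas M. \<forall>p\<in>cdom c \<inter> cdom c'. \<forall>vs.
        \<omega> c (cmap c p) vs = \<omega> c' (cmap c' p) (map (jac c c' p) vs))"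

definition fscale :: "'v::real_normed_field \<Rightarrow> ('a, 'e, 'v) form \<Rightarrow> ('a, 'e, 'v) form"
    (infixr "*\<^sub>F" 75) where
  "r *\<^sub>F \<omega> = (\<lambda>c x vs. r * \<omega> c x vs)"

text \<open>The sum runs over all ways to distribute the arguments, in their given order, over the two
  factors, with the sign of the corresponding shuffle. For \<open>1\<close>-forms
  this is \<open>a(v) b(w) - a(w) b(v)\<close>.\<close>
definition wedge ::
  "('a, 'e, 'v::real_normed_field) form \<Rightarrow> ('a, 'e, 'v) form \<Rightarrow> ('a, 'e, 'v) form"
    (infixr "\<and>\<^sub>F" 70) where
  "\<omega> \<and>\<^sub>F \<tau> = (\<lambda>c x vs. \<Sum>I\<in>Pow {..<length vs}.
      (-1) ^ card {(i, j). i \<in> I \<and> j \<in> {..<length vs} - I \<and> j < i}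
      * \<omega> c x (nths vs I) * \<tau> c x (nths vs (- I)))"

text \<open>For constant vector fields in a chart, the commutator terms of the invariant formula for
  the exterior derivative vanish.\<close>
definition ext_d :: "('a, 'e::euclidean_space, 'v::real_normed_field) form \<Rightarrow> ('a, 'e, 'v) form" where
  "ext_d \<omega> = (\<lambda>c x vs. if x \<in> cimg c
      then \<Sum>i<length vs. (-1) ^ i *
             frechet_derivative (\<lambda>y. \<omega> c y (take i vs @ drop (Suc i) vs)) (at x) (vs ! i)
      else 0)"

text \<open>The chart of the target is chosen arbitrarily; for a form on \<open>N\<close> the choice is irrelevant.\<close>
definition pullback ::
  "('a, 'e::euclidean_space) manifold \<Rightarrow> ('b, 'f::euclidean_space) manifold \<Rightarrow> ('a \<Rightarrow> 'b) \<Rightarrow>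
   ('b, 'f, 'v::real_normed_field) form \<Rightarrow> ('a, 'e, 'v) form" where
  "pullback M N f \<omega> = (\<lambda>c x vs. if c \<in> atlas M \<and> x \<in> cimg c
      then let p = cinv c x;
               c' = (SOME c'. c' \<in> atlas N \<and> f p \<in> cdom c')
           in \<omega> c' (cmap c' (f p)) (map (frechet_derivative (\<lambda>y. cmap c' (f (cinv c y))) (at x)) vs)
      else 0)"

definition nowhere_zero ::
  "('a, 'e::euclidean_space) manifold \<Rightarrow> ('a, 'e, 'v::real_normed_field) form \<Rightarrow> bool" where
  "nowhere_zero M \<omega> \<longleftrightarrow> (\<forall>c\<in>atlas M. \<forall>x\<in>cimg c. \<exists>vs. \<omega> c x vs \<noteq> 0)"

definition Re_form :: "('a, 'e, complex) form \<Rightarrow> ('a, 'e, real) form" where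
  "Re_form \<omega> = (\<lambda>c x vs. Re (\<omega> c x vs))"
definition Im_form :: "('a, 'e, complex) form \<Rightarrow> ('a, 'e, real) form" where
  "Im_form \<omega> = (\<lambda>c x vs. Im (\<omega> c x vs))"
definition cnj_form :: "('a, 'e, complex) form \<Rightarrow> ('a, 'e, complex) form" where
  "cnj_form \<omega> = (\<lambda>c x vs. cnj (\<omega> c x vs))"
definition of_real_form :: "('a, 'e, real) form \<Rightarrow> ('a, 'e, complex) form" where
  "of_real_form \<omega> = (\<lambda>c x vs. complex_of_real (\<omega> c x vs))"

text \<open>The complex form \<open>a + i b\<close>.\<close>
definition Complex_form :: "('a, 'e, real) form \<Rightarrow> ('a, 'e, real) form \<Rightarrow> ('a, 'e, complex) form" where
  "Complex_form a b = of_real_form a + \<i> *\<^sub>F of_real_form b"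

section \<open>\<open>SU(2)\<close> structures in dimension 5\<close>

text \<open>On the 4-dimensional space \<open>ker \<eta>\<close> at a point there is a complex structure \<open>J\<close> with respect
  to which \<open>\<Phi>\<close> is of type \<open>(2,0)\<close> and for which \<open>\<omega>1(X,Y) = g(JX,Y)\<close> is the fundamental form of a
  Hermitian metric \<open>g\<close>, that is, \<open>g(X,Y) = \<omega>1(X,JY)\<close> is \<open>J\<close>-invariant and positive definite.
  Forms of type \<open>(1,0)\<close> satisfy \<open>\<alpha>(JX) = i \<alpha>(X)\<close>.\<close>
definition type_20_wrt_at ::
  "('a, 'e::euclidean_space, real) form \<Rightarrow> ('a, 'e, real) form \<Rightarrow> ('a, 'e, complex) form \<Rightarrow>
   ('a, 'e) chart \<Rightarrow> 'e \<Rightarrow> bool" where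
  "type_20_wrt_at \<eta> \<omega>1 \<Phi> c x \<longleftrightarrow> (let K = {X. \<eta> c x [X] = 0} in
     \<exists>J. linear J \<and>
       (\<forall>X\<in>K. J X \<in> K \<and> J (J X) = - X) \<and>
       (\<forall>X\<in>K. \<forall>Y\<in>K. \<omega>1 c x [J X, J Y] = \<omega>1 c x [X, Y]) \<and>
       (\<forall>X\<in>K. X \<noteq> 0 \<longrightarrow> \<omega>1 c x [X, J X] > 0) \<and>
       (\<forall>X\<in>K. \<forall>Y\<in>K. \<Phi> c x [J X, Y] = \<i> * \<Phi> c x [X, Y]))"

definition su2_structure_5 ::
  "('a, 'e::euclidean_space) manifold \<Rightarrow> ('a, 'e, real) form \<Rightarrow> ('a, 'e, real) form \<Rightarrow>
   ('a, 'e, real) form \<Rightarrow> ('a, 'e, real) form \<Rightarrow> bool" where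
  "su2_structure_5 P \<eta> \<omega>1 \<omega>2 \<omega>3 \<longleftrightarrow>
     smooth_manifold P \<and> DIM('e) = 5 \<and>
     is_form P 1 \<eta> \<and> is_form P 2 \<omega>1 \<and> is_form P 2 \<omega>2 \<and> is_form P 2 \<omega>3 \<and>
     (let \<Phi> = Complex_form \<omega>2 \<omega>3 in
        nowhere_zero P (\<eta> \<and>\<^sub>F \<omega>1 \<and>\<^sub>F \<omega>1) \<and>
        \<Phi> \<and>\<^sub>F \<Phi> = 0 \<and>
        of_real_form \<omega>1 \<and>\<^sub>F \<Phi> = 0 \<and>
        \<Phi> \<and>\<^sub>F cnj_form \<Phi> = 2 *\<^sub>F of_real_form (\<omega>1 \<and>\<^sub>F \<omega>1) \<and>
        (\<forall>c\<in>atlas P. \<forall>x\<in>cimg c. type_20_wrt_at \<eta> \<omega>1 \<Phi> c x))"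

definition hypo ::
  "('a, 'e::euclidean_space) manifold \<Rightarrow> ('a, 'e, real) form \<Rightarrow> ('a, 'e, real) form \<Rightarrow>
   ('a, 'e, real) form \<Rightarrow> ('a, 'e, real) form \<Rightarrow> bool" where
  "hypo P \<eta> \<omega>1 \<omega>2 \<omega>3 \<longleftrightarrow>
     su2_structure_5 P \<eta> \<omega>1 \<omega>2 \<omega>3 \<and>
     ext_d \<omega>1 = 0 \<and> ext_d (\<omega>2 \<and>\<^sub>F \<eta>) = 0 \<and> ext_d (\<omega>3 \<and>\<^sub>F \<eta>) = 0"

section \<open>\<open>SU(2)\<close> structures in dimension 6\<close>

text \<open>Like forms, tensor fields are given by their coordinate expressions in the charts of the
  atlas, but their values elsewhere are left unconstrained.\<close>
type_synonym ('a, 'e) endo_field = "('a, 'e) chart \<Rightarrow> 'e \<Rightarrow> 'e \<Rightarrow> 'e"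
type_synonym ('a, 'e) bilin_field = "('a, 'e) chart \<Rightarrow> 'e \<Rightarrow> 'e \<Rightarrow> 'e \<Rightarrow> real"

definition almost_complex ::
  "('a, 'e::euclidean_space) manifold \<Rightarrow> ('a, 'e) endo_field \<Rightarrow> bool" where
  "almost_complex M J \<longleftrightarrow>
     (\<forall>c\<in>atlas M. \<forall>x\<in>cimg c. linear (J c x) \<and> (\<forall>X. J c x (J c x X) = - X)) \<and>
     (\<forall>c\<in>atlas M. \<forall>X. smooth_on (cimg c) (\<lambda>x. J c x X)) \<and>
     (\<forall>c\<in>atlas M. \<forall>c'\<in>atlas M. \<forall>p\<in>cdom c \<inter> cdom c'. \<forall>X.
        jac c c' p (J c (cmap c p) X) = J c' (cmap c' p) (jac c c' p X))"

definition riemannian_metric ::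
  "('a, 'e::euclidean_space) manifold \<Rightarrow> ('a, 'e) bilin_field \<Rightarrow> bool" where
  "riemannian_metric M g \<longleftrightarrow>
     (\<forall>c\<in>atlas M. \<forall>x\<in>cimg c. bilinear (g c x) \<and>
        (\<forall>X Y. g c x X Y = g c x Y X) \<and> (\<forall>X. X \<noteq> 0 \<longrightarrow> g c x X X > 0)) \<and>
     (\<forall>c\<in>atlas M. \<forall>X Y. smooth_on (cimg c) (\<lambda>x. g c x X Y)) \<and>
     (\<forall>c\<in>atlas M. \<forall>c'\<in>atlas M. \<forall>p\<in>cdom c \<inter> cdom c'. \<forall>X Y.
        g c (cmap c p) X Y = g c' (cmap c' p) (jac c c' p X) (jac c c' p Y))"

definition almost_hermitian ::
  "('a, 'e::euclidean_space) manifold \<Rightarrow> ('a, 'e) endo_field \<Rightarrow> ('a, 'e) bilin_field \<Rightarrow> bool" where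
  "almost_hermitian M J g \<longleftrightarrow> almost_complex M J \<and> riemannian_metric M g \<and>
     (\<forall>c\<in>atlas M. \<forall>x\<in>cimg c. \<forall>X Y. g c x (J c x X) (J c x Y) = g c x X Y)"

definition fundamental_form ::
  "('a, 'e) manifold \<Rightarrow> ('a, 'e) endo_field \<Rightarrow> ('a, 'e) bilin_field \<Rightarrow> ('a, 'e, real) form" where
  "fundamental_form M J g = (\<lambda>c x vs. if c \<in> atlas M \<and> x \<in> cimg c \<and> length vs = 2
      then g c x (J c x (vs ! 0)) (vs ! 1) else 0)"

text \<open>\<open>k\<close>-forms of type \<open>(k,0)\<close>.\<close>
definition type_k0 ::
  "('a, 'e) manifold \<Rightarrow> ('a, 'e) endo_field \<Rightarrow> nat \<Rightarrow> ('a, 'e, complex) form \<Rightarrow> bool" where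
  "type_k0 M J k \<omega> \<longleftrightarrow> (\<forall>c\<in>atlas M. \<forall>x\<in>cimg c. \<forall>vs. length vs = k \<longrightarrow>
     (\<forall>i<k. \<omega> c x (vs[i := J c x (vs ! i)]) = \<i> * \<omega> c x vs))"

text \<open>The vector field dual to a real \<open>1\<close>-form.\<close>
definition sharp :: "('a, 'e) bilin_field \<Rightarrow> ('a, 'e, real) form \<Rightarrow> ('a, 'e) chart \<Rightarrow> 'e \<Rightarrow> 'e" where
  "sharp g a c x = (THE X. \<forall>Y. g c x X Y = a c x [Y])"

text \<open>Contraction \<open>i_\<alpha> \<omega>\<close> by the complex vector field dual to the complex \<open>1\<close>-form \<open>\<alpha>\<close>, where \<open>g\<close>
  is extended complex-bilinearly and \<open>\<omega>\<close> complex-linearly.\<close>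
definition contract ::
  "('a, 'e) bilin_field \<Rightarrow> ('a, 'e, complex) form \<Rightarrow> ('a, 'e, complex) form \<Rightarrow> ('a, 'e, complex) form" where
  "contract g \<alpha> \<omega> = (\<lambda>c x vs.
      \<omega> c x (sharp g (Re_form \<alpha>) c x # vs) + \<i> * \<omega> c x (sharp g (Im_form \<alpha>) c x # vs))"

definition su2_structure_6 ::
  "('a, 'e::euclidean_space) manifold \<Rightarrow> ('a, 'e) endo_field \<Rightarrow> ('a, 'e) bilin_field \<Rightarrow>
   ('a, 'e, complex) form \<Rightarrow> ('a, 'e, real) form \<Rightarrow> ('a, 'e, complex) form \<Rightarrow> bool" where
  "su2_structure_6 M J g \<alpha> \<omega> \<Omega> \<longleftrightarrow>
     smooth_manifold M \<and> DIM('e) = 6 \<and>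
     almost_hermitian M J g \<and>
     is_form M 1 \<alpha> \<and> type_k0 M J 1 \<alpha> \<and>
     (\<forall>c\<in>atlas M. \<forall>x\<in>cimg c. contract g (cnj_form \<alpha>) \<alpha> c x [] = 2) \<and>
     is_form M 2 \<omega> \<and>
     is_form M 2 \<Omega> \<and> type_k0 M J 2 \<Omega> \<and>
     of_real_form (\<omega> \<and>\<^sub>F \<omega>) = (1/2) *\<^sub>F (\<Omega> \<and>\<^sub>F cnj_form \<Omega>) \<and>
     nowhere_zero M (\<omega> \<and>\<^sub>F \<omega>) \<and>
     of_real_form \<omega> \<and>\<^sub>F \<Omega> = 0 \<and>
     \<Omega> \<and>\<^sub>F \<Omega> = 0 \<and>
     contract g \<alpha> \<Omega> = 0 \<and>
     contract g \<alpha> (of_real_form \<omega>) = 0 \<and>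
     of_real_form (fundamental_form M J g) = of_real_form \<omega> + (\<i>/2) *\<^sub>F (\<alpha> \<and>\<^sub>F cnj_form \<alpha>)"

section \<open>SUSY equations\<close>

text \<open>The arguments are the angle \<open>\<phi>\<close>, \<open>Re \<Omega>\<close> and \<open>\<omega>\<close>.\<close>
definition proj_par ::
  "real \<Rightarrow> ('a, 'e, real) form \<Rightarrow> ('a, 'e, real) form \<Rightarrow> ('a, 'e, real) form" where
  "proj_par \<phi> R \<omega> = (1/2) *\<^sub>F ((1 - cos (2 * \<phi>)) *\<^sub>F R + sin (2 * \<phi>) *\<^sub>F \<omega>)"
definition proj_perp ::
  "real \<Rightarrow> ('a, 'e, real) form \<Rightarrow> ('a, 'e, real) form \<Rightarrow> ('a, 'e, real) form" where
  "proj_perp \<phi> R \<omega> = (1/2) *\<^sub>F ((1 + cos (2 * \<phi>)) *\<^sub>F R - sin (2 * \<phi>) *\<^sub>F \<omega>)"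

text \<open>\<open>A\<close>, \<open>B\<close>, \<open>C\<close> arise as the forms \<open>Re(\<Omega>)\<^sub>|\<^sub>|\<close>, \<open>Re(\<Omega>)\<^sub>\<bottom>\<close>, \<open>Im(\<Omega>)\<close> from an \<open>SU(2)\<close> structure
  with the given \<open>\<alpha>\<close> and with angle \<open>\<phi>\<close>.\<close>
definition projection_forms ::
  "('a, 'e::euclidean_space) manifold \<Rightarrow> real \<Rightarrow> ('a, 'e, complex) form \<Rightarrow>
   ('a, 'e, real) form \<Rightarrow> ('a, 'e, real) form \<Rightarrow> ('a, 'e, real) form \<Rightarrow> bool" where
  "projection_forms M \<phi> \<alpha> A B C \<longleftrightarrow>
     (\<exists>J g \<omega> \<Omega>. su2_structure_6 M J g \<alpha> \<omega> \<Omega> \<and>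
        A = proj_par \<phi> (Re_form \<Omega>) \<omega> \<and> B = proj_perp \<phi> (Re_form \<Omega>) \<omega> \<and> C = Im_form \<Omega>)"

definition solves_IIA ::
  "('a, 'e::euclidean_space) manifold \<Rightarrow> real \<Rightarrow> real \<Rightarrow> ('a, 'e, complex) form \<Rightarrow>
   ('a, 'e, real) form \<Rightarrow> ('a, 'e, real) form \<Rightarrow> ('a, 'e, real) form \<Rightarrow> bool" where
  "solves_IIA M kpar kperp \<alpha> A B C \<longleftrightarrow>
     (\<exists>\<phi>. - (pi/2) < \<phi> \<and> \<phi> < 0 \<and> kpar = - sin \<phi> \<and> kperp = cos \<phi> \<and> projection_forms M \<phi> \<alpha> A B C) \<and>
     (\<exists>H. is_form M 3 H \<and>
        ext_d (Re_form \<alpha>) = 0 \<and>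
        kpar *\<^sub>F H = kperp *\<^sub>F ext_d C \<and>
        ext_d B = (kpar * kperp) *\<^sub>F (Re_form \<alpha> \<and>\<^sub>F ext_d (Im_form \<alpha>)) \<and>
        H \<and>\<^sub>F Re_form \<alpha> = (- (kperp / kpar)) *\<^sub>F ext_d (Im_form \<alpha> \<and>\<^sub>F A))"

definition solves_IIB ::
  "('a, 'e::euclidean_space) manifold \<Rightarrow> real \<Rightarrow> real \<Rightarrow> ('a, 'e, complex) form \<Rightarrow>
   ('a, 'e, real) form \<Rightarrow> ('a, 'e, real) form \<Rightarrow> ('a, 'e, real) form \<Rightarrow> bool" where
  "solves_IIB M kpar kperp \<alpha> A B C \<longleftrightarrow>
     (\<exists>\<phi>. 0 < \<phi> \<and> \<phi> < pi/2 \<and> kpar = cos \<phi> \<and> kperp = sin \<phi> \<and> projection_forms M \<phi> \<alpha> A B C) \<and>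
     (\<exists>H. is_form M 3 H \<and>
        ext_d (Re_form \<alpha>) = 0 \<and>
        ext_d (Im_form \<alpha>) = 0 \<and>
        kpar *\<^sub>F H = kperp *\<^sub>F ext_d C \<and>
        Re_form \<alpha> \<and>\<^sub>F H = (- (kperp / kpar)) *\<^sub>F (Im_form \<alpha> \<and>\<^sub>F ext_d B) \<and>
        Im_form \<alpha> \<and>\<^sub>F H = (kperp / kpar) *\<^sub>F (Re_form \<alpha> \<and>\<^sub>F ext_d B) \<and>
        Re_form \<alpha> \<and>\<^sub>F Im_form \<alpha> \<and>\<^sub>F ext_d A = - (H \<and>\<^sub>F C))"

end

theory Submission
  imports Defs
begin

text \<open>
  At every point, the forms of an \<open>SU(2)\<close> structure in dimension 5 have a normal form: there is a coframe
  \<open>e1\<close>, \<open>e2\<close>, \<open>e3\<close>, \<open>e4\<close>, \<open>\<eta>\<close> with \<open>\<omega>1 = e\<^sup>1\<^sup>2 + e\<^sup>3\<^sup>4\<close>, \<open>\<omega>2 = e\<^sup>1\<^sup>3 - e\<^sup>2\<^sup>4\<close> and \<open>\<omega>3 = e\<^sup>1\<^sup>4 + e\<^sup>2\<^sup>3\<close>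
  (\<open>adapted_coframe_exists\<close>, \<open>su2_structure_5_coframe\<close>). Every rotation of this orthonormal triple
  yields another one. Solving the definitions of the projections for \<open>\<omega>\<close> and \<open>Re \<Omega>\<close> shows that both
  asserted solutions come from such rotations, about the axis \<open>\<omega>2 = Im \<Omega>\<close>: one has \<open>\<omega> = a \<omega>1 + b \<omega>3\<close> and
  \<open>Re \<Omega> = b \<omega>1 - a \<omega>3\<close>, where \<open>(a, b)\<close> is \<open>(kpar, kperp)\<close> for IIA and \<open>(- kperp, kpar)\<close> for IIB. Together with
  \<open>\<alpha> = \<rho> + i \<sigma>\<close>, where \<open>\<rho>\<close> and \<open>\<sigma>\<close> are multiples of \<open>\<beta>\<close> and \<open>\<eta>\<close>, these forms constitute an \<open>SU(2)\<close> structure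
  on the product (\<open>su2_forms.su2_structure\<close>, \<open>su2_forms_product\<close>).

  The almost Hermitian structure \<open>(J, g)\<close> has to be constructed, globally and smoothly, whereas the
  coframes are only chosen point by point. The way out is that \<open>J X\<close> is the unique solution of the
  equations \<open>S(J X, Y) = T(X, Y)\<close> for all \<open>Y\<close>, with the tensors \<open>S = Re \<Omega> + \<rho> \<and> \<sigma>\<close> (a nondegenerate \<open>2\<close>-form) and
  \<open>T = - Im \<Omega> - \<rho> \<otimes> \<rho> - \<sigma> \<otimes> \<sigma>\<close>. The coframe is used to solve these equations at a point and to verify the
  algebraic identities; uniqueness yields compatibility with coordinate changes, and
  \<open>smooth_on_linear_solution\<close> yields smoothness.

  The equations themselves are then short. As \<open>d\<omega>2 = 0\<close>, the form \<open>H\<close> vanishes. The form \<open>\<beta>\<close> is closed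
  because the circle is one-dimensional, and \<open>\<eta>\<close> and \<open>\<omega>1\<close> are closed by hypothesis. The last equation of IIA
  is \<open>d(\<eta> \<and> \<omega>3) = 0\<close>, a hypo condition, and the last equation of IIB follows from \<open>\<eta> \<and> d\<omega>3 = 0\<close>, which the
  Leibniz rule extracts from the same condition and \<open>d\<eta> = 0\<close>.
\<close>

section \<open>Calculus of smooth functions\<close>

lemma C_k_on_cong:
  assumes "open S" "\<And>x. x \<in> S \<Longrightarrow> f x = g x" "C_k_on k S f"
  shows "C_k_on k S g"
  using assms(2,3)
proof (induction k arbitrary: f g)
  case 0
  then show ?case by (simp cong: continuous_on_cong)
next
  case (Suc k)
  have d: "g differentiable at x" if "x \<in> S" for x
    using Suc.prems that assms(1) unfolding C_k_on.simps(2) differentiable_def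
    by (meson has_derivative_transform_within_open)
  have e: "frechet_derivative f (at x) = frechet_derivative g (at x)" if "x \<in> S" for x
    using Suc.prems that assms(1) by (intro frechet_derivative_transform_within_open[where X=S]) auto
  have "C_k_on k S (\<lambda>x. frechet_derivative g (at x) v)" for v
    using Suc.prems(2) e by (simp add: Suc.IH[of "\<lambda>x. frechet_derivative f (at x) v"])
  then show ?case using d by simp
qed

lemma C_k_on_continuous: "C_k_on k S f \<Longrightarrow> continuous_on S f"
  by (cases k) (auto intro!: continuous_at_imp_continuous_on differentiable_imp_continuous_within)

lemma C_k_on_mono: "C_k_on (Suc k) S f \<Longrightarrow> C_k_on k S f"
proof (induction k arbitrary: f)
  case 0
  then show ?case using C_k_on_continuous by fastforce
next
  case (Suc k)
  then show ?case by simp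
qed

text \<open>The definition of \<open>C_k_on\<close> refers to the chosen derivative \<open>frechet_derivative\<close>. This rule
  accepts any derivative instead, so that the closure properties below can use the derivative
  formulas of the library.\<close>

lemma C_k_on_SucI:
  assumes "open S" "\<And>x. x \<in> S \<Longrightarrow> (f has_derivative D x) (at x)" "\<And>v. C_k_on k S (\<lambda>x. D x v)"
  shows "C_k_on (Suc k) S f"
proof -
  have "frechet_derivative f (at x) = D x" if "x \<in> S" for x
    using assms(2) that frechet_derivative_at by metis
  then have "C_k_on k S (\<lambda>x. frechet_derivative f (at x) v)" for v
    by - (rule C_k_on_cong[OF assms(1) _ assms(3)], simp)
  then show ?thesis using assms(2) by (auto simp: differentiable_def)
qed

lemma C_k_on_SucD:
  assumes "C_k_on (Suc k) S f" "x \<in> S"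
  shows "(f has_derivative frechet_derivative f (at x)) (at x)"
  using assms frechet_derivative_works by auto

lemma C_k_on_const: "C_k_on k S (\<lambda>x. c)"
  by (induction k arbitrary: c) (auto simp: )

lemma C_k_on_bounded_linear:
  assumes "bounded_linear L" "open S" "C_k_on k S f"
  shows "C_k_on k S (\<lambda>x. L (f x))"
  using assms(3)
proof (induction k arbitrary: f)
  case 0
  then show ?case
    by (auto intro!: bounded_linear.continuous_on[OF assms(1)])
next
  case (Suc k)
  show ?case
    by (rule C_k_on_SucI[OF assms(2) bounded_linear.has_derivative[OF assms(1) C_k_on_SucD[OF Suc.prems]]])
       (use Suc in auto)
qed

lemma C_k_on_add:
  assumes "open S" "C_k_on k S f" "C_k_on k S g"
  shows "C_k_on k S (\<lambda>x. f x + g x)"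
  using assms(2,3)
proof (induction k arbitrary: f g)
  case 0
  then show ?case by (auto intro!: continuous_intros)
next
  case (Suc k)
  show ?case
    by (rule C_k_on_SucI[OF assms(1) has_derivative_add[OF C_k_on_SucD[OF Suc.prems(1)] C_k_on_SucD[OF Suc.prems(2)]]])
       (use Suc in auto)
qed

text \<open>By the product rule the derivative is a sum of two products of the same kind with one degree of
  differentiability less, so the induction closes.\<close>

lemma C_k_on_bilinear:
  assumes "bounded_bilinear pr" "open S" "C_k_on k S f" "C_k_on k S g"
  shows "C_k_on k S (\<lambda>x. pr (f x) (g x))"
  using assms(3,4)
proof (induction k arbitrary: f g)
  case 0
  then show ?case by (auto intro!: bounded_bilinear.continuous_on[OF assms(1)])
next
  case (Suc k)
  show ?case
    by (rule C_k_on_SucI[OF assms(2) bounded_bilinear.FDERIV[OF assms(1) C_k_on_SucD[OF Suc.prems(1)] C_k_on_SucD[OF Suc.prems(2)]]])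
       (use Suc C_k_on_mono[OF Suc.prems(1)] C_k_on_mono[OF Suc.prems(2)] in \<open>auto intro!: C_k_on_add assms(2)\<close>)
qed

lemma C_k_on_compose_linear:
  assumes "bounded_linear L" "open T" "\<And>x. x \<in> T \<Longrightarrow> L x \<in> S" "C_k_on k S f"
  shows "C_k_on k T (\<lambda>x. f (L x))"
  using assms(4)
proof (induction k arbitrary: f)
  case 0
  then have "continuous_on S f" by simp
  then have "continuous_on T (\<lambda>x. f (L x))"
    by (rule continuous_on_compose2[OF _ linear_continuous_on[OF assms(1)]]) (use assms(3) in auto)
  then show ?case by simp
next
  case (Suc k)
  have "((\<lambda>x. f (L x)) has_derivative (\<lambda>v. frechet_derivative f (at (L x)) (L v))) (at x)" if "x \<in> T" for x
    using diff_chain_at[OF bounded_linear.has_derivative[OF assms(1) has_derivative_ident] C_k_on_SucD[OF Suc.prems assms(3)[OF that]]]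
    by (simp add: o_def)
  then show ?case
    by (rule C_k_on_SucI[OF assms(2)]) (use Suc in auto)
qed

lemma smooth_on_cong: "open S \<Longrightarrow> (\<And>x. x \<in> S \<Longrightarrow> f x = g x) \<Longrightarrow> smooth_on S f \<Longrightarrow> smooth_on S g"
  unfolding smooth_on_def using C_k_on_cong by blast

lemma smooth_on_const: "smooth_on S (\<lambda>x. c)"
  by (simp add: smooth_on_def C_k_on_const)

lemma smooth_on_bounded_linear: "bounded_linear L \<Longrightarrow> open S \<Longrightarrow> smooth_on S f \<Longrightarrow> smooth_on S (\<lambda>x. L (f x))"
  by (simp add: smooth_on_def C_k_on_bounded_linear)

lemma smooth_on_add: "open S \<Longrightarrow> smooth_on S f \<Longrightarrow> smooth_on S g \<Longrightarrow> smooth_on S (\<lambda>x. f x + g x)"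
  by (simp add: smooth_on_def C_k_on_add)

lemma smooth_on_minus: "open S \<Longrightarrow> smooth_on S f \<Longrightarrow> smooth_on S (\<lambda>x. - f x)"
  by (simp add: smooth_on_bounded_linear bounded_linear_minus)

lemma smooth_on_diff:
  "open S \<Longrightarrow> smooth_on S f \<Longrightarrow> smooth_on S g \<Longrightarrow> smooth_on S (\<lambda>x. f x - g x)"
  using smooth_on_add[of S f "\<lambda>x. - g x"] by (simp add: smooth_on_minus)

lemma smooth_on_mult:
  fixes f g :: "'e::euclidean_space \<Rightarrow> 'v::real_normed_algebra"
  shows "open S \<Longrightarrow> smooth_on S f \<Longrightarrow> smooth_on S g \<Longrightarrow> smooth_on S (\<lambda>x. f x * g x)"
  by (simp add: smooth_on_def C_k_on_bilinear[OF bounded_bilinear_mult])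

lemma smooth_on_scaleR:
  "open S \<Longrightarrow> smooth_on S f \<Longrightarrow> smooth_on S g \<Longrightarrow> smooth_on S (\<lambda>x. f x *\<^sub>R g x)"
  by (simp add: smooth_on_def C_k_on_bilinear[OF bounded_bilinear_scaleR])

lemma smooth_on_sum:
  "open S \<Longrightarrow> (\<And>i. i \<in> I \<Longrightarrow> smooth_on S (f i)) \<Longrightarrow> smooth_on S (\<lambda>x. \<Sum>i\<in>I. f i x)"
  by (induction I rule: infinite_finite_induct) (auto intro!: smooth_on_add smooth_on_const)

lemma smooth_on_compose_linear:
  "bounded_linear L \<Longrightarrow> open T \<Longrightarrow> (\<And>x. x \<in> T \<Longrightarrow> L x \<in> S) \<Longrightarrow> smooth_on S f \<Longrightarrow> smooth_on T (\<lambda>x. f (L x))"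
  unfolding smooth_on_def using C_k_on_compose_linear by blast

lemma smooth_on_Pair:
  assumes "open S" "smooth_on S f" "smooth_on S g"
  shows "smooth_on S (\<lambda>x. (f x, g x))"
  using smooth_on_add[OF assms(1) smooth_on_bounded_linear[of "\<lambda>x. (x, 0)", OF _ assms(1,2)]
      smooth_on_bounded_linear[of "\<lambda>x. (0, x)", OF _ assms(1,3)]]
  by (simp add: bounded_linear_Pair bounded_linear_ident bounded_linear_zero)

lemma smooth_on_differentiable: "smooth_on S f \<Longrightarrow> x \<in> S \<Longrightarrow> f differentiable at x"
  unfolding smooth_on_def using C_k_on.simps(2) by blast

text \<open>The coordinate changes of the circle are of this kind: on the two components of their domain they
  are different translations.\<close>

lemma smooth_on_constant_derivative:
  assumes "open S" "\<And>x. x \<in> S \<Longrightarrow> (f has_derivative D) (at x)"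
  shows "smooth_on S f"
  unfolding smooth_on_def
proof
  fix k
  have "C_k_on (Suc k) S f"
    by (rule C_k_on_SucI[OF assms C_k_on_const])
  then show "C_k_on k S f" by (rule C_k_on_mono)
qed

section \<open>Smooth dependence of solutions of linear equations\<close>

lemma linear_componentwise_Basis:
  fixes A :: "'f::euclidean_space \<Rightarrow> 'g::real_vector"
  assumes "linear A"
  shows "A Z = (\<Sum>b\<in>Basis. (Z \<bullet> b) *\<^sub>R A b)"
proof -
  have "A (\<Sum>b\<in>Basis. (Z \<bullet> b) *\<^sub>R b) = (\<Sum>b\<in>Basis. (Z \<bullet> b) *\<^sub>R A b)"
    using assms by (simp add: linear_sum linear_cmul)
  then show ?thesis by (simp add: euclidean_representation)
qed

text \<open>An injective linear map is bounded below, and on a finite-dimensional space pointwise continuity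
  of a family of linear maps is continuity in operator norm, by testing on the basis.\<close>

lemma linear_family_bounded_below:
  fixes B :: "'e::euclidean_space \<Rightarrow> 'f::euclidean_space \<Rightarrow> 'f"
  assumes "open S" "x \<in> S" and Blin: "\<And>y. y \<in> S \<Longrightarrow> linear (B y)" and "inj (B x)"
    and B: "\<And>Z. isCont (\<lambda>y. B y Z) x"
  shows "\<exists>c>0. eventually (\<lambda>y. \<forall>v. c * norm v \<le> norm (B y v)) (at x)"
proof -
  have lin: "linear (B x)" using assms by auto
  obtain c where c: "c > 0" "\<And>v. c * norm v \<le> norm (B x v)"
    using linear_inj_bounded_below_pos[OF lin \<open>inj (B x)\<close>] by (metis mult.commute)
  have nb: "eventually (\<lambda>y. \<forall>b\<in>Basis. norm (B y b - B x b) < c / (2 * DIM('f))) (at x)"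
  proof (rule eventually_ball_finite, simp, rule ballI)
    fix b :: 'f assume "b \<in> Basis"
    have "((\<lambda>y. B y b) \<longlongrightarrow> B x b) (at x)"
      using B[of b] by (simp add: isCont_def)
    moreover have "c / (2 * DIM('f)) > 0" using c by simp
    ultimately show "\<forall>\<^sub>F y in at x. norm (B y b - B x b) < c / (2 * DIM('f))"
      by (simp add: tendsto_iff dist_norm)
  qed
  have lower: "eventually (\<lambda>y. \<forall>v. (c/2) * norm v \<le> norm (B y v)) (at x)"
    using nb eventually_at_in_open'[OF \<open>open S\<close> \<open>x \<in> S\<close>]
  proof eventually_elim
    case (elim y)
    show ?case
    proof
      fix v :: 'f
      have exp: "B z v = (\<Sum>b\<in>Basis. (v \<bullet> b) *\<^sub>R B z b)" if "z \<in> S" for z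
        by (rule linear_componentwise_Basis[OF Blin[OF that]])
      have "norm (B y v - B x v) = norm (\<Sum>b\<in>Basis. (v \<bullet> b) *\<^sub>R (B y b - B x b))"
        using exp[OF elim(2)] exp[OF \<open>x \<in> S\<close>] by (simp add: scaleR_diff_right sum_subtractf)
      also have "\<dots> \<le> (\<Sum>b\<in>(Basis::'f set). norm v * (c / (2 * DIM('f))))"
        using elim(1) by (intro sum_norm_le) (auto simp del: times_divide_eq_right intro!: mult_mono simp: Basis_le_norm less_imp_le)
      also have "\<dots> = (c/2) * norm v" by simp
      finally show "(c/2) * norm v \<le> norm (B y v)"
        using c(2)[of v] norm_triangle_ineq2[of "B x v" "B y v"] by (simp add: norm_minus_commute)
    qed
  qed
  then show ?thesis using c(1) by (intro exI[of _ "c/2"]) auto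
qed

text \<open>Implicit differentiation of \<open>B y (f y) = h y\<close>. The candidate derivative \<open>L\<close> is read off from
  \<open>B x (L v) = h' v - B' v (f x)\<close>. Applying \<open>B y\<close> to the error \<open>f y - f x - L (y - x)\<close> gives a quantity
  \<open>R y\<close> in which \<open>f y\<close> no longer occurs and whose derivative at \<open>x\<close> vanishes; the lower bound on \<open>B y\<close>
  then shows that the error itself is of lower order. Continuity of \<open>f\<close> is thus a consequence.\<close>

lemma has_derivative_linear_solution:
  fixes B :: "'e::euclidean_space \<Rightarrow> 'f::euclidean_space \<Rightarrow> 'f"
  assumes "open S" "x \<in> S" "\<And>y. y \<in> S \<Longrightarrow> linear (B y)" "inj (B x)"
    and B: "\<And>Z. ((\<lambda>y. B y Z) has_derivative (\<lambda>v. B' v Z)) (at x)"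
    and h: "(h has_derivative h') (at x)"
    and f: "\<And>y. y \<in> S \<Longrightarrow> B y (f y) = h y"
  shows "\<exists>L. (f has_derivative L) (at x) \<and> (\<forall>v. B x (L v) = h' v - B' v (f x))"
proof -
  have lin: "linear (B x)" using assms by auto
  have cont: "isCont (\<lambda>y. B y Z) x" for Z
    using has_derivative_continuous[OF B] by (simp add: continuous_at)
  obtain c where c: "c > 0" and lower: "eventually (\<lambda>y. \<forall>v. c * norm v \<le> norm (B y v)) (at x)"
    using linear_family_bounded_below[OF assms(1-4) cont] by blast
  obtain Bi where Bi: "linear Bi" "\<And>v. B x (Bi v) = v" "\<And>v. Bi (B x v) = v"
    using linear_injective_isomorphism[OF lin \<open>inj (B x)\<close>] by metis
  have expB': "B' v Z = (\<Sum>b\<in>Basis. (Z \<bullet> b) *\<^sub>R B' v b)" for v Z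
  proof -
    have 1: "((\<lambda>y. \<Sum>b\<in>Basis. (Z \<bullet> b) *\<^sub>R B y b) has_derivative (\<lambda>v. \<Sum>b\<in>Basis. (Z \<bullet> b) *\<^sub>R B' v b)) (at x)"
      by (intro has_derivative_sum has_derivative_scaleR_right B)
    have "(\<Sum>b\<in>Basis. (Z \<bullet> b) *\<^sub>R B y b) = B y Z" if "y \<in> S" for y
      using linear_componentwise_Basis[OF assms(3)[OF that]] by metis
    then have "((\<lambda>y. B y Z) has_derivative (\<lambda>v. \<Sum>b\<in>Basis. (Z \<bullet> b) *\<^sub>R B' v b)) (at x)"
      using has_derivative_transform_within_open[OF 1 \<open>open S\<close> \<open>x \<in> S\<close>] by simp
    then show ?thesis using has_derivative_unique[OF B] by metis
  qed
  define L where "L v = Bi (h' v - B' v (f x))" for v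
  have linL: "linear L"
  proof -
    have "linear (\<lambda>v. h' v - B' v (f x))"
      using has_derivative_linear[OF h] has_derivative_linear[OF B] linear_compose_sub by blast
    then show ?thesis unfolding L_def using Bi(1) linear_compose[of _ Bi] by (simp add: o_def)
  qed
  define R where "R y = h y - B y (f x) - B y (L (y - x))" for y
  have "((\<lambda>y. B y (L (y - x))) has_derivative (\<lambda>v. B x (L v))) (at x)"
  proof -
    have "((\<lambda>y. L (y - x)) has_derivative L) (at x)"
      using linL by (intro bounded_linear.has_derivative[of L "\<lambda>y. y - x" "\<lambda>v. v"])
        (auto intro!: derivative_eq_intros simp: linear_conv_bounded_linear)
    then have c: "((\<lambda>y. L (y - x) \<bullet> b) has_derivative (\<lambda>v. L v \<bullet> b)) (at x)" for b
      by (rule has_derivative_inner_left)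
    have 1: "((\<lambda>y. \<Sum>b\<in>Basis. (L (y - x) \<bullet> b) *\<^sub>R B y b) has_derivative
        (\<lambda>v. \<Sum>b\<in>Basis. (L (x - x) \<bullet> b) *\<^sub>R B' v b + (L v \<bullet> b) *\<^sub>R B x b)) (at x)"
      by (intro has_derivative_sum has_derivative_scaleR B c)
    have e: "(\<Sum>b\<in>Basis. (Z \<bullet> b) *\<^sub>R B y b) = B y Z" if "y \<in> S" for y Z
      using linear_componentwise_Basis[OF assms(3)[OF that]] by metis
    have "L 0 = 0" using linL linear_0 by blast
    then have "((\<lambda>y. \<Sum>b\<in>Basis. (L (y - x) \<bullet> b) *\<^sub>R B y b) has_derivative (\<lambda>v. B x (L v))) (at x)"
      using 1 e[OF \<open>x \<in> S\<close>] by simp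
    then show ?thesis
      by (rule has_derivative_transform_within_open[OF _ \<open>open S\<close> \<open>x \<in> S\<close>]) (rule e)
  qed
  then have "(R has_derivative (\<lambda>v. h' v - B' v (f x) - B x (L v))) (at x)"
    unfolding R_def by (intro has_derivative_diff h B)
  then have R0: "(R has_derivative (\<lambda>v. 0)) (at x)" by (simp add: L_def Bi)
  have Rx: "R x = 0" unfolding R_def using f[OF \<open>x \<in> S\<close>] linear_0[OF linL] linear_0[OF lin] by simp
  have "(f has_derivative L) (at x)"
    unfolding has_derivative_at_within
  proof
    show "bounded_linear L" using linL by (simp add: linear_conv_bounded_linear)
    have lim: "((\<lambda>y. (1/c) * norm ((R y - R x - 0) /\<^sub>R norm (y - x))) \<longlongrightarrow> (1/c) * norm (0::'f)) (at x)"
      using R0 unfolding has_derivative_at_within by (intro tendsto_intros) auto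
    show "((\<lambda>y. (f y - f x - L (y - x)) /\<^sub>R norm (y - x)) \<longlongrightarrow> 0) (at x)"
    proof (rule Lim_null_comparison[OF _ lim[simplified]])
      show "\<forall>\<^sub>F y in at x. norm ((f y - f x - L (y - x)) /\<^sub>R norm (y - x))
              \<le> inverse (norm (y - x)) * norm (R y - R x) / c"
        using lower eventually_at_in_open'[OF \<open>open S\<close> \<open>x \<in> S\<close>]
      proof eventually_elim
        case (elim y)
        have "B y (f y - f x - L (y - x)) = R y"
          using assms(3)[OF elim(2)] f[OF elim(2)] by (simp add: R_def linear_diff)
        then have "c * norm (f y - f x - L (y - x)) \<le> norm (R y)" using elim(1) by metis
        then have "norm (f y - f x - L (y - x)) \<le> norm (R y) / c" using c by (simp add: field_simps)
        then have "inverse (norm (y - x)) * norm (f y - f x - L (y - x))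
            \<le> inverse (norm (y - x)) * (norm (R y) / c)"
          by (rule mult_left_mono) simp
        then show ?case using Rx by simp
      qed
    qed
  qed
  then show ?thesis by (auto simp: L_def Bi intro!: exI[of _ L])
qed

text \<open>By induction on \<open>k\<close>: differentiating the equation shows that the derivative of the solution
  solves a system with the same coefficients \<open>B\<close>, whose right-hand side involves \<open>f\<close> itself and the
  derivative of \<open>h\<close>. For this reason the statement proved by induction quantifies over all right-hand
  sides of class \<open>C\<^sup>k\<close>, while \<open>B\<close> stays fixed and smooth.\<close>

lemma smooth_on_linear_solution:
  fixes B :: "'e::euclidean_space \<Rightarrow> 'f::euclidean_space \<Rightarrow> 'f"
  assumes "open S" "\<And>x. x \<in> S \<Longrightarrow> linear (B x)" "\<And>x. x \<in> S \<Longrightarrow> inj (B x)"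
    and B: "\<And>Z. smooth_on S (\<lambda>x. B x Z)" and h: "smooth_on S h"
    and f: "\<And>x. x \<in> S \<Longrightarrow> B x (f x) = h x"
  shows "smooth_on S f"
proof -
  have fd: "(f has_derivative frechet_derivative f (at x)) (at x) \<and>
      (\<forall>v. B x (frechet_derivative f (at x) v) = 
         frechet_derivative h (at x) v - frechet_derivative (\<lambda>y. B y (f x)) (at x) v)"
    if x: "x \<in> S" and f: "\<And>x. x \<in> S \<Longrightarrow> B x (f x) = h x" and h: "h differentiable at x" for x f h
  proof -
    have "((\<lambda>y. B y Z) has_derivative (\<lambda>v. frechet_derivative (\<lambda>y. B y Z) (at x) v)) (at x)" for Z
      using smooth_on_differentiable[OF B x, unfolded frechet_derivative_works] .
    moreover have "(h has_derivative frechet_derivative h (at x)) (at x)"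
      using h frechet_derivative_works by blast
    ultimately have "\<exists>L. (f has_derivative L) (at x) \<and> (\<forall>v. B x (L v) =
         frechet_derivative h (at x) v - (\<lambda>v Z. frechet_derivative (\<lambda>y. B y Z) (at x) v) v (f x))"
      by (intro has_derivative_linear_solution[where B = B and f = f and h = h and S = S
          and B' = "\<lambda>v Z. frechet_derivative (\<lambda>y. B y Z) (at x) v"])
        (use assms(1-3) x f in auto)
    then obtain L where L: "(f has_derivative L) (at x)" "\<forall>v. B x (L v) =
         frechet_derivative h (at x) v - frechet_derivative (\<lambda>y. B y (f x)) (at x) v"
      by blast
    then have "L = frechet_derivative f (at x)" using frechet_derivative_at by blast
    then show ?thesis using L by simp
  qed
  have expB: "frechet_derivative (\<lambda>y. B y Z) (at x) v =
      (\<Sum>b\<in>Basis. (Z \<bullet> b) *\<^sub>R frechet_derivative (\<lambda>y. B y b) (at x) v)" if x: "x \<in> S" for x Z v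
  proof -
    have 1: "((\<lambda>y. \<Sum>b\<in>Basis. (Z \<bullet> b) *\<^sub>R B y b) has_derivative
        (\<lambda>v. \<Sum>b\<in>Basis. (Z \<bullet> b) *\<^sub>R frechet_derivative (\<lambda>y. B y b) (at x) v)) (at x)"
      using smooth_on_differentiable[OF B x] frechet_derivative_works
      by (intro has_derivative_sum has_derivative_scaleR_right) blast
    have "(\<Sum>b\<in>Basis. (Z \<bullet> b) *\<^sub>R B y b) = B y Z" if "y \<in> S" for y
      using linear_componentwise_Basis[OF assms(2)[OF that]] by metis
    then have "((\<lambda>y. B y Z) has_derivative
        (\<lambda>v. \<Sum>b\<in>Basis. (Z \<bullet> b) *\<^sub>R frechet_derivative (\<lambda>y. B y b) (at x) v)) (at x)"
      using has_derivative_transform_within_open[OF 1 \<open>open S\<close> x] by simp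
    from fun_cong[OF frechet_derivative_at[OF this], of v] show ?thesis by (rule sym)
  qed
  have "C_k_on k S f" if "C_k_on k S h" "\<And>x. x \<in> S \<Longrightarrow> B x (f x) = h x" for k f h
    using that
  proof (induction k arbitrary: f h)
    case 0
    have "isCont f x" if x: "x \<in> S" for x
    proof -
      have cont: "isCont (\<lambda>y. B y Z) x" for Z
        using smooth_on_differentiable[OF B x] differentiable_imp_continuous_within by blast
      obtain c where c: "c > 0" and lower: "eventually (\<lambda>y. \<forall>v. c * norm v \<le> norm (B y v)) (at x)"
        using linear_family_bounded_below[OF \<open>open S\<close> x assms(2) assms(3)[OF x] cont] by blast
      have "isCont h x" using 0(1) x \<open>open S\<close> by (simp add: continuous_on_eq_continuous_at)
      then have lim: "((\<lambda>y. norm (h y - B y (f x)) / c) \<longlongrightarrow> norm (h x - B x (f x)) / c) (at x)"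
        using cont[of "f x"] c by (intro tendsto_intros) (auto simp: isCont_def)
      have "((\<lambda>y. f y - f x) \<longlongrightarrow> 0) (at x)"
      proof (rule Lim_null_comparison)
        show "((\<lambda>y. norm (h y - B y (f x)) / c) \<longlongrightarrow> 0) (at x)" using lim 0(2)[OF x] by simp
        show "\<forall>\<^sub>F y in at x. norm (f y - f x) \<le> norm (h y - B y (f x)) / c"
          using lower eventually_at_in_open'[OF \<open>open S\<close> x]
        proof eventually_elim
          case (elim y)
          have "B y (f y - f x) = h y - B y (f x)"
            using assms(2)[OF elim(2)] 0(2)[OF elim(2)] by (simp add: linear_diff)
          then have "c * norm (f y - f x) \<le> norm (h y - B y (f x))" using elim(1) by metis
          then show ?case using c by (simp add: field_simps)
        qed
      qed
      then show ?thesis by (simp add: isCont_def LIM_zero_iff)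
    qed
    then show ?case by (auto intro: continuous_at_imp_continuous_on)
  next
    case (Suc k)
    have hd: "h differentiable at x" if "x \<in> S" for x using Suc.prems(1) that by simp
    note fd' = fd[OF _ Suc.prems(2) hd]
    have fk: "C_k_on k S f" using Suc.IH[OF C_k_on_mono] Suc.prems by blast
    show ?case
    proof (rule C_k_on_SucI[OF \<open>open S\<close>])
      show "(f has_derivative frechet_derivative f (at x)) (at x)" if "x \<in> S" for x
        using fd' that by blast
      fix v
      have "C_k_on k S (\<lambda>x. frechet_derivative (\<lambda>y. B y b) (at x) v)" for b
        using B unfolding smooth_on_def by (metis C_k_on.simps(2))
      then have "C_k_on k S (\<lambda>x. \<Sum>b\<in>A. (f x \<bullet> b) *\<^sub>R frechet_derivative (\<lambda>y. B y b) (at x) v)" for A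
        by (induction A rule: infinite_finite_induct)
          (auto intro!: C_k_on_add C_k_on_const C_k_on_bilinear[OF bounded_bilinear_scaleR]
            C_k_on_bounded_linear[OF bounded_linear_inner_left] fk \<open>open S\<close>)
      then have "C_k_on k S (\<lambda>x. frechet_derivative (\<lambda>y. B y (f x)) (at x) v)"
        by (rule C_k_on_cong[OF \<open>open S\<close>, rotated]) (rule expB[symmetric])
      moreover have "C_k_on k S (\<lambda>x. frechet_derivative h (at x) v)" using Suc.prems(1) by simp
      ultimately have "C_k_on k S (\<lambda>x. frechet_derivative h (at x) v + - frechet_derivative (\<lambda>y. B y (f x)) (at x) v)"
        by (intro C_k_on_add C_k_on_bounded_linear[OF bounded_linear_minus[OF bounded_linear_ident]] \<open>open S\<close>)
      then show "C_k_on k S (\<lambda>x. frechet_derivative f (at x) v)"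
        by (rule Suc.IH) (use fd' in auto)
    qed
  qed
  then show ?thesis using h f unfolding smooth_on_def by blast
qed

section \<open>Wedge products and exterior derivatives in low degrees\<close>

text \<open>The part of being a \<open>k\<close>-form that the algebra of wedge products needs.\<close>

definition homogeneous :: "nat \<Rightarrow> ('a, 'e, 'v::real_normed_field) form \<Rightarrow> bool" where
  "homogeneous k \<omega> \<longleftrightarrow> (\<forall>c x vs. length vs \<noteq> k \<longrightarrow> \<omega> c x vs = 0)"

lemma homogeneousD: "homogeneous k \<omega> \<Longrightarrow> length vs \<noteq> k \<Longrightarrow> \<omega> c x vs = 0"
  unfolding homogeneous_def by blast

lemma is_form_outside:
  "is_form M k \<omega> \<Longrightarrow> \<not> (c \<in> atlas M \<and> x \<in> cimg c \<and> length vs = k) \<Longrightarrow> \<omega> c x vs = 0"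
  by (drule conjunct1[OF iffD1[OF is_form_def]]) (simp only: simp_thms)

lemma is_form_homogeneous: "is_form M k \<omega> \<Longrightarrow> homogeneous k \<omega>"
  unfolding homogeneous_def using is_form_outside by blast

lemma homogeneous_wedge:
  assumes "homogeneous k \<omega>" "homogeneous l \<tau>"
  shows "homogeneous (k + l) (\<omega> \<and>\<^sub>F \<tau>)"
  unfolding homogeneous_def wedge_def
proof (intro allI impI sum.neutral ballI)
  fix c x and vs :: "'b list" and I assume n: "length vs \<noteq> k + l" and I: "I \<in> Pow {..<length vs}"
  have "length (nths vs I) + length (nths vs (- I)) = length vs"
  proof -
    have "card {i. i < length vs \<and> i \<in> I} + card {i. i < length vs \<and> i \<in> - I}
        = card ({i. i < length vs \<and> i \<in> I} \<union> {i. i < length vs \<and> i \<in> - I})"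
      by (subst card_Un_disjoint) auto
    also have "{i. i < length vs \<and> i \<in> I} \<union> {i. i < length vs \<and> i \<in> - I} = {..<length vs}" by auto
    finally show ?thesis by (simp add: length_nths)
  qed
  then have "length (nths vs I) \<noteq> k \<or> length (nths vs (- I)) \<noteq> l" using n by auto
  then show "(-1) ^ card {(i, j). i \<in> I \<and> j \<in> {..<length vs} - I \<and> j < i}
      * \<omega> c x (nths vs I) * \<tau> c x (nths vs (- I)) = 0"
    using assms by (auto simp: homogeneousD)
qed

lemma sum_Pow_lessThan_Suc:
  "sum f (Pow {..<Suc n}) = sum f (Pow {..<n}) + sum (\<lambda>I. f (insert n I)) (Pow {..<n})"
proof -
  have "sum f (Pow {..<Suc n}) = sum f (Pow {..<n} \<union> insert n ` Pow {..<n})"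
    by (simp add: lessThan_Suc Pow_insert)
  also have "\<dots> = sum f (Pow {..<n}) + sum f (insert n ` Pow {..<n})"
    by (rule sum.union_disjoint) auto
  also have "sum f (insert n ` Pow {..<n}) = sum (\<lambda>I. f (insert n I)) (Pow {..<n})"
    by (subst sum.reindex) (auto simp: inj_on_def)
  finally show ?thesis .
qed

text \<open>Unlike a cardinality, a double sum over explicit index ranges evaluates by rewriting; this yields the
  expansions of wedge products of low degree below.\<close>

lemma card_inversions:
  assumes "I \<subseteq> {..<n::nat}"
  shows "card {(i, j). i \<in> I \<and> j \<in> {..<n} - I \<and> j < i}
       = (\<Sum>i<n. \<Sum>j<n. if i \<in> I \<and> j \<notin> I \<and> j < i then 1 else 0)"
proof -
  have "{(i, j). i \<in> I \<and> j \<in> {..<n} - I \<and> j < i} = {p \<in> {..<n} \<times> {..<n}. fst p \<in> I \<and> snd p \<notin> I \<and> snd p < fst p}"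
    using assms by auto
  then have "card {(i, j). i \<in> I \<and> j \<in> {..<n} - I \<and> j < i}
      = (\<Sum>p\<in>{..<n} \<times> {..<n}. if fst p \<in> I \<and> snd p \<notin> I \<and> snd p < fst p then 1 else 0)"
    by (simp only: card_eq_sum) (rule sum.inter_filter[OF finite_cartesian_product[OF finite_lessThan finite_lessThan]])
  then show ?thesis by (simp only: sum.cartesian_product case_prod_unfold)
qed

lemma wedge_inversions:
  "(\<omega> \<and>\<^sub>F \<tau>) c x vs = (\<Sum>I\<in>Pow {..<length vs}.
      (-1) ^ (\<Sum>i<length vs. \<Sum>j<length vs. if i \<in> I \<and> j \<notin> I \<and> j < i then 1 else 0)
      * \<omega> c x (nths vs I) * \<tau> c x (nths vs (- I)))"
  unfolding wedge_def by (rule sum.cong[OF refl]) (simp only: card_inversions Pow_iff)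

lemmas wedge_expand = wedge_inversions sum_Pow_lessThan_Suc nths_Cons homogeneousD

lemma wedge_1_1:
  assumes "homogeneous 1 \<omega>" "homogeneous 1 \<tau>"
  shows "(\<omega> \<and>\<^sub>F \<tau>) c x [u, v] = \<omega> c x [u] * \<tau> c x [v] - \<omega> c x [v] * \<tau> c x [u]"
  using assms by (simp add: wedge_expand)

lemma wedge_1_2:
  assumes "homogeneous 1 \<omega>" "homogeneous 2 \<tau>"
  shows "(\<omega> \<and>\<^sub>F \<tau>) c x [u, v, w] =
    \<omega> c x [u] * \<tau> c x [v, w] - \<omega> c x [v] * \<tau> c x [u, w] + \<omega> c x [w] * \<tau> c x [u, v]"
  using assms by (simp add: wedge_expand)

lemma wedge_2_1:
  assumes "homogeneous 2 \<omega>" "homogeneous 1 \<tau>"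
  shows "(\<omega> \<and>\<^sub>F \<tau>) c x [u, v, w] =
    \<omega> c x [u, v] * \<tau> c x [w] - \<omega> c x [u, w] * \<tau> c x [v] + \<omega> c x [v, w] * \<tau> c x [u]"
  using assms by (simp add: wedge_expand)

lemma wedge_1_3:
  assumes "homogeneous 1 \<omega>" "homogeneous 3 \<tau>"
  shows "(\<omega> \<and>\<^sub>F \<tau>) c x [t, u, v, w] =
    \<omega> c x [t] * \<tau> c x [u, v, w] - \<omega> c x [u] * \<tau> c x [t, v, w]
    + \<omega> c x [v] * \<tau> c x [t, u, w] - \<omega> c x [w] * \<tau> c x [t, u, v]"
  using assms by (simp add: wedge_expand)

lemma wedge_2_2:
  assumes "homogeneous 2 \<omega>" "homogeneous 2 \<tau>"
  shows "(\<omega> \<and>\<^sub>F \<tau>) c x [t, u, v, w] =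
    \<omega> c x [t, u] * \<tau> c x [v, w] - \<omega> c x [t, v] * \<tau> c x [u, w] + \<omega> c x [t, w] * \<tau> c x [u, v]
    + \<omega> c x [u, v] * \<tau> c x [t, w] - \<omega> c x [u, w] * \<tau> c x [t, v] + \<omega> c x [v, w] * \<tau> c x [t, u]"
  using assms by (simp add: wedge_expand)

lemma form_eqI_homogeneous:
  assumes "homogeneous k \<omega>" "homogeneous k \<tau>" "\<And>c x vs. length vs = k \<Longrightarrow> \<omega> c x vs = \<tau> c x vs"
  shows "\<omega> = \<tau>"
  using assms by (intro ext) (metis homogeneousD)

lemma length_2E: "length vs = 2 \<Longrightarrow> (\<And>u v. vs = [u, v] \<Longrightarrow> thesis) \<Longrightarrow> thesis"
  by (auto simp: numeral_eq_Suc length_Suc_conv)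
lemma length_3E: "length vs = 3 \<Longrightarrow> (\<And>u v w. vs = [u, v, w] \<Longrightarrow> thesis) \<Longrightarrow> thesis"
  by (auto simp: numeral_eq_Suc length_Suc_conv)
lemma length_4E: "length vs = 4 \<Longrightarrow> (\<And>t u v w. vs = [t, u, v, w] \<Longrightarrow> thesis) \<Longrightarrow> thesis"
  by (auto simp: numeral_eq_Suc length_Suc_conv)

lemma wedge_1_2_commute:
  assumes "homogeneous 1 \<omega>" "homogeneous 2 \<tau>"
  shows "\<omega> \<and>\<^sub>F \<tau> = \<tau> \<and>\<^sub>F \<omega>"
proof (rule form_eqI_homogeneous)
  show "homogeneous 3 (\<omega> \<and>\<^sub>F \<tau>)" "homogeneous 3 (\<tau> \<and>\<^sub>F \<omega>)"
    using homogeneous_wedge[OF assms] homogeneous_wedge[OF assms(2,1)] by (simp_all add: numeral_eq_Suc)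
qed (use assms in \<open>auto elim!: length_3E simp: wedge_1_2 wedge_2_1\<close>)

lemma wedge_2_2_commute:
  assumes "homogeneous 2 \<omega>" "homogeneous 2 \<tau>"
  shows "\<omega> \<and>\<^sub>F \<tau> = \<tau> \<and>\<^sub>F \<omega>"
proof (rule form_eqI_homogeneous)
  show "homogeneous 4 (\<omega> \<and>\<^sub>F \<tau>)" "homogeneous 4 (\<tau> \<and>\<^sub>F \<omega>)"
    using homogeneous_wedge[OF assms] homogeneous_wedge[OF assms(2,1)] by simp_all
qed (use assms in \<open>auto elim!: length_4E simp: wedge_2_2\<close>)

lemma wedge_add_left: "(\<omega> + \<omega>') \<and>\<^sub>F \<tau> = \<omega> \<and>\<^sub>F \<tau> + \<omega>' \<and>\<^sub>F \<tau>"
  by (intro ext) (simp add: wedge_def sum.distrib algebra_simps)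
lemma wedge_add_right: "\<tau> \<and>\<^sub>F (\<omega> + \<omega>') = \<tau> \<and>\<^sub>F \<omega> + \<tau> \<and>\<^sub>F \<omega>'"
  by (intro ext) (simp add: wedge_def sum.distrib algebra_simps)
lemma wedge_fscale_left: "(r *\<^sub>F \<omega>) \<and>\<^sub>F \<tau> = r *\<^sub>F (\<omega> \<and>\<^sub>F \<tau>)"
  by (intro ext) (simp add: wedge_def fscale_def sum_distrib_left algebra_simps)
lemma wedge_fscale_right: "\<tau> \<and>\<^sub>F (r *\<^sub>F \<omega>) = r *\<^sub>F (\<tau> \<and>\<^sub>F \<omega>)"
  by (intro ext) (simp add: wedge_def fscale_def sum_distrib_left algebra_simps)
lemma wedge_0_left: "0 \<and>\<^sub>F \<tau> = 0"
  by (intro ext) (simp add: wedge_def)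
lemma wedge_0_right: "\<tau> \<and>\<^sub>F 0 = 0"
  by (intro ext) (simp add: wedge_def)

lemma fscale_fscale: "r *\<^sub>F s *\<^sub>F \<omega> = (r * s) *\<^sub>F \<omega>"
  by (intro ext) (simp add: fscale_def)
lemma fscale_0 [simp]: "r *\<^sub>F 0 = 0"
  by (intro ext) (simp add: fscale_def)

lemma Complex_form_apply: "Complex_form a b c x vs = Complex (a c x vs) (b c x vs)"
  by (simp add: Complex_form_def of_real_form_def fscale_def complex_eq_iff)
lemma Re_Complex_form [simp]: "Re_form (Complex_form a b) = a"
  by (simp add: Re_form_def Complex_form_apply)
lemma Im_Complex_form [simp]: "Im_form (Complex_form a b) = b"
  by (simp add: Im_form_def Complex_form_apply)
lemma cnj_Complex_form: "cnj_form (Complex_form a b) = Complex_form a ((-1) *\<^sub>F b)"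
  by (intro ext) (simp add: cnj_form_def Complex_form_apply fscale_def complex_eq_iff)
lemma of_real_form_Complex_form: "of_real_form a = Complex_form a 0"
  by (intro ext) (simp add: of_real_form_def Complex_form_apply complex_eq_iff)

lemma Complex_form_eq_iff: "Complex_form a b = Complex_form a' b' \<longleftrightarrow> a = a' \<and> b = b'"
  by (metis Re_Complex_form Im_Complex_form)

lemma Complex_form_wedge:
  "Complex_form a b \<and>\<^sub>F Complex_form a' b' = Complex_form (a \<and>\<^sub>F a' - b \<and>\<^sub>F b') (a \<and>\<^sub>F b' + b \<and>\<^sub>F a')"
proof -
  have p: "(-1::complex) ^ n * z = (if even n then z else - z)" for n z by simp
  have q: "(-1::real) ^ n * z = (if even n then z else - z)" for n z by simp
  show ?thesis
    by (intro ext) (auto simp: complex_eq_iff Complex_form_apply wedge_def mult.assoc p q 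
        sum_subtractf[symmetric] sum.distrib[symmetric] intro!: sum.cong)
qed

lemma ext_d_2: "x \<in> cimg c \<Longrightarrow> ext_d \<omega> c x [u, v] =
    frechet_derivative (\<lambda>y. \<omega> c y [v]) (at x) u - frechet_derivative (\<lambda>y. \<omega> c y [u]) (at x) v"
  by (simp add: ext_d_def)
lemma ext_d_3: "x \<in> cimg c \<Longrightarrow> ext_d \<omega> c x [u, v, w] =
    frechet_derivative (\<lambda>y. \<omega> c y [v, w]) (at x) u - frechet_derivative (\<lambda>y. \<omega> c y [u, w]) (at x) v
    + frechet_derivative (\<lambda>y. \<omega> c y [u, v]) (at x) w"
  by (simp add: ext_d_def)
lemma ext_d_4: "x \<in> cimg c \<Longrightarrow> ext_d \<omega> c x [t, u, v, w] =
    frechet_derivative (\<lambda>y. \<omega> c y [u, v, w]) (at x) t - frechet_derivative (\<lambda>y. \<omega> c y [t, v, w]) (at x) u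
    + frechet_derivative (\<lambda>y. \<omega> c y [t, u, w]) (at x) v - frechet_derivative (\<lambda>y. \<omega> c y [t, u, v]) (at x) w"
  by (simp add: ext_d_def)

lemma homogeneous_ext_d:
  assumes "homogeneous k \<omega>" shows "homogeneous (Suc k) (ext_d \<omega>)"
  unfolding homogeneous_def ext_d_def
proof (intro allI impI)
  fix c x and vs :: "'b list" assume n: "length vs \<noteq> Suc k"
  have "(\<lambda>y. \<omega> c y (take i vs @ drop (Suc i) vs)) = (\<lambda>y. 0)" if "i < length vs" for i
    using n that by (intro ext homogeneousD[OF assms]) auto
  then show "(if x \<in> cimg c then \<Sum>i<length vs. (- 1) ^ i *
      frechet_derivative (\<lambda>y. \<omega> c y (take i vs @ drop (Suc i) vs)) (at x) (vs ! i) else 0) = 0"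
    by simp
qed

lemma is_form_smooth: "is_form M k \<omega> \<Longrightarrow> c \<in> atlas M \<Longrightarrow> smooth_on (cimg c) (\<lambda>x. \<omega> c x vs)"
  by (drule conjunct1[OF conjunct2[OF conjunct2[OF iffD1[OF is_form_def]]]]) (simp only:)

lemma is_form_has_derivative:
  "is_form M k \<omega> \<Longrightarrow> c \<in> atlas M \<Longrightarrow> x \<in> cimg c \<Longrightarrow>
   ((\<lambda>x. \<omega> c x vs) has_derivative frechet_derivative (\<lambda>x. \<omega> c x vs) (at x)) (at x)"
  using smooth_on_differentiable[OF is_form_smooth] frechet_derivative_works by blast

lemma is_form_off_atlas: "is_form M k \<omega> \<Longrightarrow> c \<notin> atlas M \<Longrightarrow> \<omega> c x vs = 0"
  using is_form_outside by blast

lemma ext_d_off_atlas: "is_form M k \<omega> \<Longrightarrow> c \<notin> atlas M \<Longrightarrow> ext_d \<omega> c x vs = 0"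
  by (simp add: ext_d_def is_form_off_atlas)

text \<open>The Leibniz rule \<open>d(\<omega> \<and> \<eta>) = d\<omega> \<and> \<eta> + \<omega> \<and> d\<eta>\<close> with \<open>d\<eta> = 0\<close>, evaluated on four vectors.
  The sign that comes from moving \<open>\<eta>\<close> to the front does not matter, as both sides vanish.\<close>

lemma wedge_ext_d_closed:
  fixes \<omega> \<eta> :: "('a, 'e::euclidean_space, real) form"
  assumes \<omega>: "is_form M 2 \<omega>" and \<eta>: "is_form M 1 \<eta>"
    and closed: "ext_d \<eta> = 0" "ext_d (\<omega> \<and>\<^sub>F \<eta>) = 0"
  shows "\<eta> \<and>\<^sub>F ext_d \<omega> = 0"
proof (rule form_eqI_homogeneous)
  note h = is_form_homogeneous[OF \<omega>] is_form_homogeneous[OF \<eta>]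
  have h3: "homogeneous 3 (ext_d \<omega>)" using homogeneous_ext_d[OF h(1)] by (simp add: numeral_eq_Suc)
  show "homogeneous 4 (\<eta> \<and>\<^sub>F ext_d \<omega>)" using homogeneous_wedge[OF h(2) h3] by simp
  show "homogeneous 4 0" by (simp add: homogeneous_def)
  fix c x and vs :: "'e list" assume "length vs = 4"
  then obtain a b e d where vs: "vs = [a, b, e, d]" by (rule length_4E)
  show "(\<eta> \<and>\<^sub>F ext_d \<omega>) c x vs = 0 c x vs"
  proof (cases "c \<in> atlas M \<and> x \<in> cimg c")
    case False
    then have "ext_d \<omega> c x ws = 0" for ws
      using ext_d_off_atlas[OF \<omega>, of c x ws] by (cases "x \<in> cimg c") (simp_all add: ext_d_def)
    then show ?thesis by (simp add: wedge_def)
  next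
    case True
    define D2 where "D2 u v w = frechet_derivative (\<lambda>y. \<omega> c y [u, v]) (at x) w" for u v w
    define D1 where "D1 u v = frechet_derivative (\<lambda>y. \<eta> c y [u]) (at x) v" for u v
    have d2: "((\<lambda>y. \<omega> c y [u, v]) has_derivative D2 u v) (at x)" for u v
      unfolding D2_def using is_form_has_derivative[OF \<omega>] True by simp
    have d1: "((\<lambda>y. \<eta> c y [u]) has_derivative D1 u) (at x)" for u
      unfolding D1_def using is_form_has_derivative[OF \<eta>] True by simp
    \<comment> \<open>The hypothesis \<open>d\<eta> = 0\<close> says that the derivative of \<open>\<eta>\<close> is symmetric.\<close>
    have sym: "D1 v u = D1 u v" for u v
      using fun_cong[OF fun_cong[OF fun_cong[OF closed(1), of c], of x], of "[u, v]"] True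
      by (simp add: ext_d_2 D1_def)
    have dw: "frechet_derivative (\<lambda>y. (\<omega> \<and>\<^sub>F \<eta>) c y [u, v, w]) (at x) t =
       \<omega> c x [u, v] * D1 w t + D2 u v t * \<eta> c x [w] - (\<omega> c x [u, w] * D1 v t + D2 u w t * \<eta> c x [v])
       + (\<omega> c x [v, w] * D1 u t + D2 v w t * \<eta> c x [u])" for t u v w
    proof -
      have "((\<lambda>y. (\<omega> \<and>\<^sub>F \<eta>) c y [u, v, w]) has_derivative (\<lambda>t. 
       \<omega> c x [u, v] * D1 w t + D2 u v t * \<eta> c x [w] - (\<omega> c x [u, w] * D1 v t + D2 u w t * \<eta> c x [v])
       + (\<omega> c x [v, w] * D1 u t + D2 v w t * \<eta> c x [u]))) (at x)"
        unfolding wedge_2_1[OF h]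
        by (intro has_derivative_add has_derivative_diff has_derivative_mult d1 d2)
      from fun_cong[OF frechet_derivative_at[OF this], of t] show ?thesis by simp
    qed
    have "ext_d (\<omega> \<and>\<^sub>F \<eta>) c x [a, b, e, d] = 0" using closed(2) by simp
    then show ?thesis
      using True sym unfolding vs
      by (simp add: wedge_1_3[OF h(2) h3] ext_d_4 ext_d_3 dw D2_def[symmetric]) (simp add: algebra_simps)
  qed
qed

lemma ext_d_fscale:
  fixes \<omega> :: "('a, 'e::euclidean_space, real) form"
  assumes "\<And>c x vs. x \<in> cimg c \<Longrightarrow> (\<lambda>y. \<omega> c y vs) differentiable at x"
  shows "ext_d (r *\<^sub>F \<omega>) = r *\<^sub>F ext_d \<omega>"
proof -
  have "frechet_derivative (\<lambda>y. r * \<omega> c y vs) (at x) v = r * frechet_derivative (\<lambda>y. \<omega> c y vs) (at x) v"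
    if "x \<in> cimg c" for c x v vs
  proof -
    have "((\<lambda>y. r * \<omega> c y vs) has_derivative (\<lambda>v. r * frechet_derivative (\<lambda>y. \<omega> c y vs) (at x) v)) (at x)"
      using assms[OF that, unfolded frechet_derivative_works] by (rule has_derivative_mult_right)
    from fun_cong[OF frechet_derivative_at[OF this], of v] show ?thesis by (rule sym)
  qed
  then show ?thesis
    by (intro ext) (auto simp: ext_d_def fscale_def sum_distrib_left algebra_simps intro!: sum.cong)
qed

section \<open>Coframes adapted to an \<open>SU(2)\<close> structure at a point\<close>

lemma linear_has_kernel:
  fixes f :: "'a::euclidean_space \<Rightarrow> 'b::euclidean_space"
  assumes "linear f" "DIM('b) < DIM('a)"
  shows "\<exists>x. x \<noteq> 0 \<and> f x = 0"
proof (rule ccontr)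
  assume "\<nexists>x. x \<noteq> 0 \<and> f x = 0"
  then have "inj f" using linear_injective_0[OF assms(1)] by auto
  then have "dim (range f) = dim (UNIV :: 'a set)"
    using dim_image_eq[OF assms(1)] by (metis inj_on_subset subset_UNIV)
  moreover have "dim (range f) \<le> DIM('b)" by (rule dim_subset_UNIV)
  ultimately show False using assms(2) by simp
qed

text \<open>The value of the wedge product of two \<open>2\<close>-forms on four vectors.\<close>

definition wedge4 :: "('t \<Rightarrow> 't \<Rightarrow> real) \<Rightarrow> ('t \<Rightarrow> 't \<Rightarrow> real) \<Rightarrow> 't \<Rightarrow> 't \<Rightarrow> 't \<Rightarrow> 't \<Rightarrow> real" where
  "wedge4 w w' t u v z = w t u * w' v z - w t v * w' u z + w t z * w' u v
    + w u v * w' t z - w u z * w' t v + w v z * w' t u"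

text \<open>In the usual shorthand, \<open>w1 = e\<^sup>1\<^sup>2 + e\<^sup>3\<^sup>4\<close>, \<open>w2 = e\<^sup>1\<^sup>3 - e\<^sup>2\<^sup>4\<close> and \<open>w3 = e\<^sup>1\<^sup>4 + e\<^sup>2\<^sup>3\<close>, that is,
  \<open>w2 + i w3 = (e\<^sup>1 + i e\<^sup>2) \<and> (e\<^sup>3 + i e\<^sup>4)\<close>.\<close>

definition adapted_coframe ::
  "('t::real_vector \<Rightarrow> 't \<Rightarrow> real) \<Rightarrow> ('t \<Rightarrow> 't \<Rightarrow> real) \<Rightarrow> ('t \<Rightarrow> 't \<Rightarrow> real) \<Rightarrow>
   ('t \<Rightarrow> real) \<Rightarrow> ('t \<Rightarrow> real) \<Rightarrow> ('t \<Rightarrow> real) \<Rightarrow> ('t \<Rightarrow> real) \<Rightarrow> bool" where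
  "adapted_coframe w1 w2 w3 e1 e2 e3 e4 \<longleftrightarrow> linear e1 \<and> linear e2 \<and> linear e3 \<and> linear e4 \<and>
    (\<forall>X Y. w1 X Y = e1 X * e2 Y - e1 Y * e2 X + e3 X * e4 Y - e3 Y * e4 X) \<and>
    (\<forall>X Y. w2 X Y = e1 X * e3 Y - e1 Y * e3 X - (e2 X * e4 Y - e2 Y * e4 X)) \<and>
    (\<forall>X Y. w3 X Y = e1 X * e4 Y - e1 Y * e4 X + e2 X * e3 Y - e2 Y * e3 X)"

text \<open>The pointwise normal form of an \<open>SU(2)\<close> structure in dimension 5. The complex structure \<open>J\<close> makes
  \<open>ker \<eta>\<close> a Hermitian plane with a unitary frame \<open>E1\<close>, \<open>E2 = J E1\<close>, \<open>E3\<close>, \<open>E4 = J E3\<close>. Being of type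
  \<open>(2,0)\<close> on \<open>ker \<eta>\<close>, the form \<open>w2 + i w3\<close> is there \<open>c (e\<^sup>1 + i e\<^sup>2) \<and> (e\<^sup>3 + i e\<^sup>4)\<close> with a complex number
  \<open>c = p + i q\<close>; the relation \<open>w2 \<and> w2 = w1 \<and> w1\<close> forces \<open>|c| = 1\<close>, and \<open>c\<close> is absorbed by rotating \<open>e\<^sup>3\<close> and \<open>e\<^sup>4\<close>.
  The type condition says nothing about vectors transverse to \<open>ker \<eta>\<close>. There one uses the vector \<open>\<xi>\<close>
  with \<open>\<eta>(\<xi>) = 1\<close> that spans the kernel of \<open>w1\<close>; the relations \<open>w1 \<and> w2 = w1 \<and> w3 = 0\<close> imply that \<open>\<xi>\<close>
  is also in the kernel of \<open>w2\<close> and \<open>w3\<close>.\<close>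

lemma adapted_coframe_exists:
  fixes \<eta> :: "'t::euclidean_space \<Rightarrow> real" and w1 w2 w3 :: "'t \<Rightarrow> 't \<Rightarrow> real"
  assumes dim: "DIM('t) = 5" and \<eta>: "linear \<eta>" "\<exists>t. \<eta> t \<noteq> 0"
    and bil: "bilinear w1" "bilinear w2" "bilinear w3"
    and alt: "\<And>X. w1 X X = 0" "\<And>X. w2 X X = 0" "\<And>X. w3 X X = 0"
    and J: "linear J" "\<And>X. \<eta> X = 0 \<Longrightarrow> \<eta> (J X) = 0" "\<And>X. \<eta> X = 0 \<Longrightarrow> J (J X) = - X"
    and inv: "\<And>X Y. \<eta> X = 0 \<Longrightarrow> \<eta> Y = 0 \<Longrightarrow> w1 (J X) (J Y) = w1 X Y"
    and pos: "\<And>X. \<eta> X = 0 \<Longrightarrow> X \<noteq> 0 \<Longrightarrow> w1 X (J X) > 0"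
    and type: "\<And>X Y. \<eta> X = 0 \<Longrightarrow> \<eta> Y = 0 \<Longrightarrow> w2 (J X) Y = - w3 X Y"
      "\<And>X Y. \<eta> X = 0 \<Longrightarrow> \<eta> Y = 0 \<Longrightarrow> w3 (J X) Y = w2 X Y"
    and wedge: "\<And>t u v z. wedge4 w1 w2 t u v z = 0" "\<And>t u v z. wedge4 w1 w3 t u v z = 0"
      "\<And>t u v z. wedge4 w2 w2 t u v z = wedge4 w1 w1 t u v z"
  shows "\<exists>e1 e2 e3 e4. adapted_coframe w1 w2 w3 e1 e2 e3 e4 \<and>
    (\<forall>X. e1 X = 0 \<and> e2 X = 0 \<and> e3 X = 0 \<and> e4 X = 0 \<and> \<eta> X = 0 \<longrightarrow> X = 0)"
proof -
  have anti: "w Y X = - w X Y" if "bilinear w" "\<And>X. w X X = 0" for w :: "'t \<Rightarrow> 't \<Rightarrow> real" and X Y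
  proof -
    have "w (X + Y) (X + Y) = w X X + w X Y + (w Y X + w Y Y)"
      by (simp only: bilinear_ladd[OF that(1)] bilinear_radd[OF that(1)])
    then show ?thesis unfolding that(2) by simp
  qed
  note anti1 = anti[OF bil(1) alt(1)] and anti2 = anti[OF bil(2) alt(2)] and anti3 = anti[OF bil(3) alt(3)]
  note \<eta>simps = linear_add[OF \<eta>(1)] linear_diff[OF \<eta>(1)] linear_cmul[OF \<eta>(1)]
  define g where "g X Y = w1 X (J Y)" for X Y
  have gsym: "g X Y = g Y X" if "\<eta> X = 0" "\<eta> Y = 0" for X Y
    unfolding g_def using inv[of X "J Y"] J that anti1[of "J X" Y]
    by (simp add: bilinear_rneg[OF bil(1)])
  have glin: "linear (\<lambda>X. g X Y)" for Y
    using bil(1) unfolding g_def bilinear_def by blast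
  have grlin: "linear (g Y)" for Y
    using bil(1) J(1) linear_compose[of J "w1 Y"] unfolding g_def bilinear_def by (simp add: o_def)
  note gsimps = linear_add[OF glin] linear_diff[OF glin] linear_cmul[OF glin]
  have unit: "\<exists>r. g (r *\<^sub>R u) (r *\<^sub>R u) = 1" if "\<eta> u = 0" "u \<noteq> 0" for u
  proof -
    have p: "g u u > 0" using pos[OF that] by (simp add: g_def)
    show ?thesis
      by (rule exI[of _ "1 / sqrt (g u u)"])
        (use p in \<open>simp add: gsimps linear_cmul[OF grlin] field_simps\<close>)
  qed
  obtain u where u: "u \<noteq> 0" "\<eta> u = 0" using linear_has_kernel[OF \<eta>(1)] dim by auto
  obtain r where r: "g (r *\<^sub>R u) (r *\<^sub>R u) = 1" using unit u by blast
  define E1 where "E1 = r *\<^sub>R u"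
  define E2 where "E2 = J E1"
  have "linear (\<lambda>X. (\<eta> X, g X E1, g X E2))"
    using \<eta>(1) glin by (intro linearI) (simp_all add: \<eta>simps gsimps)
  from linear_has_kernel[OF this] obtain u' where u': "u' \<noteq> 0" "\<eta> u' = 0" "g u' E1 = 0" "g u' E2 = 0"
    using dim by (auto simp: zero_prod_def)
  obtain r' where r': "g (r' *\<^sub>R u') (r' *\<^sub>R u') = 1" using unit u' by blast
  define E3 where "E3 = r' *\<^sub>R u'"
  define E4 where "E4 = J E3"
  have K: "\<eta> E1 = 0" "\<eta> E2 = 0" "\<eta> E3 = 0" "\<eta> E4 = 0"
    using u u' J by (simp_all add: E1_def E2_def E3_def E4_def \<eta>simps)
  have JE: "J E1 = E2" "J E3 = E4" "J E2 = - E1" "J E4 = - E3"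
    using J(3) K by (simp_all add: E2_def E4_def)
  have g11: "g E1 E1 = 1" "g E3 E3 = 1" "g E3 E1 = 0" "g E3 E2 = 0"
    using r r' u' by (simp_all add: E1_def[symmetric] E3_def[symmetric]) (simp_all add: E3_def gsimps)
  have w1E: "w1 E1 E2 = 1" "w1 E3 E4 = 1" "w1 E3 E2 = 0" "w1 E3 E1 = 0" "w1 E4 E2 = 0" "w1 E4 E1 = 0"
  proof -
    show 1: "w1 E1 E2 = 1" "w1 E3 E4 = 1" "w1 E3 E2 = 0" "w1 E3 E1 = 0"
      using g11 by (simp_all add: g_def JE bilinear_rneg[OF bil(1)])
    show "w1 E4 E2 = 0" using inv[of E3 E1] K 1 by (simp add: JE)
    show "w1 E4 E1 = 0" using inv[of E3 E2] K 1 by (simp add: JE bilinear_rneg[OF bil(1)])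
  qed
  have gE: "g E1 E1 = 1" "g E1 E2 = 0" "g E1 E3 = 0" "g E1 E4 = 0"
    "g E2 E1 = 0" "g E2 E2 = 1" "g E2 E3 = 0" "g E2 E4 = 0"
    "g E3 E1 = 0" "g E3 E2 = 0" "g E3 E3 = 1" "g E3 E4 = 0"
    "g E4 E1 = 0" "g E4 E2 = 0" "g E4 E3 = 0" "g E4 E4 = 1"
    using w1E anti1[of E1 E2] anti1[of E3 E4] anti1[of E3 E2] anti1[of E3 E1] anti1[of E4 E2] anti1[of E4 E1]
    by (simp_all add: g_def JE bilinear_rneg[OF bil(1)] alt)
  obtain t where t: "\<eta> t \<noteq> 0" using \<eta>(2) by blast
  define h where "h X = (\<eta> X, g X E1, g X E2, g X E3, g X E4)" for X
  have hlin: "linear h"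
    unfolding h_def using \<eta>(1) glin by (intro linearI) (simp_all add: \<eta>simps gsimps)
  have hsurj: "surj h"
  proof (rule surjI)
    fix s :: "real \<times> real \<times> real \<times> real \<times> real"
    obtain s0 s1 s2 s3 s4 where s: "s = (s0, s1, s2, s3, s4)" by (metis prod.exhaust)
    show "h ((\<lambda>(s0, s1, s2, s3, s4). (s0 / \<eta> t) *\<^sub>R t + (s1 - s0 / \<eta> t * g t E1) *\<^sub>R E1 + (s2 - s0 / \<eta> t * g t E2) *\<^sub>R E2
          + (s3 - s0 / \<eta> t * g t E3) *\<^sub>R E3 + (s4 - s0 / \<eta> t * g t E4) *\<^sub>R E4) s) = s"
      unfolding s h_def using t by (simp add: \<eta>simps gsimps gE K)
  qed
  have hinj: "X = 0" if "\<eta> X = 0" "g X E1 = 0" "g X E2 = 0" "g X E3 = 0" "g X E4 = 0" for X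
  proof -
    have "inj h" using eucl.linear_surjective_imp_injective[OF hlin hsurj] dim by simp
    moreover have "h X = h 0" using that hlin by (simp add: h_def linear_0[OF \<eta>(1)] linear_0[OF glin])
    ultimately show ?thesis by (simp add: inj_eq)
  qed
  \<comment> \<open>The coefficients are chosen so that \<open>w1 \<xi>\<close> vanishes on the frame of \<open>ker \<eta>\<close>.\<close>
  define \<xi> where "\<xi> = (1 / \<eta> t) *\<^sub>R (t - w1 t E2 *\<^sub>R E1 + w1 t E1 *\<^sub>R E2 - w1 t E4 *\<^sub>R E3 + w1 t E3 *\<^sub>R E4)"
  have \<eta>\<xi>: "\<eta> \<xi> = 1" using t by (simp add: \<xi>_def \<eta>simps K)
  have w1\<xi>: "w1 \<xi> E1 = 0" "w1 \<xi> E2 = 0" "w1 \<xi> E3 = 0" "w1 \<xi> E4 = 0"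
    using w1E anti1[of E1 E2] anti1[of E3 E4] anti1[of E3 E2] anti1[of E3 E1] anti1[of E4 E2] anti1[of E4 E1]
    by (simp_all add: \<xi>_def bilinear_ladd[OF bil(1)] bilinear_lsub[OF bil(1)] bilinear_lmul[OF bil(1)] alt)
  \<comment> \<open>Contracting \<open>w1 \<and> w = 0\<close> with \<open>\<xi>\<close> leaves \<open>w1 \<and> (i\<^sub>\<xi> w) = 0\<close>; evaluation on a vector of the frame and
    on an orthogonal complex line isolates each component of \<open>i\<^sub>\<xi> w\<close>.\<close>
  have contracted: "w \<xi> E1 = 0 \<and> w \<xi> E2 = 0 \<and> w \<xi> E3 = 0 \<and> w \<xi> E4 = 0"
    if "\<And>t u v z. wedge4 w1 w t u v z = 0" for w
    using that[of \<xi> E1 E3 E4] that[of \<xi> E2 E3 E4] that[of \<xi> E3 E1 E2] that[of \<xi> E4 E1 E2] w1\<xi> w1E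
      anti1[of E1 E2] anti1[of E3 E4] anti1[of E3 E2] anti1[of E3 E1] anti1[of E4 E2] anti1[of E4 E1]
    by (simp add: wedge4_def)
  define f where "f E X = g X E - \<eta> X * g \<xi> E" for E X
  have flin: "linear (f E)" for E
    unfolding f_def by (intro linearI) (simp_all add: \<eta>simps gsimps algebra_simps)
  have rep: "X = \<eta> X *\<^sub>R \<xi> + f E1 X *\<^sub>R E1 + f E2 X *\<^sub>R E2 + f E3 X *\<^sub>R E3 + f E4 X *\<^sub>R E4" for X
  proof -
    have "X - (\<eta> X *\<^sub>R \<xi> + f E1 X *\<^sub>R E1 + f E2 X *\<^sub>R E2 + f E3 X *\<^sub>R E3 + f E4 X *\<^sub>R E4) = 0"
      by (rule hinj) (simp_all add: \<eta>simps gsimps gE K \<eta>\<xi> f_def)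
    then show ?thesis by simp
  qed
  have expand: "w X Y = 
      w E1 E2 * (f E1 X * f E2 Y - f E1 Y * f E2 X) + w E1 E3 * (f E1 X * f E3 Y - f E1 Y * f E3 X)
    + w E1 E4 * (f E1 X * f E4 Y - f E1 Y * f E4 X) + w E2 E3 * (f E2 X * f E3 Y - f E2 Y * f E3 X)
    + w E2 E4 * (f E2 X * f E4 Y - f E2 Y * f E4 X) + w E3 E4 * (f E3 X * f E4 Y - f E3 Y * f E4 X)"
    if w: "bilinear w" "\<And>X. w X X = 0" and 0: "w \<xi> E1 = 0 \<and> w \<xi> E2 = 0 \<and> w \<xi> E3 = 0 \<and> w \<xi> E4 = 0"
    for w X Y
  proof -
    note an = anti[OF w]
    show ?thesis
      by (subst (1) rep[of X], subst (1) rep[of Y],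
        simp only: bilinear_ladd[OF w(1)] bilinear_radd[OF w(1)] bilinear_lmul[OF w(1)] bilinear_rmul[OF w(1)]
          0 an[of E1 \<xi>] an[of E2 \<xi>] an[of E3 \<xi>] an[of E4 \<xi>] an[of E1 E2] an[of E1 E3] an[of E1 E4] an[of E2 E3]
          an[of E2 E4] an[of E3 E4] w(2))
        (simp add: algebra_simps)
  qed
  define p q where "p = w2 E1 E3" and "q = w3 E1 E3"
  have w2E: "w2 E1 E2 = 0" "w2 E3 E4 = 0" "w2 E2 E3 = - q" "w2 E1 E4 = - q" "w2 E2 E4 = - p" "w2 E1 E3 = p"
    and w3E: "w3 E1 E2 = 0" "w3 E3 E4 = 0" "w3 E2 E3 = p" "w3 E1 E4 = p" "w3 E2 E4 = - q" "w3 E1 E3 = q"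
    using type(1)[of E1 E1] type(1)[of E3 E3] type(1)[of E1 E3] type(1)[of E3 E1] type(1)[of E1 E4]
      type(2)[of E1 E1] type(2)[of E3 E3] type(2)[of E1 E3] type(2)[of E3 E1] type(2)[of E1 E4]
      anti2[of E1 E2] anti2[of E3 E4] anti2[of E1 E3] anti2[of E1 E4]
      anti3[of E1 E2] anti3[of E3 E4] anti3[of E1 E3] anti3[of E1 E4]
    by (simp_all add: K JE p_def q_def alt)
  have w1E': "w1 E1 E2 = 1" "w1 E3 E4 = 1" "w1 E1 E3 = 0" "w1 E1 E4 = 0" "w1 E2 E3 = 0" "w1 E2 E4 = 0"
    using w1E anti1[of E3 E2] anti1[of E3 E1] anti1[of E4 E2] anti1[of E4 E1] by simp_all
  have pq: "p * p + q * q = 1"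
    using wedge(3)[of E1 E2 E3 E4] by (simp add: wedge4_def w1E' w2E)
  have W1: "w1 X Y = f E1 X * f E2 Y - f E1 Y * f E2 X + f E3 X * f E4 Y - f E3 Y * f E4 X" for X Y
    using expand[OF bil(1) alt(1), of X Y] w1\<xi> by (simp add: w1E')
  have W2: "w2 X Y = p * (f E1 X * f E3 Y - f E1 Y * f E3 X) - q * (f E1 X * f E4 Y - f E1 Y * f E4 X)
     - q * (f E2 X * f E3 Y - f E2 Y * f E3 X) - p * (f E2 X * f E4 Y - f E2 Y * f E4 X)" for X Y
    using expand[OF bil(2) alt(2) contracted[OF wedge(1)], of X Y] by (simp add: w2E)
  have W3: "w3 X Y = q * (f E1 X * f E3 Y - f E1 Y * f E3 X) + p * (f E1 X * f E4 Y - f E1 Y * f E4 X)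
     + p * (f E2 X * f E3 Y - f E2 Y * f E3 X) - q * (f E2 X * f E4 Y - f E2 Y * f E4 X)" for X Y
    using expand[OF bil(3) alt(3) contracted[OF wedge(2)], of X Y] by (simp add: w3E)
  \<comment> \<open>Rotation by the argument of \<open>p + i q\<close>.\<close>
  define e3 e4 where "e3 X = p * f E3 X - q * f E4 X" and "e4 X = q * f E3 X + p * f E4 X" for X
  have f34: "p * e3 X + q * e4 X = f E3 X" "p * e4 X - q * e3 X = f E4 X" for X
  proof -
    have "p * e3 X + q * e4 X = (p * p + q * q) * f E3 X" "p * e4 X - q * e3 X = (p * p + q * q) * f E4 X"
      by (simp_all add: e3_def e4_def algebra_simps)
    then show "p * e3 X + q * e4 X = f E3 X" "p * e4 X - q * e3 X = f E4 X" by (simp_all add: pq)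
  qed
  have lin: "linear (f E1)" "linear (f E2)" "linear e3" "linear e4"
    using flin unfolding e3_def e4_def
    by (auto intro!: linearI simp: linear_add[OF flin] linear_cmul[OF flin] algebra_simps)
  have zero: "X = 0" if "f E1 X = 0" "f E2 X = 0" "e3 X = 0" "e4 X = 0" "\<eta> X = 0" for X
  proof -
    have "f E3 X = 0" "f E4 X = 0" using f34[of X] that by simp_all
    then show ?thesis using rep[of X] that by simp
  qed
  have e34: "e3 X * e4 Y - e3 Y * e4 X = f E3 X * f E4 Y - f E3 Y * f E4 X" for X Y
  proof -
    have "e3 X * e4 Y - e3 Y * e4 X = (p * p + q * q) * (f E3 X * f E4 Y - f E3 Y * f E4 X)"
      by (simp add: e3_def e4_def algebra_simps)
    then show ?thesis by (simp add: pq)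
  qed
  have "adapted_coframe w1 w2 w3 (f E1) (f E2) e3 e4"
    unfolding adapted_coframe_def
  proof (intro conjI allI lin)
    show "w1 X Y = f E1 X * f E2 Y - f E1 Y * f E2 X + e3 X * e4 Y - e3 Y * e4 X" for X Y
      using W1[of X Y] e34[of X Y] by simp
  qed (simp_all add: W2 W3 e3_def e4_def algebra_simps)
  then show ?thesis using zero by blast
qed

section \<open>The rotated triple at a point of a 6-manifold\<close>

text \<open>Linear algebra of the \<open>SU(2)\<close> structure at a point of a 6-manifold, in coordinates. The forms \<open>\<omega>\<close>,
  \<open>R\<close>, \<open>w2\<close> (the last two being \<open>Re \<Omega>\<close> and \<open>Im \<Omega>\<close>) are the image of the standard triple \<open>w1\<close>, \<open>w2\<close>, \<open>w3\<close>
  under a rotation about \<open>w2\<close> given by \<open>a\<close> and \<open>b\<close>, and \<open>\<alpha> = \<rho> + i \<sigma>\<close>.\<close>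

locale su2_coframe =
  fixes e1 e2 e3 e4 \<rho> \<sigma> :: "'v::euclidean_space \<Rightarrow> real" and a b :: real
  assumes lin: "linear e1" "linear e2" "linear e3" "linear e4" "linear \<rho>" "linear \<sigma>"
    and dim: "DIM('v) = 6"
    and separating: "\<And>X. e1 X = 0 \<Longrightarrow> e2 X = 0 \<Longrightarrow> e3 X = 0 \<Longrightarrow> e4 X = 0 \<Longrightarrow> \<rho> X = 0 \<Longrightarrow> \<sigma> X = 0 \<Longrightarrow> X = 0"
    and ab: "a * a + b * b = 1"
begin

lemmas coframe_linear [simp] = lin[THEN linear_add] lin[THEN linear_diff] lin[THEN linear_cmul]
  lin[THEN linear_neg] lin[THEN linear_0]

lemma dual_vector:
  "\<exists>X. e1 X = t1 \<and> e2 X = t2 \<and> e3 X = t3 \<and> e4 X = t4 \<and> \<rho> X = t5 \<and> \<sigma> X = t6"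
proof -
  define h where "h X = (e1 X, e2 X, e3 X, e4 X, \<rho> X, \<sigma> X)" for X
  have hlin: "linear h" unfolding h_def by (intro linearI) simp_all
  have "inj h" unfolding linear_injective_0[OF hlin]
    using separating by (auto simp: h_def zero_prod_def)
  then have "surj h" using eucl.linear_injective_imp_surjective[OF hlin] dim by simp
  then have "\<exists>X. h X = (t1, t2, t3, t4, t5, t6)" by (metis surjD)
  then show ?thesis by (simp add: h_def)
qed

lemma coframe_eqI:
  "e1 X = e1 Y \<Longrightarrow> e2 X = e2 Y \<Longrightarrow> e3 X = e3 Y \<Longrightarrow> e4 X = e4 Y \<Longrightarrow> \<rho> X = \<rho> Y \<Longrightarrow> \<sigma> X = \<sigma> Y \<Longrightarrow> X = Y"
  using separating[of "X - Y"] by simp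

definition "w1 X Y = e1 X * e2 Y - e1 Y * e2 X + e3 X * e4 Y - e3 Y * e4 X"
definition "w2 X Y = e1 X * e3 Y - e1 Y * e3 X - (e2 X * e4 Y - e2 Y * e4 X)"
definition "w3 X Y = e1 X * e4 Y - e1 Y * e4 X + e2 X * e3 Y - e2 Y * e3 X"
definition "\<omega> X Y = a * w1 X Y + b * w3 X Y"
definition "R X Y = b * w1 X Y - a * w3 X Y"
text \<open>The tensors \<open>S\<close> and \<open>T\<close> determine \<open>J\<close> without reference to a coframe. Since \<open>\<Omega>\<close> and \<open>\<alpha>\<close> have type
  \<open>(2,0)\<close> and \<open>(1,0)\<close>, one has \<open>R(JX,Y) = - w2(X,Y)\<close>, \<open>\<rho>(JX) = - \<sigma>(X)\<close> and \<open>\<sigma>(JX) = \<rho>(X)\<close>, hence \<open>S(JX,Y) = T(X,Y)\<close>,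
  where \<open>S\<close> is a nondegenerate \<open>2\<close>-form.\<close>

definition "S X Y = R X Y + (\<rho> X * \<sigma> Y - \<rho> Y * \<sigma> X)"
definition "T X Y = - w2 X Y - \<rho> X * \<rho> Y - \<sigma> X * \<sigma> Y"

lemmas defs = w1_def w2_def w3_def \<omega>_def R_def S_def T_def


text \<open>Evaluating on the dual frame turns the equation into two linear systems with matrix of
  determinant \<open>a\<^sup>2 + b\<^sup>2 = 1\<close>.\<close>

lemma S_eq_T_iff:
  "(\<forall>Y. S Z Y = T X Y) \<longleftrightarrow> e1 Z = - a * e2 X - b * e4 X \<and> e2 Z = a * e1 X - b * e3 X \<and>
     e3 Z = - a * e4 X + b * e2 X \<and> e4 Z = a * e3 X + b * e1 X \<and> \<rho> Z = - \<sigma> X \<and> \<sigma> Z = \<rho> X"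
  (is "?l \<longleftrightarrow> ?r")
proof
  assume ?l
  then have eq: "S Z Y = T X Y" for Y by blast
  have 1: "- b * e2 Z + a * e4 Z = e3 X"
  proof -
    obtain Y where "e1 Y = 1 \<and> e2 Y = 0 \<and> e3 Y = 0 \<and> e4 Y = 0 \<and> \<rho> Y = 0 \<and> \<sigma> Y = 0" using dual_vector by blast
    then show ?thesis using eq[of Y] by (simp add: defs)
  qed
  have 2: "b * e1 Z + a * e3 Z = - e4 X"
  proof -
    obtain Y where "e1 Y = 0 \<and> e2 Y = 1 \<and> e3 Y = 0 \<and> e4 Y = 0 \<and> \<rho> Y = 0 \<and> \<sigma> Y = 0" using dual_vector by blast
    then show ?thesis using eq[of Y] by (simp add: defs)
  qed
  have 3: "- b * e4 Z - a * e2 Z = - e1 X"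
  proof -
    obtain Y where "e1 Y = 0 \<and> e2 Y = 0 \<and> e3 Y = 1 \<and> e4 Y = 0 \<and> \<rho> Y = 0 \<and> \<sigma> Y = 0" using dual_vector by blast
    then show ?thesis using eq[of Y] by (simp add: defs)
  qed
  have 4: "b * e3 Z - a * e1 Z = e2 X"
  proof -
    obtain Y where "e1 Y = 0 \<and> e2 Y = 0 \<and> e3 Y = 0 \<and> e4 Y = 1 \<and> \<rho> Y = 0 \<and> \<sigma> Y = 0" using dual_vector by blast
    then show ?thesis using eq[of Y] by (simp add: defs)
  qed
  have 5: "\<sigma> Z = \<rho> X"
  proof -
    obtain Y where "e1 Y = 0 \<and> e2 Y = 0 \<and> e3 Y = 0 \<and> e4 Y = 0 \<and> \<rho> Y = 1 \<and> \<sigma> Y = 0" using dual_vector by blast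
    then show ?thesis using eq[of Y] by (simp add: defs)
  qed
  have 6: "\<rho> Z = - \<sigma> X"
  proof -
    obtain Y where "e1 Y = 0 \<and> e2 Y = 0 \<and> e3 Y = 0 \<and> e4 Y = 0 \<and> \<rho> Y = 0 \<and> \<sigma> Y = 1" using dual_vector by blast
    then show ?thesis using eq[of Y] by (simp add: defs)
  qed
  have e14: "b * e4 Z + a * e2 Z = e1 X" "- b * e1 Z - a * e3 Z = e4 X" using 2 3 by simp_all
  have "(a * a + b * b) * e1 Z = - a * e2 X - b * e4 X" "(a * a + b * b) * e2 Z = a * e1 X - b * e3 X"
    "(a * a + b * b) * e3 Z = - a * e4 X + b * e2 X" "(a * a + b * b) * e4 Z = a * e3 X + b * e1 X"
    unfolding 1[symmetric] 4[symmetric] e14[symmetric] by (simp_all add: algebra_simps)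
  then show ?r using 5 6 by (simp add: ab)
next
  assume r: ?r
  show ?l
  proof
    fix Y
    have "S Z Y = - (a * a + b * b) * w2 X Y - \<rho> X * \<rho> Y - \<sigma> X * \<sigma> Y"
      by (simp add: r defs) algebra
    then show "S Z Y = T X Y" by (simp add: T_def ab)
  qed
qed

lemma S_nondegenerate: "(\<And>Y. S Z Y = 0) \<Longrightarrow> Z = 0"
  using S_eq_T_iff[of Z 0] by (intro separating) (simp_all add: defs)

definition "J X = (THE Z. \<forall>Y. S Z Y = T X Y)"

lemma J_unique: "\<exists>!Z. \<forall>Y. S Z Y = T X Y"
  unfolding S_eq_T_iff using dual_vector[of "- a * e2 X - b * e4 X"] coframe_eqI by (metis (no_types, lifting))

lemma S_J: "S (J X) Y = T X Y"
  using theI'[OF J_unique[of X]] unfolding J_def by blast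

lemma J_coords [simp]: "e1 (J X) = - a * e2 X - b * e4 X" "e2 (J X) = a * e1 X - b * e3 X"
   "e3 (J X) = - a * e4 X + b * e2 X" "e4 (J X) = a * e3 X + b * e1 X" "\<rho> (J X) = - \<sigma> X" "\<sigma> (J X) = \<rho> X"
  using S_eq_T_iff[of "J X" X] S_J by auto

lemma linear_J: "linear J"
  by (intro linearI coframe_eqI) (simp_all add: algebra_simps)

lemma J_J: "J (J X) = - X"
  by (intro coframe_eqI) (simp_all, (use ab in algebra)+)

text \<open>The metric is recovered from the fundamental form \<open>F = \<omega> + \<rho> \<and> \<sigma>\<close> by \<open>g(X,Y) = F(X,JY)\<close>. In the coframe
  it is the standard inner product.\<close>

definition "g X Y = \<omega> X (J Y) + (\<rho> X * \<sigma> (J Y) - \<rho> (J Y) * \<sigma> X)"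

lemma g_coords: "g X Y = e1 X * e1 Y + e2 X * e2 Y + e3 X * e3 Y + e4 X * e4 Y + \<rho> X * \<rho> Y + \<sigma> X * \<sigma> Y"
proof -
  have "g X Y = (a * a + b * b) * (e1 X * e1 Y + e2 X * e2 Y + e3 X * e3 Y + e4 X * e4 Y) + \<rho> X * \<rho> Y + \<sigma> X * \<sigma> Y"
    by (simp add: g_def defs) algebra
  then show ?thesis by (simp add: ab)
qed

lemma bilinear_g: "bilinear g"
  unfolding bilinear_def by (auto intro!: linearI simp: g_coords algebra_simps)

lemma g_pos: "X \<noteq> 0 \<Longrightarrow> g X X > 0"
  using separating[of X] unfolding g_coords
  by (smt (verit) mult_eq_0_iff not_sum_power2_lt_zero zero_le_square)

lemma g_J: "g (J X) Y = \<omega> X Y + (\<rho> X * \<sigma> Y - \<rho> Y * \<sigma> X)"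
  by (simp add: g_coords defs algebra_simps)

lemma g_J_J: "g (J X) (J Y) = g X Y"
proof -
  have "g (J X) (J Y) = (a * a + b * b) * (e1 X * e1 Y + e2 X * e2 Y + e3 X * e3 Y + e4 X * e4 Y) + \<rho> X * \<rho> Y + \<sigma> X * \<sigma> Y"
    by (simp add: g_coords) algebra
  then show ?thesis by (simp add: ab g_coords)
qed

lemma \<Omega>_J: "R (J X) Y = - w2 X Y" "R X (J Y) = - w2 X Y" "w2 (J X) Y = R X Y" "w2 X (J Y) = R X Y"
proof -
  have "R (J X) Y = - (a * a + b * b) * w2 X Y" "R X (J Y) = - (a * a + b * b) * w2 X Y"
    by (simp_all add: defs) algebra+
  then show "R (J X) Y = - w2 X Y" "R X (J Y) = - w2 X Y" by (simp_all add: ab)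
  show "w2 (J X) Y = R X Y" "w2 X (J Y) = R X Y" by (simp_all add: defs algebra_simps)
qed

lemma sharp_coframe:
  fixes l defines "D \<equiv> THE X. \<forall>Y. g X Y = l Y"
  assumes l: "\<And>Y. l Y = r * \<rho> Y + s * \<sigma> Y"
  shows "e1 D = 0" "e2 D = 0" "e3 D = 0" "e4 D = 0" "\<rho> D = r" "\<sigma> D = s"
proof -
  obtain D' where D': "e1 D' = 0 \<and> e2 D' = 0 \<and> e3 D' = 0 \<and> e4 D' = 0 \<and> \<rho> D' = r \<and> \<sigma> D' = s"
    using dual_vector by blast
  have "D = D'"
    unfolding D_def
  proof (rule the_equality)
    show 1: "\<forall>Y. g D' Y = l Y" using D' by (simp add: g_coords l)
    fix X assume "\<forall>Y. g X Y = l Y"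
    then have "g (X - D') (X - D') = 0"
      using 1 by (simp add: bilinear_lsub[OF bilinear_g])
    then show "X = D'" using g_pos[of "X - D'"] by fastforce
  qed
  then show "e1 D = 0" "e2 D = 0" "e3 D = 0" "e4 D = 0" "\<rho> D = r" "\<sigma> D = s" using D' by simp_all
qed

end

section \<open>Charts and pullbacks\<close>

lemma is_form_transform:
  assumes "is_form M k \<omega>" "c \<in> atlas M" "c' \<in> atlas M" "p \<in> cdom c" "p \<in> cdom c'"
  shows "\<omega> c (cmap c p) vs = \<omega> c' (cmap c' p) (map (jac c c' p) vs)"
  using conjunct2[OF conjunct2[OF conjunct2[OF iffD1[OF is_form_def assms(1)]]]] assms(2-) by (metis IntI)

lemma is_form_linear:
  assumes "is_form M k \<omega>" "c \<in> atlas M" "x \<in> cimg c" "length vs = k" "i < k"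
  shows "linear (\<lambda>v. \<omega> c x (vs[i := v]))"
  using conjunct1[OF conjunct2[OF iffD1[OF is_form_def assms(1)]]] assms(2-) by blast

lemma is_form_alternating:
  assumes "is_form M k \<omega>" "c \<in> atlas M" "x \<in> cimg c" "length vs = k" "i < k" "j < k" "i \<noteq> j" "vs ! i = vs ! j"
  shows "\<omega> c x vs = 0"
  using conjunct1[OF conjunct2[OF iffD1[OF is_form_def assms(1)]]] assms(2-) by blast

lemma is_formI:
  assumes "\<And>c x vs. \<not> (c \<in> atlas M \<and> x \<in> cimg c \<and> length vs = k) \<Longrightarrow> \<omega> c x vs = 0"
    and "\<And>c x vs i. c \<in> atlas M \<Longrightarrow> x \<in> cimg c \<Longrightarrow> length vs = k \<Longrightarrow> i < k \<Longrightarrow> linear (\<lambda>v. \<omega> c x (vs[i := v]))"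
    and "\<And>c x vs i j. c \<in> atlas M \<Longrightarrow> x \<in> cimg c \<Longrightarrow> length vs = k \<Longrightarrow> i < k \<Longrightarrow> j < k \<Longrightarrow> i \<noteq> j \<Longrightarrow>
      vs ! i = vs ! j \<Longrightarrow> \<omega> c x vs = 0"
    and "\<And>c vs. c \<in> atlas M \<Longrightarrow> smooth_on (cimg c) (\<lambda>x. \<omega> c x vs)"
    and "\<And>c c' p vs. c \<in> atlas M \<Longrightarrow> c' \<in> atlas M \<Longrightarrow> p \<in> cdom c \<Longrightarrow> p \<in> cdom c' \<Longrightarrow>
      \<omega> c (cmap c p) vs = \<omega> c' (cmap c' p) (map (jac c c' p) vs)"
  shows "is_form M k \<omega>"
  unfolding is_form_def
  by (intro conjI allI ballI impI; (elim conjE IntE)?; (rule assms; assumption)?)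

context
  fixes M :: "('a, 'e::euclidean_space) manifold" and c :: "('a, 'e) chart"
  assumes M: "smooth_manifold M" and c: "c \<in> atlas M"
begin

lemma chart_homeomorphism:
  "openin (mtop M) (cdom c)" "open (cimg c)"
  "homeomorphic_map (subtopology (mtop M) (cdom c)) (top_of_set (cimg c)) (cmap c)"
  using M c unfolding smooth_manifold_def by blast+

lemma cmap_inj: "inj_on (cmap c) (cdom c)"
proof -
  have "topspace (subtopology (mtop M) (cdom c)) = cdom c"
    using openin_subset[OF chart_homeomorphism(1)] by auto
  then show ?thesis using homeomorphic_imp_injective_map[OF chart_homeomorphism(3)] by simp
qed

lemma cinv_cmap: "p \<in> cdom c \<Longrightarrow> cinv c (cmap c p) = p"
  unfolding cinv_def by (rule inv_into_f_f[OF cmap_inj])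

lemma open_overlap:
  assumes "c' \<in> atlas M" shows "open (cmap c ` (cdom c \<inter> cdom c'))"
proof -
  have "openin (mtop M) (cdom c')" using M assms unfolding smooth_manifold_def by blast
  then have "openin (subtopology (mtop M) (cdom c)) (cdom c \<inter> cdom c')"
    by (metis inf_commute openin_subtopology)
  then have "openin (top_of_set (cimg c)) (cmap c ` (cdom c \<inter> cdom c'))"
    using homeomorphic_imp_open_map[OF chart_homeomorphism(3)] unfolding open_map_def by blast
  then show ?thesis using chart_homeomorphism(2) openin_open_eq by blast
qed

lemma transition_smooth:
  assumes "c' \<in> atlas M" shows "smooth_on (cmap c ` (cdom c \<inter> cdom c')) (\<lambda>x. cmap c' (cinv c x))"
  using M c assms unfolding smooth_manifold_def by blast

lemma jac_has_derivative:
  assumes "c' \<in> atlas M" "p \<in> cdom c" "p \<in> cdom c'"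
  shows "((\<lambda>x. cmap c' (cinv c x)) has_derivative jac c c' p) (at (cmap c p))"
  unfolding jac_def
  using smooth_on_differentiable[OF transition_smooth[OF assms(1)], of "cmap c p"] assms
  by (simp add: frechet_derivative_works)

end

lemma cmap_in_cimg: "p \<in> cdom c \<Longrightarrow> cmap c p \<in> cimg c"
  by (simp add: cimg_def)

lemma cinv_in_cdom: "x \<in> cimg c \<Longrightarrow> cinv c x \<in> cdom c"
  unfolding cimg_def cinv_def by (rule inv_into_into)

lemma cmap_cinv: "x \<in> cimg c \<Longrightarrow> cmap c (cinv c x) = x"
  unfolding cimg_def cinv_def by (rule f_inv_into_f)

text \<open>A map is described by the linear map \<open>L\<close> between these two charts. The projections of a product
  manifold are of this kind for product charts, which makes pullbacks along them explicit.\<close>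

definition chart_over :: "('e \<Rightarrow> 'f) \<Rightarrow> ('a \<Rightarrow> 'b) \<Rightarrow> ('a, 'e) chart \<Rightarrow> ('b, 'f) chart \<Rightarrow> bool" where
  "chart_over L f c d \<longleftrightarrow> (\<forall>p\<in>cdom c. f p \<in> cdom d \<and> cmap d (f p) = L (cmap c p))"

definition chart_linear ::
  "('a, 'e::euclidean_space) manifold \<Rightarrow> ('b, 'f::euclidean_space) manifold \<Rightarrow> ('a \<Rightarrow> 'b) \<Rightarrow> ('e \<Rightarrow> 'f) \<Rightarrow> bool" where
  "chart_linear M N f L \<longleftrightarrow> smooth_manifold M \<and> smooth_manifold N \<and> bounded_linear L \<and>
     (\<forall>c\<in>atlas M. \<exists>d\<in>atlas N. chart_over L f c d)"

lemma chart_over_cimg: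
  assumes "chart_over L f c d" "x \<in> cimg c" shows "L x \<in> cimg d"
  using assms cinv_in_cdom[OF assms(2)] cmap_cinv[OF assms(2)] cmap_in_cimg unfolding chart_over_def by metis

text \<open>The chain rule applied to the two ways of writing the map in the charts \<open>c\<close> and \<open>d'\<close>.\<close>

lemma jac_chart_over:
  assumes M: "chart_linear M N f L" and c: "c \<in> atlas M" "c' \<in> atlas M" and d: "d \<in> atlas N" "d' \<in> atlas N"
    and over: "chart_over L f c d" "chart_over L f c' d'" and p: "p \<in> cdom c" "p \<in> cdom c'"
  shows "L (jac c c' p v) = jac d d' (f p) (L v)"
proof -
  have sM: "smooth_manifold M" and sN: "smooth_manifold N" and L: "bounded_linear L"
    using M unfolding chart_linear_def by auto
  let ?U = "cmap c ` (cdom c \<inter> cdom c')"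
  have 1: "((\<lambda>x. L (cmap c' (cinv c x))) has_derivative (\<lambda>v. L (jac c c' p v))) (at (cmap c p))"
    by (rule bounded_linear.has_derivative[OF L jac_has_derivative[OF sM c p]])
  have fp: "f p \<in> cdom d" "f p \<in> cdom d'" "cmap d (f p) = L (cmap c p)"
    using over p by (auto simp: chart_over_def)
  have "((\<lambda>x. cmap d' (cinv d x)) has_derivative jac d d' (f p)) (at (L (cmap c p)))"
    using jac_has_derivative[OF sN d fp(1,2)] fp(3) by simp
  from has_derivative_compose[OF bounded_linear_imp_has_derivative[OF L] this]
  have 2: "((\<lambda>x. cmap d' (cinv d (L x))) has_derivative (\<lambda>v. jac d d' (f p) (L v))) (at (cmap c p))" .
  have 3: "((\<lambda>x. cmap d' (cinv d (L x))) has_derivative (\<lambda>v. L (jac c c' p v))) (at (cmap c p))"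
  proof (rule has_derivative_transform_within_open[OF 1 open_overlap[OF sM c]])
    show "cmap c p \<in> ?U" using p by simp
    fix x assume "x \<in> ?U"
    then obtain q where q: "x = cmap c q" "q \<in> cdom c" "q \<in> cdom c'" by blast
    then have "f q \<in> cdom d" "cmap d (f q) = L x" "cmap d' (f q) = L (cmap c' q)" using over by (auto simp: chart_over_def)
    then show "L (cmap c' (cinv c x)) = cmap d' (cinv d (L x))"
      using cinv_cmap[OF sM c(1) q(2)] cinv_cmap[OF sN d(1)] q(1) by metis
  qed
  show ?thesis using has_derivative_unique[OF 2 3] by metis
qed

text \<open>The definition of the pullback picks some chart of the target; the transformation law of \<open>\<omega>\<close> shows
  that the chart \<open>d\<close> gives the same result, and there the derivative of the map is \<open>L\<close>.\<close>

lemma pullback_chart_over: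
  fixes \<omega> :: "('b, 'f::euclidean_space, 'v::real_normed_field) form"
  assumes M: "chart_linear M N f L" and \<omega>: "is_form N k \<omega>"
    and c: "c \<in> atlas M" and d: "d \<in> atlas N" and over: "chart_over L f c d" and x: "x \<in> cimg c"
  shows "pullback M N f \<omega> c x vs = \<omega> d (L x) (map L vs)"
proof -
  have sM: "smooth_manifold M" and sN: "smooth_manifold N" and L: "bounded_linear L"
    using M unfolding chart_linear_def by auto
  define p where "p = cinv c x"
  define d' where "d' = (SOME d'. d' \<in> atlas N \<and> f p \<in> cdom d')"
  have p: "p \<in> cdom c" "cmap c p = x" using cinv_in_cdom[OF x] cmap_cinv[OF x] by (simp_all add: p_def)
  have fp: "f p \<in> cdom d" "cmap d (f p) = L x" using over p by (auto simp: chart_over_def)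
  have d': "d' \<in> atlas N" "f p \<in> cdom d'"
    using someI[of "\<lambda>d'. d' \<in> atlas N \<and> f p \<in> cdom d'" d] d fp by (auto simp: d'_def)
  let ?U = "cmap d ` (cdom d \<inter> cdom d')"
  have "((\<lambda>y. cmap d' (cinv d y)) has_derivative jac d d' (f p)) (at (L x))"
    using jac_has_derivative[OF sN d d'(1) fp(1) d'(2)] fp(2) by simp
  from has_derivative_compose[OF bounded_linear_imp_has_derivative[OF L] this]
  have 1: "((\<lambda>y. cmap d' (cinv d (L y))) has_derivative (\<lambda>v. jac d d' (f p) (L v))) (at x)" .
  have "((\<lambda>y. cmap d' (f (cinv c y))) has_derivative (\<lambda>v. jac d d' (f p) (L v))) (at x)"
  proof (rule has_derivative_transform_within_open[OF 1 chart_homeomorphism(2)[OF sM c] x])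
    fix y assume y: "y \<in> cimg c"
    have "f (cinv c y) \<in> cdom d \<and> cmap d (f (cinv c y)) = L y"
      using over cinv_in_cdom[OF y] cmap_cinv[OF y] unfolding chart_over_def by metis
    then show "cmap d' (cinv d (L y)) = cmap d' (f (cinv c y))" using cinv_cmap[OF sN d] by metis
  qed
  from frechet_derivative_at[OF this]
  have "pullback M N f \<omega> c x vs = \<omega> d' (cmap d' (f p)) (map (\<lambda>v. jac d d' (f p) (L v)) vs)"
    using c x unfolding pullback_def p_def d'_def by (simp add: Let_def)
  also have "\<dots> = \<omega> d (cmap d (f p)) (map L vs)"
    using is_form_transform[OF \<omega> d d'(1) fp(1) d'(2), of "map L vs"] by (simp add: o_def)
  finally show ?thesis by (simp add: fp)
qed

lemma is_form_pullback:
  fixes \<omega> :: "('b, 'f::euclidean_space, 'v::real_normed_field) form"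
  assumes M: "chart_linear M N f L" and \<omega>: "is_form N k \<omega>"
  shows "is_form M k (pullback M N f \<omega>)"
proof (rule is_formI)
  have sM: "smooth_manifold M" and L: "bounded_linear L"
    using M unfolding chart_linear_def by auto
  have over: "\<exists>d\<in>atlas N. chart_over L f c d" if "c \<in> atlas M" for c
    using M that by (simp add: chart_linear_def)
  note eq = pullback_chart_over[OF M \<omega>]
  fix c assume c: "c \<in> atlas M"
  obtain d where d: "d \<in> atlas N" "chart_over L f c d" using over[OF c] by blast
  note eq_c = eq[OF c d]
  note cimg = chart_over_cimg[OF d(2)]
  show "smooth_on (cimg c) (\<lambda>x. pullback M N f \<omega> c x vs)" for vs
    by (rule smooth_on_cong[OF chart_homeomorphism(2)[OF sM c] eq_c[symmetric]])
      (auto intro: smooth_on_compose_linear[OF L chart_homeomorphism(2)[OF sM c] cimg is_form_smooth[OF \<omega> d(1)]])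
  show "linear (\<lambda>v. pullback M N f \<omega> c x (vs[i := v]))" if "x \<in> cimg c" "length vs = k" "i < k" for x vs i
  proof -
    have "linear (\<lambda>v. \<omega> d (L x) ((map L vs)[i := v]))"
      using is_form_linear[OF \<omega> d(1) cimg[OF that(1)], of "map L vs" i] that by simp
    from linear_compose[OF bounded_linear.linear[OF L] this]
    show ?thesis by (simp add: eq_c[OF that(1)] map_update o_def)
  qed
  show "pullback M N f \<omega> c x vs = 0"
    if "x \<in> cimg c" "length vs = k" "i < k" "j < k" "i \<noteq> j" "vs ! i = vs ! j" for x vs i j
    unfolding eq_c[OF that(1)]
    using is_form_alternating[OF \<omega> d(1) cimg[OF that(1)], of "map L vs" i j] that by simp
  show "pullback M N f \<omega> c (cmap c p) vs = pullback M N f \<omega> c' (cmap c' p) (map (jac c c' p) vs)"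
    if c': "c' \<in> atlas M" and p: "p \<in> cdom c" "p \<in> cdom c'" for c' p vs
  proof -
    obtain d' where d': "d' \<in> atlas N" "chart_over L f c' d'" using over[OF c'] by blast
    have fp: "f p \<in> cdom d" "f p \<in> cdom d'" "L (cmap c p) = cmap d (f p)" "L (cmap c' p) = cmap d' (f p)"
      using d d' p by (auto simp: chart_over_def)
    have "map L (map (jac c c' p) vs) = map (jac d d' (f p)) (map L vs)"
      using jac_chart_over[OF M c c' d(1) d'(1) d(2) d'(2) p] by simp
    then have "\<omega> d' (cmap d' (f p)) (map L (map (jac c c' p) vs)) = \<omega> d' (cmap d' (f p)) (map (jac d d' (f p)) (map L vs))"
      by (simp only:)
    then show ?thesis
      using eq_c[OF cmap_in_cimg[OF p(1)]] eq[OF c' d' cmap_in_cimg[OF p(2)]]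
        is_form_transform[OF \<omega> d(1) d'(1) fp(1,2)] fp(3,4) by (simp del: map_map)
  qed
next
  fix c x and vs :: "'c list" assume n: "\<not> (c \<in> atlas M \<and> x \<in> cimg c \<and> length vs = k)"
  show "pullback M N f \<omega> c x vs = 0"
  proof (cases "c \<in> atlas M \<and> x \<in> cimg c")
    case True
    then obtain d where d: "d \<in> atlas N" "chart_over L f c d" using M by (auto simp: chart_linear_def)
    show ?thesis using True n pullback_chart_over[OF M \<omega> _ d] is_form_outside[OF \<omega>] by auto
  next
    case False
    then show ?thesis by (auto simp: pullback_def)
  qed
qed

text \<open>The chain rule in every summand, where \<open>L\<close> is its own derivative. Being about coordinate
  expressions rather than forms, it also applies to wedge products.\<close>

lemma ext_d_chart_over:
  fixes \<omega> :: "('b, 'f::euclidean_space, 'v::real_normed_field) form"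
  assumes L: "bounded_linear L" and x: "x \<in> cimg c" and cimg: "open (cimg c)" "\<And>y. y \<in> cimg c \<Longrightarrow> L y \<in> cimg d"
    and eq: "\<And>y vs. y \<in> cimg c \<Longrightarrow> \<omega>' c y vs = \<omega> d (L y) (map L vs)"
    and diff: "\<And>vs. (\<lambda>y. \<omega> d y vs) differentiable at (L x)"
  shows "ext_d \<omega>' c x vs = ext_d \<omega> d (L x) (map L vs)"
proof -
  have "frechet_derivative (\<lambda>y. \<omega>' c y vs) (at x) v = frechet_derivative (\<lambda>y. \<omega> d y (map L vs)) (at (L x)) (L v)" for vs v
  proof -
    have "((\<lambda>y. \<omega> d y (map L vs)) has_derivative frechet_derivative (\<lambda>y. \<omega> d y (map L vs)) (at (L x))) (at (L x))"
      using diff by (simp add: frechet_derivative_works)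
    from has_derivative_compose[OF bounded_linear_imp_has_derivative[OF L] this]
    have "((\<lambda>y. \<omega>' c y vs) has_derivative (\<lambda>v. frechet_derivative (\<lambda>y. \<omega> d y (map L vs)) (at (L x)) (L v))) (at x)"
      by (rule has_derivative_transform_within_open[OF _ cimg(1) x]) (simp add: eq)
    from fun_cong[OF frechet_derivative_at[OF this], of v] show ?thesis by simp
  qed
  then show ?thesis using x cimg(2) by (simp add: ext_d_def take_map drop_map)
qed

section \<open>Products of manifolds\<close>

lemma second_countable_prod:
  assumes "second_countable X" "second_countable Y"
  shows "second_countable (prod_topology X Y)"
proof -
  obtain A where A: "countable A" "\<And>V. V \<in> A \<Longrightarrow> openin X V"
    "\<And>U x. openin X U \<Longrightarrow> x \<in> U \<Longrightarrow> \<exists>V\<in>A. x \<in> V \<and> V \<subseteq> U"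
    using assms(1) unfolding second_countable_def by metis
  obtain B where B: "countable B" "\<And>V. V \<in> B \<Longrightarrow> openin Y V"
    "\<And>U x. openin Y U \<Longrightarrow> x \<in> U \<Longrightarrow> \<exists>V\<in>B. x \<in> V \<and> V \<subseteq> U"
    using assms(2) unfolding second_countable_def by metis
  show ?thesis unfolding second_countable_def
  proof (intro exI[of _ "(\<lambda>(U, V). U \<times> V) ` (A \<times> B)"] conjI ballI allI impI)
    show "countable ((\<lambda>(U, V). U \<times> V) ` (A \<times> B))" using A(1) B(1) by simp
    show "openin (prod_topology X Y) V" if "V \<in> (\<lambda>(U, V). U \<times> V) ` (A \<times> B)" for V
      using that A(2) B(2) by (auto simp: openin_prod_Times_iff)
    fix U z assume "openin (prod_topology X Y) U \<and> z \<in> U"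
    then obtain V W where "openin X V" "openin Y W" "fst z \<in> V" "snd z \<in> W" "V \<times> W \<subseteq> U"
      unfolding openin_prod_topology_alt by (metis prod.collapse)
    moreover obtain V' where "V' \<in> A" "fst z \<in> V'" "V' \<subseteq> V" using A(3) calculation by metis
    moreover obtain W' where "W' \<in> B" "snd z \<in> W'" "W' \<subseteq> W" using B(3) calculation by metis
    ultimately show "\<exists>V\<in>(\<lambda>(U, V). U \<times> V) ` (A \<times> B). z \<in> V \<and> V \<subseteq> U"
      by (intro bexI[of _ "V' \<times> W'"]) (auto simp: mem_Times_iff)
  qed
qed

lemma cdom_prod_chart [simp]: "cdom (prod_chart c d) = cdom c \<times> cdom d"
  by (simp add: prod_chart_def cdom_def)
lemma cmap_prod_chart [simp]: "cmap (prod_chart c d) = map_prod (cmap c) (cmap d)"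
  by (simp add: prod_chart_def cmap_def)
lemma cimg_prod_chart [simp]: "cimg (prod_chart c d) = cimg c \<times> cimg d"
  by (simp add: cimg_def map_prod_surj_on)

lemma atlas_prod: "c \<in> atlas (prod_manifold M N) \<longleftrightarrow> (\<exists>c1\<in>atlas M. \<exists>c2\<in>atlas N. c = prod_chart c1 c2)"
  by (auto simp: prod_manifold_def)

lemma smooth_manifold_prod:
  fixes M :: "('a, 'e::euclidean_space) manifold" and N :: "('b, 'f::euclidean_space) manifold"
  assumes M: "smooth_manifold M" and N: "smooth_manifold N"
  shows "smooth_manifold (prod_manifold M N)"
  unfolding smooth_manifold_def
proof (intro conjI ballI)
  have top: "mtop (prod_manifold M N) = prod_topology (mtop M) (mtop N)" by (simp add: prod_manifold_def)
  show "Hausdorff_space (mtop (prod_manifold M N))"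
    using M N by (simp add: top smooth_manifold_def Hausdorff_space_prod_topology)
  show "second_countable (mtop (prod_manifold M N))"
    using M N by (simp add: top smooth_manifold_def second_countable_prod)
  have "(\<Union>c\<in>atlas M. cdom c) = topspace (mtop M)" "(\<Union>c\<in>atlas N. cdom c) = topspace (mtop N)"
    using M N by (simp_all add: smooth_manifold_def)
  moreover have "(\<Union>c\<in>atlas (prod_manifold M N). cdom c) = (\<Union>c\<in>atlas M. cdom c) \<times> (\<Union>d\<in>atlas N. cdom d)"
  proof (intro equalityI subsetI)
    fix z assume "z \<in> (\<Union>c\<in>atlas M. cdom c) \<times> (\<Union>d\<in>atlas N. cdom d)"
    then obtain c d where cd: "c \<in> atlas M" "d \<in> atlas N" "z \<in> cdom (prod_chart c d)"
      unfolding cdom_prod_chart by blast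
    then have "prod_chart c d \<in> atlas (prod_manifold M N)" unfolding atlas_prod by blast
    then show "z \<in> (\<Union>c\<in>atlas (prod_manifold M N). cdom c)" using cd(3) by (rule UN_I)
  next
    fix z assume "z \<in> (\<Union>c\<in>atlas (prod_manifold M N). cdom c)"
    then obtain e where "e \<in> atlas (prod_manifold M N)" "z \<in> cdom e" by (rule UN_E)
    moreover then obtain c d where cd: "c \<in> atlas M" "d \<in> atlas N" "e = prod_chart c d" unfolding atlas_prod by blast
    ultimately have "z \<in> cdom c \<times> cdom d" by (simp only: cdom_prod_chart)
    then show "z \<in> (\<Union>c\<in>atlas M. cdom c) \<times> (\<Union>d\<in>atlas N. cdom d)" using cd(1,2) by blast
  qed
  ultimately show "(\<Union>c\<in>atlas (prod_manifold M N). cdom c) = topspace (mtop (prod_manifold M N))"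
    by (simp add: top)
  fix c assume "c \<in> atlas (prod_manifold M N)"
  then obtain c1 c2 where c: "c = prod_chart c1 c2" "c1 \<in> atlas M" "c2 \<in> atlas N" by (auto simp: atlas_prod)
  note f1 = chart_homeomorphism[OF M c(2)] and f2 = chart_homeomorphism[OF N c(3)]
  show "openin (mtop (prod_manifold M N)) (cdom c)" using f1 f2 by (simp add: top c openin_prod_Times_iff)
  show "open (cimg c)" using f1 f2 by (simp add: c open_Times)
  obtain g1 where g1: "homeomorphic_maps (subtopology (mtop M) (cdom c1)) (top_of_set (cimg c1)) (cmap c1) g1"
    using f1(3) unfolding homeomorphic_map_maps by blast
  obtain g2 where g2: "homeomorphic_maps (subtopology (mtop N) (cdom c2)) (top_of_set (cimg c2)) (cmap c2) g2"
    using f2(3) unfolding homeomorphic_map_maps by blast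
  have "homeomorphic_maps (prod_topology (subtopology (mtop M) (cdom c1)) (subtopology (mtop N) (cdom c2)))
     (prod_topology (top_of_set (cimg c1)) (top_of_set (cimg c2))) (\<lambda>(x, y). (cmap c1 x, cmap c2 y)) (\<lambda>(x, y). (g1 x, g2 y))"
    using g1 g2 by (simp only: homeomorphic_maps_prod) simp
  then show "homeomorphic_map (subtopology (mtop (prod_manifold M N)) (cdom c)) (top_of_set (cimg c)) (cmap c)"
    unfolding homeomorphic_map_maps by (auto simp: top c subtopology_Times map_prod_def)
  fix c' assume "c' \<in> atlas (prod_manifold M N)"
  then obtain d1 d2 where d: "c' = prod_chart d1 d2" "d1 \<in> atlas M" "d2 \<in> atlas N" by (auto simp: atlas_prod)
  let ?U = "cmap c1 ` (cdom c1 \<inter> cdom d1)" and ?V = "cmap c2 ` (cdom c2 \<inter> cdom d2)"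
  have UV: "cmap c ` (cdom c \<inter> cdom c') = ?U \<times> ?V"
    by (simp add: c d Times_Int_Times map_prod_surj_on)
  have op: "open (?U \<times> ?V)" using open_overlap[OF M c(2) d(2)] open_overlap[OF N c(3) d(3)] by (rule open_Times)
  have "smooth_on (?U \<times> ?V) (\<lambda>z. cmap d1 (cinv c1 (fst z)))"
    by (rule smooth_on_compose_linear[OF bounded_linear_fst op _ transition_smooth[OF M c(2) d(2)]]) auto
  moreover have "smooth_on (?U \<times> ?V) (\<lambda>z. cmap d2 (cinv c2 (snd z)))"
    by (rule smooth_on_compose_linear[OF bounded_linear_snd op _ transition_smooth[OF N c(3) d(3)]]) auto
  ultimately have "smooth_on (?U \<times> ?V) (\<lambda>z. (cmap d1 (cinv c1 (fst z)), cmap d2 (cinv c2 (snd z))))"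
    by (rule smooth_on_Pair[OF op])
  then show "smooth_on (cmap c ` (cdom c \<inter> cdom c')) (\<lambda>x. cmap c' (cinv c x))"
    unfolding UV
  proof (rule smooth_on_cong[OF op, rotated])
    fix z assume "z \<in> ?U \<times> ?V"
    then obtain p q where z: "z = (cmap c1 p, cmap c2 q)" "p \<in> cdom c1" "q \<in> cdom c2" by blast
    have "inj_on (cmap c) (cdom c)"
      using cmap_inj[OF M c(2)] cmap_inj[OF N c(3)] by (simp add: c map_prod_inj_on)
    from inv_into_f_f[OF this, of "(p, q)"] z have "cinv c z = (p, q)" by (simp add: cinv_def c)
    then show "(cmap d1 (cinv c1 (fst z)), cmap d2 (cinv c2 (snd z))) = cmap c' (cinv c z)"
      using cinv_cmap[OF M c(2) z(2)] cinv_cmap[OF N c(3) z(3)] by (simp add: z d)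
  qed
qed

lemma chart_over_fst: "chart_over fst fst (prod_chart c d) c"
  and chart_over_snd: "chart_over snd snd (prod_chart c d) d"
  by (auto simp: chart_over_def)

lemma chart_linear_fst:
  assumes "smooth_manifold M" "smooth_manifold N"
  shows "chart_linear (prod_manifold M N) M fst fst"
  unfolding chart_linear_def
proof (intro conjI ballI)
  fix c assume "c \<in> atlas (prod_manifold M N)"
  then show "\<exists>d\<in>atlas M. chart_over fst fst c d"
    unfolding atlas_prod using chart_over_fst by blast
qed (use assms smooth_manifold_prod[OF assms] bounded_linear_fst in blast)+

lemma chart_linear_snd:
  assumes "smooth_manifold M" "smooth_manifold N"
  shows "chart_linear (prod_manifold M N) N snd snd"
  unfolding chart_linear_def
proof (intro conjI ballI)
  fix c assume "c \<in> atlas (prod_manifold M N)"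
  then show "\<exists>d\<in>atlas N. chart_over snd snd c d"
    unfolding atlas_prod using chart_over_snd by blast
qed (use assms smooth_manifold_prod[OF assms] bounded_linear_snd in blast)+

section \<open>The circle\<close>

lemma Arg_less_pi: "z \<noteq> -1 \<Longrightarrow> norm z = 1 \<Longrightarrow> Arg z < pi"
proof -
  assume "z \<noteq> -1" "norm z = 1"
  moreover have "z = cis (Arg z)" if "norm z = 1" using rcis_cmod_Arg[of z] that by (simp add: rcis_def)
  ultimately show ?thesis using Arg_le_pi[of z] cis_pi by (metis order_le_less)
qed

lemma Arg2pi_cis: "0 \<le> x \<Longrightarrow> x < 2 * pi \<Longrightarrow> Arg2pi (cis x) = x"
  by (rule Arg2pi_unique[of 1]) (simp_all add: cis_conv_exp)

lemma cis_Arg2pi: "norm z = 1 \<Longrightarrow> cis (Arg2pi z) = z"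
  using complex_norm_eq_1_exp[of z] by (simp add: cis_conv_exp)

lemma cis_Arg_norm_1: "norm z = 1 \<Longrightarrow> cis (Arg z) = z"
  using rcis_cmod_Arg[of z] by (simp add: rcis_def)

lemma Arg2pi_pos: "z \<noteq> 1 \<Longrightarrow> norm z = 1 \<Longrightarrow> Arg2pi z > 0"
  using cis_Arg2pi[of z] Arg2pi_ge_0[of z] by (metis cis_zero order_le_less)

lemma atlas_circle: "c \<in> atlas circle \<longleftrightarrow> c = (sphere 0 1 - {-1}, Arg) \<or> c = (sphere 0 1 - {1}, Arg2pi)"
  by (simp add: circle_def)

lemma cis_neq_1: "0 < x \<Longrightarrow> x < 2 * pi \<Longrightarrow> cis x \<noteq> 1"
  using Arg2pi_cis[of x] Arg2pi_cis[of 0] by auto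

lemma cis_neq_m1: "- pi < x \<Longrightarrow> x < pi \<Longrightarrow> cis x \<noteq> - 1"
  using Arg_cis[of x] Arg_cis[of pi] by (auto simp: cis_pi)

lemma cimg_Arg: "cimg (sphere 0 1 - {-1}, Arg) = {-pi<..<pi}"
proof (intro equalityI subsetI)
  fix x assume "x \<in> {-pi<..<pi}"
  then show "x \<in> cimg (sphere 0 1 - {-1}, Arg)"
    using Arg_cis[of x] cis_neq_m1[of x] unfolding cimg_def cmap_def cdom_def
    by (intro image_eqI[of _ _ "cis x"]) auto
qed (auto simp: cimg_def cmap_def cdom_def mpi_less_Arg Arg_less_pi)

lemma cimg_Arg2pi: "cimg (sphere 0 1 - {1}, Arg2pi) = {0<..<2*pi}"
proof (intro equalityI subsetI)
  fix x assume "x \<in> {0<..<2*pi}"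
  then show "x \<in> cimg (sphere 0 1 - {1}, Arg2pi)"
    using Arg2pi_cis[of x] cis_neq_1[of x] unfolding cimg_def cmap_def cdom_def
    by (intro image_eqI[of _ _ "cis x"]) auto
qed (auto simp: cimg_def cmap_def cdom_def Arg2pi_pos Arg2pi_lt_2pi)

lemma cis_cmap_circle: "c \<in> atlas circle \<Longrightarrow> p \<in> cdom c \<Longrightarrow> cis (cmap c p) = p"
  by (auto simp: atlas_circle cdom_def cmap_def cis_Arg_norm_1 cis_Arg2pi)

lemma cinv_circle: "c \<in> atlas circle \<Longrightarrow> x \<in> cimg c \<Longrightarrow> cinv c x = cis x"
  using cis_cmap_circle[OF _ cinv_in_cdom] cmap_cinv by metis

lemma circle_overlap:
  assumes "c \<in> atlas circle"
  shows "cmap c ` (cdom c \<inter> cdom c') = {x \<in> cimg c. cis x \<in> cdom c'}"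
proof (intro equalityI subsetI)
  fix x assume "x \<in> cmap c ` (cdom c \<inter> cdom c')"
  then show "x \<in> {x \<in> cimg c. cis x \<in> cdom c'}" using cis_cmap_circle[OF assms] by (auto simp: cimg_def)
next
  fix x assume x: "x \<in> {x \<in> cimg c. cis x \<in> cdom c'}"
  then have "cis x \<in> cdom c" "cmap c (cis x) = x"
    using cinv_circle[OF assms] cinv_in_cdom[of x c] cmap_cinv[of x c] by auto
  then show "x \<in> cmap c ` (cdom c \<inter> cdom c')" using x by (intro image_eqI[of _ _ "cis x"]) auto
qed

text \<open>Two angle functions differ by a locally constant multiple of \<open>2 \<pi>\<close>.\<close>

lemma circle_transition:
  assumes c: "c \<in> atlas circle" "c' \<in> atlas circle"
  shows "open (cmap c ` (cdom c \<inter> cdom c'))" (is ?op)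
    and "x \<in> cmap c ` (cdom c \<inter> cdom c') \<Longrightarrow> ((\<lambda>x. cmap c' (cinv c x)) has_derivative (\<lambda>v. v)) (at x)"
proof -
  define A B :: "(complex, real) chart" where "A = (sphere 0 1 - {-1}, Arg)" and "B = (sphere 0 1 - {1}, Arg2pi)"
  have [simp]: "cimg A = {-pi<..<pi}" "cimg B = {0<..<2*pi}" "cdom A = sphere 0 1 - {-1}" "cdom B = sphere 0 1 - {1}"
    "cmap A = Arg" "cmap B = Arg2pi"
    by (simp_all add: A_def B_def cimg_Arg cimg_Arg2pi cdom_def cmap_def)
  have in_atlas: "A \<in> atlas circle" "B \<in> atlas circle" by (simp_all add: A_def B_def atlas_circle)
  have cases: "c = A \<or> c = B" "c' = A \<or> c' = B" using c by (simp_all add: A_def B_def atlas_circle)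
  have AA: "{x \<in> cimg A. cis x \<in> cdom A} = {-pi<..<pi}" using cis_neq_m1 by auto
  have BB: "{x \<in> cimg B. cis x \<in> cdom B} = {0<..<2*pi}" using cis_neq_1 by auto
  have AB: "{x \<in> cimg A. cis x \<in> cdom B} = {-pi<..<0} \<union> {0<..<pi}"
  proof -
    have "cis x = 1 \<longleftrightarrow> x = 0" if "-pi < x" "x < pi" for x using Arg_cis[of x] that by fastforce
    then show ?thesis by force
  qed
  have BA: "{x \<in> cimg B. cis x \<in> cdom A} = {0<..<pi} \<union> {pi<..<2*pi}"
  proof -
    have "cis x = -1 \<longleftrightarrow> x = pi" if "0 < x" "x < 2 * pi" for x
      using Arg2pi_cis[of x] Arg2pi_cis[of pi] that by (auto simp: cis_pi)
    then show ?thesis by force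
  qed
  show ?op unfolding circle_overlap[OF c(1)] using cases
    by (elim disjE) (simp_all only: AA BB AB BA open_Un open_greaterThanLessThan)
  assume x: "x \<in> cmap c ` (cdom c \<inter> cdom c')"
  \<comment> \<open>Near \<open>x\<close> the coordinate change is the translation by \<open>k\<close>.\<close>
  have shift: "((\<lambda>x. cmap c' (cinv c x)) has_derivative (\<lambda>v. v)) (at x)"
    if "open U" "x \<in> U" "U \<subseteq> cimg c" "\<And>y. y \<in> U \<Longrightarrow> cmap c' (cis y) = y + k" for U k
  proof (rule has_derivative_transform_within_open[OF _ that(1,2)])
    show "((\<lambda>y. y + k) has_derivative (\<lambda>v. v)) (at x)" by (auto intro!: derivative_eq_intros)
    show "y + k = cmap c' (cinv c y)" if "y \<in> U" for y
      using \<open>U \<subseteq> cimg c\<close> that cinv_circle[OF c(1)] \<open>\<And>y. y \<in> U \<Longrightarrow> cmap c' (cis y) = y + k\<close> by (simp add: subset_iff)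
  qed
  have period: "cis (y + 2 * pi) = cis y" "cis (y - 2 * pi) = cis y" for y
    by (simp_all add: cis_mult[symmetric] cis_divide[symmetric])
  have AtoB: "Arg2pi (cis y) = y + 2 * pi" if "-pi < y" "y < 0" for y
    using Arg2pi_cis[of "y + 2 * pi"] that by (simp add: period)
  have BtoA: "Arg (cis y) = y + (- 2 * pi)" if "pi < y" "y < 2 * pi" for y
    using Arg_cis[of "y - 2 * pi"] that by (simp add: period)
  note x' = x[unfolded circle_overlap[OF c(1)]]
  show "((\<lambda>x. cmap c' (cinv c x)) has_derivative (\<lambda>v. v)) (at x)"
    using cases
  proof (elim disjE)
    assume eq: "c = A" "c' = A"
    show ?thesis using x' unfolding eq AA
      using shift[of "{-pi<..<pi}" 0] by (auto simp: eq Arg_cis)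
  next
    assume eq: "c = B" "c' = B"
    show ?thesis using x' unfolding eq BB
      using shift[of "{0<..<2*pi}" 0] by (auto simp: eq Arg2pi_cis)
  next
    assume eq: "c = A" "c' = B"
    from x' have "x \<in> {-pi<..<0} \<or> x \<in> {0<..<pi}" unfolding eq AB by blast
    then show ?thesis
      using shift[of "{-pi<..<0}" "2 * pi"] shift[of "{0<..<pi}" 0] by (auto simp: eq AtoB Arg2pi_cis subset_iff)
  next
    assume eq: "c = B" "c' = A"
    from x' have "x \<in> {0<..<pi} \<or> x \<in> {pi<..<2*pi}" unfolding eq BA by blast
    then show ?thesis
      using shift[of "{pi<..<2*pi}" "- 2 * pi"] shift[of "{0<..<pi}" 0] by (auto simp: eq BtoA Arg_cis subset_iff)
  qed
qed

lemma second_countable_euclidean: "second_countable (euclidean :: 'a::second_countable_topology topology)"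
proof -
  obtain B :: "'a set set" where B: "countable B" "topological_basis B" using ex_countable_basis by blast
  show ?thesis unfolding second_countable_def
  proof (intro exI[of _ B] conjI ballI allI impI)
    show "openin euclidean V" if "V \<in> B" for V using topological_basis_open[OF B(2) that] by simp
    show "\<exists>V\<in>B. x \<in> V \<and> V \<subseteq> U" if "openin euclidean U \<and> x \<in> U" for U x
      using topological_basisE[OF B(2)] that by (metis open_openin)
  qed (rule B(1))
qed

lemma smooth_manifold_circle: "smooth_manifold circle"
  unfolding smooth_manifold_def
proof (intro conjI ballI)
  have top: "mtop circle = top_of_set (sphere 0 1)" by (simp add: circle_def)
  show "Hausdorff_space (mtop circle)" by (simp add: top Hausdorff_space_subtopology)
  show "second_countable (mtop circle)"
    by (simp add: top second_countable_subtopology second_countable_euclidean)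
  show "(\<Union>c\<in>atlas circle. cdom c) = topspace (mtop circle)" by (auto simp: circle_def cdom_def)
  fix c assume c: "c \<in> atlas circle"
  show "openin (mtop circle) (cdom c)"
    using c by (auto simp: top atlas_circle cdom_def intro!: openin_delete)
  show op: "open (cimg c)" using c by (auto simp: atlas_circle cimg_Arg cimg_Arg2pi)
  have sub: "cdom c \<subseteq> sphere 0 1" using c by (auto simp: atlas_circle cdom_def)
  have "homeomorphic_maps (top_of_set (cdom c)) (top_of_set (cimg c)) (cmap c) cis"
    unfolding homeomorphic_maps_def
  proof (intro conjI ballI)
    have "continuous_on (cdom c) (cmap c)"
    proof -
      have "z \<notin> \<real>\<^sub>\<le>\<^sub>0" if "norm z = 1" "z \<noteq> -1" for z :: complex
        using that by (auto elim!: nonpos_Reals_cases)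
      moreover have "z \<notin> \<real>\<^sub>\<ge>\<^sub>0" if "norm z = 1" "z \<noteq> 1" for z :: complex
        using that by (auto elim!: nonneg_Reals_cases)
      ultimately show ?thesis
        using c continuous_at_Arg continuous_at_Arg2pi
        by (auto simp: atlas_circle cdom_def cmap_def intro!: continuous_at_imp_continuous_on)
    qed
    then show "continuous_map (top_of_set (cdom c)) (top_of_set (cimg c)) (cmap c)"
      by (auto simp: cimg_def)
    have "continuous_on (cimg c) cis" by (intro continuous_intros)
    then show "continuous_map (top_of_set (cimg c)) (top_of_set (cdom c)) cis"
      using cis_cmap_circle[OF c] by (auto simp: cimg_def)
  qed (use cis_cmap_circle[OF c] in \<open>auto simp: cimg_def\<close>)
  then show "homeomorphic_map (subtopology (mtop circle) (cdom c)) (top_of_set (cimg c)) (cmap c)"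
    using sub unfolding homeomorphic_map_maps by (auto simp: top subtopology_subtopology Int_absorb1)
  fix c' assume c': "c' \<in> atlas circle"
  show "smooth_on (cmap c ` (cdom c \<inter> cdom c')) (\<lambda>x. cmap c' (cinv c x))"
    by (rule smooth_on_constant_derivative[OF circle_transition[OF c c']])
qed

text \<open>The form \<open>d\<theta>\<close>, which is the same in both charts.\<close>

definition angle_form :: "(complex, real, real) form" where
  "angle_form c x vs = (if c \<in> atlas circle \<and> x \<in> cimg c \<and> length vs = 1 then hd vs else 0)"

lemma is_form_angle_form: "is_form circle 1 angle_form"
proof (rule is_formI)
  fix c assume c: "c \<in> atlas circle"
  show "linear (\<lambda>v. angle_form c x (vs[i := v]))" if "x \<in> cimg c" "length vs = 1" "i < 1" for x vs i
    using that c by (auto simp: angle_form_def length_Suc_conv linear_id[unfolded id_def])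
  show "smooth_on (cimg c) (\<lambda>x. angle_form c x vs)" for vs
    by (rule smooth_on_cong[OF chart_homeomorphism(2)[OF smooth_manifold_circle c] _ smooth_on_const[of _ "if length vs = 1 then hd vs else 0"]])
      (simp add: angle_form_def c)
  show "angle_form c (cmap c p) vs = angle_form c' (cmap c' p) (map (jac c c' p) vs)"
    if c': "c' \<in> atlas circle" and p: "p \<in> cdom c" "p \<in> cdom c'" for c' p vs
  proof -
    have "jac c c' p = (\<lambda>v. v)"
      unfolding jac_def using circle_transition(2)[OF c c', of "cmap c p"] p
      by (intro frechet_derivative_at[symmetric]) auto
    then show ?thesis using c c' p cmap_in_cimg[of p c] cmap_in_cimg[of p c'] by (simp add: angle_form_def)
  qed
qed (auto simp: angle_form_def)

lemma nowhere_zero_angle_form: "nowhere_zero circle angle_form"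
  unfolding nowhere_zero_def by (auto simp: angle_form_def intro!: exI[of _ "[1]"])

section \<open>\<open>SU(2)\<close> structures from adapted coframes\<close>

lemma is_form_zero: "is_form M k 0"
  by (rule is_formI) (auto simp: smooth_on_const intro: linear_zero)

lemma is_form_add:
  assumes M: "smooth_manifold M" and f: "is_form M k \<omega>" "is_form M k \<tau>"
  shows "is_form M k (\<omega> + \<tau>)"
proof (rule is_formI)
  fix c assume c: "c \<in> atlas M"
  show "smooth_on (cimg c) (\<lambda>x. (\<omega> + \<tau>) c x vs)" for vs
    using smooth_on_add[OF chart_homeomorphism(2)[OF M c] is_form_smooth[OF f(1) c] is_form_smooth[OF f(2) c]]
    by simp
  show "linear (\<lambda>v. (\<omega> + \<tau>) c x (vs[i := v]))" if "x \<in> cimg c" "length vs = k" "i < k" for x vs i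
    using linear_compose_add[OF is_form_linear[OF f(1) c that] is_form_linear[OF f(2) c that]] by simp
  show "(\<omega> + \<tau>) c (cmap c p) vs = (\<omega> + \<tau>) c' (cmap c' p) (map (jac c c' p) vs)"
    if c': "c' \<in> atlas M" and p: "p \<in> cdom c" "p \<in> cdom c'" for c' p vs
    using is_form_transform[OF f(1) c c' p, of vs] is_form_transform[OF f(2) c c' p, of vs] by simp
  show "(\<omega> + \<tau>) c x vs = 0"
    if "x \<in> cimg c" "length vs = k" "i < k" "j < k" "i \<noteq> j" "vs ! i = vs ! j" for x vs i j
    using is_form_alternating[OF f(1) c that] is_form_alternating[OF f(2) c that] by simp
next
  fix c x and vs :: "'b list" assume "\<not> (c \<in> atlas M \<and> x \<in> cimg c \<and> length vs = k)"
  from is_form_outside[OF f(1) this] is_form_outside[OF f(2) this] show "(\<omega> + \<tau>) c x vs = 0" by simp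
qed

lemma is_form_bounded_linear:
  fixes \<omega> :: "('a, 'e::euclidean_space, 'v::real_normed_field) form" and A :: "'v \<Rightarrow> 'w::real_normed_field"
  assumes M: "smooth_manifold M" and f: "is_form M k \<omega>" and A: "bounded_linear A"
  shows "is_form M k (\<lambda>c x vs. A (\<omega> c x vs))"
proof (rule is_formI)
  have A0: "A 0 = 0" using A by (simp add: linear_simps)
  fix c assume c: "c \<in> atlas M"
  show "smooth_on (cimg c) (\<lambda>x. A (\<omega> c x vs))" for vs
    by (rule smooth_on_bounded_linear[OF A chart_homeomorphism(2)[OF M c] is_form_smooth[OF f c]])
  show "linear (\<lambda>v. A (\<omega> c x (vs[i := v])))" if "x \<in> cimg c" "length vs = k" "i < k" for x vs i
    using linear_compose[OF is_form_linear[OF f c that] bounded_linear.linear[OF A]] by (simp add: o_def)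
  show "A (\<omega> c (cmap c p) vs) = A (\<omega> c' (cmap c' p) (map (jac c c' p) vs))"
    if c': "c' \<in> atlas M" and p: "p \<in> cdom c" "p \<in> cdom c'" for c' p vs
    using is_form_transform[OF f c c' p, of vs] by simp
  show "A (\<omega> c x vs) = 0"
    if "x \<in> cimg c" "length vs = k" "i < k" "j < k" "i \<noteq> j" "vs ! i = vs ! j" for x vs i j
    using is_form_alternating[OF f c that] A0 by simp
next
  fix c x and vs :: "'e list" assume "\<not> (c \<in> atlas M \<and> x \<in> cimg c \<and> length vs = k)"
  then show "A (\<omega> c x vs) = 0" using is_form_outside[OF f] A by (simp add: linear_simps)
qed

lemma is_form_fscale: "smooth_manifold M \<Longrightarrow> is_form M k \<omega> \<Longrightarrow> is_form M k (r *\<^sub>F \<omega>)"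
  unfolding fscale_def by (rule is_form_bounded_linear) (simp_all add: bounded_linear_mult_right)

lemma is_form_of_real_form: "smooth_manifold M \<Longrightarrow> is_form M k \<omega> \<Longrightarrow> is_form M k (of_real_form \<omega>)"
  unfolding of_real_form_def by (rule is_form_bounded_linear[OF _ _ bounded_linear_of_real])

lemma is_form_Complex_form:
  assumes "smooth_manifold M" "is_form M k a" "is_form M k b"
  shows "is_form M k (Complex_form a b)"
  unfolding Complex_form_def
  by (rule is_form_add[OF assms(1) is_form_of_real_form[OF assms(1,2)]
      is_form_fscale[OF assms(1) is_form_of_real_form[OF assms(1,3)]]])

text \<open>The data from which an \<open>SU(2)\<close> structure on a 6-manifold is built: \<open>\<alpha> = \<rho> + i \<sigma>\<close> and a triple of
  \<open>2\<close>-forms which is in normal form with respect to some coframe at every point. The coframes need not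
  depend continuously on the point; they serve only to verify pointwise identities.\<close>

locale su2_forms =
  fixes M :: "('a, 'e::euclidean_space) manifold" and \<rho> \<sigma> W1 W2 W3 :: "('a, 'e, real) form" and a b :: real
  assumes M: "smooth_manifold M" and dim: "DIM('e) = 6"
    and forms: "is_form M 1 \<rho>" "is_form M 1 \<sigma>" "is_form M 2 W1" "is_form M 2 W2" "is_form M 2 W3"
    and ab: "a * a + b * b = 1"
    and coframe: "\<And>c x. c \<in> atlas M \<Longrightarrow> x \<in> cimg c \<Longrightarrow> \<exists>e1 e2 e3 e4.
      adapted_coframe (\<lambda>X Y. W1 c x [X, Y]) (\<lambda>X Y. W2 c x [X, Y]) (\<lambda>X Y. W3 c x [X, Y]) e1 e2 e3 e4 \<and>
      (\<forall>X. e1 X = 0 \<and> e2 X = 0 \<and> e3 X = 0 \<and> e4 X = 0 \<and> \<rho> c x [X] = 0 \<and> \<sigma> c x [X] = 0 \<longrightarrow> X = 0)"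
begin

text \<open>The fields of which the corresponding objects of \<^locale>\<open>su2_coframe\<close> are the values at a point. None of
  them mentions a coframe, so that smoothness and the transformation laws can be read off.\<close>

definition "\<omega> = a *\<^sub>F W1 + b *\<^sub>F W3"
definition "R = b *\<^sub>F W1 + (- a) *\<^sub>F W3"
definition "S c x X Y = R c x [X, Y] + (\<rho> c x [X] * \<sigma> c x [Y] - \<rho> c x [Y] * \<sigma> c x [X])"
definition "T c x X Y = - W2 c x [X, Y] - \<rho> c x [X] * \<rho> c x [Y] - \<sigma> c x [X] * \<sigma> c x [Y]"
definition "J c x X = (THE Z. \<forall>Y. S c x Z Y = T c x X Y)"
definition "g c x X Y = \<omega> c x [X, J c x Y] + (\<rho> c x [X] * \<sigma> c x [J c x Y] - \<rho> c x [J c x Y] * \<sigma> c x [X])"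

definition coframe_at where
  "coframe_at c x e1 e2 e3 e4 \<longleftrightarrow>
    su2_coframe e1 e2 e3 e4 (\<lambda>X. \<rho> c x [X]) (\<lambda>X. \<sigma> c x [X]) a b \<and>
    (\<forall>X Y. W1 c x [X, Y] = su2_coframe.w1 e1 e2 e3 e4 X Y) \<and>
    (\<forall>X Y. W2 c x [X, Y] = su2_coframe.w2 e1 e2 e3 e4 X Y) \<and>
    (\<forall>X Y. W3 c x [X, Y] = su2_coframe.w3 e1 e2 e3 e4 X Y)"

lemma coframe_at_exists:
  assumes "c \<in> atlas M" "x \<in> cimg c"
  shows "\<exists>e1 e2 e3 e4. coframe_at c x e1 e2 e3 e4"
proof -
  have lin: "linear (\<lambda>X. \<rho> c x [X])" "linear (\<lambda>X. \<sigma> c x [X])"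
    using is_form_linear[OF forms(1) assms, of "[0]" 0] is_form_linear[OF forms(2) assms, of "[0]" 0] by simp_all
  obtain e1 e2 e3 e4 where
      ad: "adapted_coframe (\<lambda>X Y. W1 c x [X, Y]) (\<lambda>X Y. W2 c x [X, Y]) (\<lambda>X Y. W3 c x [X, Y]) e1 e2 e3 e4"
    and sep: "\<forall>X. e1 X = 0 \<and> e2 X = 0 \<and> e3 X = 0 \<and> e4 X = 0 \<and> \<rho> c x [X] = 0 \<and> \<sigma> c x [X] = 0 \<longrightarrow> X = 0"
    using coframe[OF assms] by blast
  have lin_e: "linear e1" "linear e2" "linear e3" "linear e4" using ad by (simp_all only: adapted_coframe_def)
  have sep': "X = 0" if "e1 X = 0" "e2 X = 0" "e3 X = 0" "e4 X = 0" "\<rho> c x [X] = 0" "\<sigma> c x [X] = 0" for X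
    using sep that by blast
  interpret I: su2_coframe e1 e2 e3 e4 "\<lambda>X. \<rho> c x [X]" "\<lambda>X. \<sigma> c x [X]" a b
    by (rule su2_coframe.intro) ((rule lin_e lin dim)+, rule sep', assumption+, rule ab)
  have "coframe_at c x e1 e2 e3 e4"
    unfolding coframe_at_def using I.su2_coframe_axioms ad
    by (simp add: adapted_coframe_def I.w1_def I.w2_def I.w3_def)
  then show ?thesis by blast
qed

lemma coframe_atD:
  assumes "coframe_at c x e1 e2 e3 e4"
  shows "su2_coframe e1 e2 e3 e4 (\<lambda>X. \<rho> c x [X]) (\<lambda>X. \<sigma> c x [X]) a b"
    "W1 c x [X, Y] = su2_coframe.w1 e1 e2 e3 e4 X Y"
    "W2 c x [X, Y] = su2_coframe.w2 e1 e2 e3 e4 X Y"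
    "W3 c x [X, Y] = su2_coframe.w3 e1 e2 e3 e4 X Y"
    "\<omega> c x [X, Y] = su2_coframe.\<omega> e1 e2 e3 e4 a b X Y"
    "R c x [X, Y] = su2_coframe.R e1 e2 e3 e4 a b X Y"
    "S c x = su2_coframe.S e1 e2 e3 e4 (\<lambda>X. \<rho> c x [X]) (\<lambda>X. \<sigma> c x [X]) a b"
    "T c x = su2_coframe.T e1 e2 e3 e4 (\<lambda>X. \<rho> c x [X]) (\<lambda>X. \<sigma> c x [X])"
    "J c x = su2_coframe.J e1 e2 e3 e4 (\<lambda>X. \<rho> c x [X]) (\<lambda>X. \<sigma> c x [X]) a b"
    "g c x = su2_coframe.g e1 e2 e3 e4 (\<lambda>X. \<rho> c x [X]) (\<lambda>X. \<sigma> c x [X]) a b"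
proof -
  show I: "su2_coframe e1 e2 e3 e4 (\<lambda>X. \<rho> c x [X]) (\<lambda>X. \<sigma> c x [X]) a b"
    using assms by (simp add: coframe_at_def)
  interpret I: su2_coframe e1 e2 e3 e4 "\<lambda>X. \<rho> c x [X]" "\<lambda>X. \<sigma> c x [X]" a b by (rule I)
  show 1: "W1 c x [X, Y] = I.w1 X Y" "W2 c x [X, Y] = I.w2 X Y" "W3 c x [X, Y] = I.w3 X Y" for X Y
    using assms by (simp_all add: coframe_at_def)
  show 2: "\<omega> c x [X, Y] = I.\<omega> X Y" "R c x [X, Y] = I.R X Y" for X Y
    by (simp_all add: \<omega>_def R_def fscale_def I.\<omega>_def I.R_def 1)
  show 3: "S c x = I.S" "T c x = I.T"
    by (intro ext; simp add: S_def T_def I.S_def I.T_def 1 2)+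
  show 4: "J c x = I.J" by (intro ext) (simp add: J_def I.J_def 3)
  show "g c x = I.g" by (intro ext) (simp only: g_def I.g_def 2 4)
qed

lemma is_form_\<omega>: "is_form M 2 \<omega>" and is_form_R: "is_form M 2 R"
  unfolding \<omega>_def R_def by (intro is_form_add is_form_fscale M forms)+

lemma S_determines_J:
  assumes "c \<in> atlas M" "x \<in> cimg c"
  shows "linear (\<lambda>Z. S c x Z Y)" "linear (S c x X)" "(\<And>Y. S c x Z Y = 0) \<Longrightarrow> Z = 0"
    "S c x (J c x X) Y = T c x X Y" "(\<And>Y. S c x Z Y = T c x X Y) \<Longrightarrow> Z = J c x X"
proof -
  obtain e1 e2 e3 e4 where cf: "coframe_at c x e1 e2 e3 e4" using coframe_at_exists[OF assms] by blast
  note e = coframe_atD[OF cf]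
  interpret I: su2_coframe e1 e2 e3 e4 "\<lambda>X. \<rho> c x [X]" "\<lambda>X. \<sigma> c x [X]" a b by (rule e(1))
  show "linear (\<lambda>Z. S c x Z Y)" "linear (S c x X)"
    unfolding e(7-9) by (intro linearI; simp add: I.defs algebra_simps)+
  show "(\<And>Y. S c x Z Y = 0) \<Longrightarrow> Z = 0" unfolding e(7-9) by (rule I.S_nondegenerate)
  show "S c x (J c x X) Y = T c x X Y" unfolding e(7-9) by (rule I.S_J)
  show "(\<And>Y. S c x Z Y = T c x X Y) \<Longrightarrow> Z = J c x X" unfolding e(7-9) using I.J_unique I.S_J by blast
qed

lemma J_g_properties:
  assumes "c \<in> atlas M" "x \<in> cimg c"
  shows "linear (J c x)" "J c x (J c x X) = - X" "bilinear (g c x)" "g c x X Y = g c x Y X"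
    "X \<noteq> 0 \<Longrightarrow> g c x X X > 0" "g c x (J c x X) (J c x Y) = g c x X Y"
    "g c x (J c x X) Y = \<omega> c x [X, Y] + (\<rho> c x [X] * \<sigma> c x [Y] - \<rho> c x [Y] * \<sigma> c x [X])"
    "\<rho> c x [J c x X] = - \<sigma> c x [X]" "\<sigma> c x [J c x X] = \<rho> c x [X]"
    "R c x [J c x X, Y] = - W2 c x [X, Y]" "R c x [X, J c x Y] = - W2 c x [X, Y]"
    "W2 c x [J c x X, Y] = R c x [X, Y]" "W2 c x [X, J c x Y] = R c x [X, Y]"
proof -
  obtain e1 e2 e3 e4 where cf: "coframe_at c x e1 e2 e3 e4" using coframe_at_exists[OF assms] by blast
  note e = coframe_atD[OF cf]
  interpret I: su2_coframe e1 e2 e3 e4 "\<lambda>X. \<rho> c x [X]" "\<lambda>X. \<sigma> c x [X]" a b by (rule e(1))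
  show "linear (J c x)" "J c x (J c x X) = - X" "bilinear (g c x)" "X \<noteq> 0 \<Longrightarrow> g c x X X > 0"
    "g c x (J c x X) (J c x Y) = g c x X Y"
    "g c x (J c x X) Y = \<omega> c x [X, Y] + (\<rho> c x [X] * \<sigma> c x [Y] - \<rho> c x [Y] * \<sigma> c x [X])"
    "\<rho> c x [J c x X] = - \<sigma> c x [X]" "\<sigma> c x [J c x X] = \<rho> c x [X]"
    "R c x [J c x X, Y] = - W2 c x [X, Y]" "R c x [X, J c x Y] = - W2 c x [X, Y]"
    "W2 c x [J c x X, Y] = R c x [X, Y]" "W2 c x [X, J c x Y] = R c x [X, Y]"
    unfolding e(3,5,6,9,10)
    by (rule I.linear_J I.J_J I.bilinear_g I.g_pos I.g_J_J I.g_J I.\<Omega>_J I.J_coords | assumption)+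
  show "g c x X Y = g c x Y X" unfolding e(10) by (simp add: I.g_coords algebra_simps)
qed

text \<open>The vectors dual to \<open>\<rho>\<close> and \<open>\<sigma>\<close> lie in the common kernel of the coframe \<open>e1\<close>, ..., \<open>e4\<close>.\<close>

lemma sharp_in_kernel:
  assumes "c \<in> atlas M" "x \<in> cimg c" and l: "\<And>Y. l c x [Y] = r * \<rho> c x [Y] + s * \<sigma> c x [Y]"
  shows "\<rho> c x [sharp g l c x] = r" "\<sigma> c x [sharp g l c x] = s"
    "\<omega> c x [sharp g l c x, Y] = 0" "R c x [sharp g l c x, Y] = 0" "W2 c x [sharp g l c x, Y] = 0"
proof -
  obtain e1 e2 e3 e4 where cf: "coframe_at c x e1 e2 e3 e4" using coframe_at_exists[OF assms(1,2)] by blast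
  note e = coframe_atD[OF cf]
  interpret I: su2_coframe e1 e2 e3 e4 "\<lambda>X. \<rho> c x [X]" "\<lambda>X. \<sigma> c x [X]" a b by (rule e(1))
  note D = I.sharp_coframe[of "\<lambda>Y. l c x [Y]", OF l, folded e(10), folded sharp_def]
  show "\<rho> c x [sharp g l c x] = r" "\<sigma> c x [sharp g l c x] = s" by (rule D)+
  show "\<omega> c x [sharp g l c x, Y] = 0" "R c x [sharp g l c x, Y] = 0" "W2 c x [sharp g l c x, Y] = 0"
    unfolding e(3,5,6) by (simp_all add: I.defs D)
qed

text \<open>That is, \<open>Wi \<and> Wj = \<delta>\<^sub>i\<^sub>j W1 \<and> W1\<close>: with respect to the wedge product the triple is orthogonal and all its
  members have the same length.\<close>

lemma triple_wedge_relations: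
  "W2 \<and>\<^sub>F W2 = W1 \<and>\<^sub>F W1" "W3 \<and>\<^sub>F W3 = W1 \<and>\<^sub>F W1" "W1 \<and>\<^sub>F W2 = 0" "W1 \<and>\<^sub>F W3 = 0" "W3 \<and>\<^sub>F W2 = 0"
proof -
  note h = forms(3-5)[THEN is_form_homogeneous]
  have h4: "homogeneous 4 (W \<and>\<^sub>F W')" if "homogeneous 2 W" "homogeneous 2 W'" for W W' :: "('a, 'e, real) form"
    using homogeneous_wedge[OF that] by simp
  have h0: "homogeneous 4 (0 :: ('a, 'e, real) form)" by (simp add: homogeneous_def)
  have all: "(W2 \<and>\<^sub>F W2) c x vs = (W1 \<and>\<^sub>F W1) c x vs \<and> (W3 \<and>\<^sub>F W3) c x vs = (W1 \<and>\<^sub>F W1) c x vs \<and>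
    (W1 \<and>\<^sub>F W2) c x vs = 0 \<and> (W1 \<and>\<^sub>F W3) c x vs = 0 \<and> (W3 \<and>\<^sub>F W2) c x vs = 0"
    if "length vs = 4" for c x vs
  proof (cases "c \<in> atlas M \<and> x \<in> cimg c")
    case True
    obtain t u v z where vs: "vs = [t, u, v, z]" using \<open>length vs = 4\<close> by (rule length_4E)
    obtain e1 e2 e3 e4 where cf: "coframe_at c x e1 e2 e3 e4" using coframe_at_exists True by blast
    note e = coframe_atD[OF cf]
    interpret I: su2_coframe e1 e2 e3 e4 "\<lambda>X. \<rho> c x [X]" "\<lambda>X. \<sigma> c x [X]" a b by (rule e(1))
    show ?thesis unfolding vs wedge_2_2[OF h(1,1)] wedge_2_2[OF h(2,2)] wedge_2_2[OF h(3,3)]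
        wedge_2_2[OF h(1,2)] wedge_2_2[OF h(1,3)] wedge_2_2[OF h(3,2)]
      by (simp add: e(2-4) I.w1_def I.w2_def I.w3_def algebra_simps)
  next
    case False
    then show ?thesis
      by (auto simp: wedge_def is_form_outside[OF forms(3)] is_form_outside[OF forms(4)] is_form_outside[OF forms(5)])
  qed
  show "W2 \<and>\<^sub>F W2 = W1 \<and>\<^sub>F W1" "W3 \<and>\<^sub>F W3 = W1 \<and>\<^sub>F W1" "W1 \<and>\<^sub>F W2 = 0" "W1 \<and>\<^sub>F W3 = 0" "W3 \<and>\<^sub>F W2 = 0"
    by (rule form_eqI_homogeneous[of 4], (intro h h4 h0)+, simp add: all)+
qed

text \<open>Rotations preserve orthogonality and length.\<close>

lemma rotated_triple_wedge_relations:
  "\<omega> \<and>\<^sub>F \<omega> = W1 \<and>\<^sub>F W1" "R \<and>\<^sub>F R = W1 \<and>\<^sub>F W1" "\<omega> \<and>\<^sub>F R = 0" "\<omega> \<and>\<^sub>F W2 = 0" "R \<and>\<^sub>F W2 = 0" "W2 \<and>\<^sub>F R = 0"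
proof -
  note h = forms(3-5)[THEN is_form_homogeneous]
  have W31: "W3 \<and>\<^sub>F W1 = 0" using wedge_2_2_commute[OF h(1,3)] triple_wedge_relations(4) by simp
  have W23: "W2 \<and>\<^sub>F W3 = 0" using wedge_2_2_commute[OF h(3,2)] triple_wedge_relations(5) by simp
  have W21: "W2 \<and>\<^sub>F W1 = 0" using wedge_2_2_commute[OF h(1,2)] triple_wedge_relations(3) by simp
  have k: "(a * a) *\<^sub>F V + (b * b) *\<^sub>F V = V" "(b * b) *\<^sub>F V + (a * a) *\<^sub>F V = V" for V :: "('a, 'e, real) form"
    using ab by (intro ext; simp add: fscale_def flip: distrib_right; simp add: add.commute)+
  have m: "(a * b) *\<^sub>F V + (- (b * a)) *\<^sub>F V = 0" "(b * a) *\<^sub>F V + (- (a * b)) *\<^sub>F V = 0"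
    for V :: "('a, 'e, real) form"
    by (intro ext; simp add: fscale_def algebra_simps)+
  show "\<omega> \<and>\<^sub>F \<omega> = W1 \<and>\<^sub>F W1" "R \<and>\<^sub>F R = W1 \<and>\<^sub>F W1" "\<omega> \<and>\<^sub>F R = 0"
    "\<omega> \<and>\<^sub>F W2 = 0" "R \<and>\<^sub>F W2 = 0" "W2 \<and>\<^sub>F R = 0"
    unfolding \<omega>_def R_def
    by (simp_all add: wedge_add_left wedge_add_right wedge_fscale_left wedge_fscale_right fscale_fscale
        triple_wedge_relations W31 W23 W21 k m)
qed

text \<open>Contraction of \<open>S\<close> and \<open>T\<close> with the basis turns the defining equation of \<open>J X\<close> into a system of
  linear equations with smooth coefficients.\<close>

lemma smooth_J:
  assumes c: "c \<in> atlas M" shows "smooth_on (cimg c) (\<lambda>x. J c x X)"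
proof (rule smooth_on_linear_solution)
  let ?B = "\<lambda>x Z. \<Sum>Y\<in>Basis. S c x Z Y *\<^sub>R Y"
  show op: "open (cimg c)" by (rule chart_homeomorphism(2)[OF M c])
  note s = is_form_smooth[OF forms(1) c] is_form_smooth[OF forms(2) c] is_form_smooth[OF forms(4) c] is_form_smooth[OF is_form_R c]
  show "smooth_on (cimg c) (\<lambda>x. ?B x Z)" for Z
    unfolding S_def by (intro smooth_on_sum smooth_on_scaleR smooth_on_add smooth_on_diff smooth_on_mult smooth_on_const op s)
  show "smooth_on (cimg c) (\<lambda>x. \<Sum>Y\<in>Basis. T c x X Y *\<^sub>R Y)"
    unfolding T_def by (intro smooth_on_sum smooth_on_scaleR smooth_on_minus smooth_on_diff smooth_on_mult smooth_on_const op s)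
  fix x assume x: "x \<in> cimg c"
  show lin: "linear (?B x)"
    by (intro linearI) (simp_all add: linear_add[OF S_determines_J(1)[OF c x]] linear_cmul[OF S_determines_J(1)[OF c x]]
        scaleR_add_left sum.distrib scaleR_sum_right)
  show "inj (?B x)"
    unfolding linear_injective_0[OF lin]
  proof (intro allI impI)
    fix Z assume "?B x Z = 0"
    then have "S c x Z Y = 0" if "Y \<in> Basis" for Y
      using inner_sum_left_Basis[OF that, of "S c x Z"] by simp
    then have "S c x Z Y = 0" for Y
      using linear_componentwise_Basis[OF S_determines_J(2)[OF c x], of Z Y] by simp
    then show "Z = 0" by (rule S_determines_J(3)[OF c x])
  qed
  show "?B x (J c x X) = (\<Sum>Y\<in>Basis. T c x X Y *\<^sub>R Y)" by (simp add: S_determines_J(4)[OF c x])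
qed

text \<open>The jacobian is invertible because it carries one nondegenerate form into another one.\<close>

lemma jac_preserves_S_T:
  assumes c: "c \<in> atlas M" "c' \<in> atlas M" and p: "p \<in> cdom c" "p \<in> cdom c'"
  shows "linear (jac c c' p)" "surj (jac c c' p)"
    "S c (cmap c p) X Y = S c' (cmap c' p) (jac c c' p X) (jac c c' p Y)"
    "T c (cmap c p) X Y = T c' (cmap c' p) (jac c c' p X) (jac c c' p Y)"
proof -
  show lin: "linear (jac c c' p)" by (rule has_derivative_linear[OF jac_has_derivative[OF M c p]])
  note tr = is_form_transform[OF forms(1) c p] is_form_transform[OF forms(2) c p] is_form_transform[OF forms(4) c p]
    is_form_transform[OF is_form_R c p]
  show S: "S c (cmap c p) X Y = S c' (cmap c' p) (jac c c' p X) (jac c c' p Y)" for X Y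
    unfolding S_def by (simp add: tr)
  show "T c (cmap c p) X Y = T c' (cmap c' p) (jac c c' p X) (jac c c' p Y)"
    unfolding T_def by (simp add: tr)
  have "inj (jac c c' p)" unfolding linear_injective_0[OF lin]
  proof (intro allI impI)
    fix Z assume Z: "jac c c' p Z = 0"
    have "S c (cmap c p) Z Y = 0" for Y
      using S[of Z Y] Z linear_0[OF S_determines_J(1)[OF c(2) cmap_in_cimg[OF p(2)]]] by simp
    then show "Z = 0" by (rule S_determines_J(3)[OF c(1) cmap_in_cimg[OF p(1)]])
  qed
  then show "surj (jac c c' p)" using lin by (simp add: linear_injective_imp_surjective)
qed

text \<open>Both sides solve the equation that characterises \<open>J (DX)\<close> in the chart \<open>c'\<close>, where \<open>D\<close> is the jacobian.\<close>

lemma J_transform: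
  assumes c: "c \<in> atlas M" "c' \<in> atlas M" and p: "p \<in> cdom c" "p \<in> cdom c'"
  shows "jac c c' p (J c (cmap c p) X) = J c' (cmap c' p) (jac c c' p X)"
proof (rule S_determines_J(5)[OF c(2) cmap_in_cimg[OF p(2)]])
  fix Y
  obtain Y' where Y': "Y = jac c c' p Y'" using jac_preserves_S_T(2)[OF c p] by (metis surjD)
  show "S c' (cmap c' p) (jac c c' p (J c (cmap c p) X)) Y = T c' (cmap c' p) (jac c c' p X) Y"
    using S_determines_J(4)[OF c(1) cmap_in_cimg[OF p(1)], of X Y'] jac_preserves_S_T(3,4)[OF c p] by (simp add: Y')
qed

lemma almost_hermitian_J_g: "almost_hermitian M J g"
  unfolding almost_hermitian_def almost_complex_def riemannian_metric_def
proof (intro conjI ballI allI impI)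
  fix c assume c: "c \<in> atlas M"
  note op = chart_homeomorphism(2)[OF M c]
  show "smooth_on (cimg c) (\<lambda>x. J c x X)" for X by (rule smooth_J[OF c])
  show "smooth_on (cimg c) (\<lambda>x. g c x X Y)" for X Y
  proof -
    define G where "G x Z = \<omega> c x [X, Z] + (\<rho> c x [X] * \<sigma> c x [Z] - \<rho> c x [Z] * \<sigma> c x [X])" for x Z
    note s = is_form_smooth[OF forms(1) c] is_form_smooth[OF forms(2) c] is_form_smooth[OF is_form_\<omega> c]
    have sG: "smooth_on (cimg c) (\<lambda>x. G x Z)" for Z
      unfolding G_def by (intro smooth_on_add smooth_on_diff smooth_on_mult op s)
    have sJ: "smooth_on (cimg c) (\<lambda>x. J c x Y \<bullet> Z)" for Z
      by (rule smooth_on_bounded_linear[OF bounded_linear_inner_left op smooth_J[OF c]])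
    have "smooth_on (cimg c) (\<lambda>x. \<Sum>Z\<in>Basis. (J c x Y \<bullet> Z) * G x Z)"
      by (intro smooth_on_sum smooth_on_mult op sG sJ)
    then show ?thesis
    proof (rule smooth_on_cong[OF op, rotated])
      fix x assume x: "x \<in> cimg c"
      have l: "linear (\<lambda>Z. \<omega> c x [X, Z])" "linear (\<lambda>Z. \<rho> c x [Z])" "linear (\<lambda>Z. \<sigma> c x [Z])"
        using is_form_linear[OF is_form_\<omega> c x, of "[X, 0]" 1] is_form_linear[OF forms(1) c x, of "[0]" 0]
          is_form_linear[OF forms(2) c x, of "[0]" 0] by simp_all
      have "linear (G x)" unfolding G_def
        by (intro linearI) (simp_all add: l[THEN linear_add] l[THEN linear_cmul] algebra_simps)
      from linear_componentwise_Basis[OF this, of "J c x Y"]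
      show "(\<Sum>Z\<in>Basis. (J c x Y \<bullet> Z) * G x Z) = g c x X Y" by (simp add: g_def G_def)
    qed
  qed
  show "linear (J c x)" "bilinear (g c x)" if "x \<in> cimg c" for x using J_g_properties[OF c that] by blast+
  show "J c x (J c x X) = - X" "g c x X Y = g c x Y X" "g c x (J c x X) (J c x Y) = g c x X Y"
    if "x \<in> cimg c" for x X Y using J_g_properties[OF c that] by blast+
  show "0 < g c x X X" if "x \<in> cimg c" "X \<noteq> 0" for x X using J_g_properties[OF c that(1)] that(2) by blast
  fix c' p assume c': "c' \<in> atlas M" and "p \<in> cdom c \<inter> cdom c'"
  then have p: "p \<in> cdom c" "p \<in> cdom c'" by auto
  show J: "jac c c' p (J c (cmap c p) X) = J c' (cmap c' p) (jac c c' p X)" for X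
    by (rule J_transform[OF c c' p])
  show "g c (cmap c p) X Y = g c' (cmap c' p) (jac c c' p X) (jac c c' p Y)" for X Y
    unfolding g_def
    by (simp add: is_form_transform[OF forms(1) c c' p] is_form_transform[OF forms(2) c c' p]
        is_form_transform[OF is_form_\<omega> c c' p] J)
qed

lemma contract_zero:
  assumes \<tau>: "is_form M 2 \<tau>" and zero: "\<And>c x l r s Y. c \<in> atlas M \<Longrightarrow> x \<in> cimg c \<Longrightarrow>
      (\<And>Y. l c x [Y] = r * \<rho> c x [Y] + s * \<sigma> c x [Y]) \<Longrightarrow> \<tau> c x [sharp g l c x, Y] = 0"
  shows "contract g (Complex_form \<rho> \<sigma>) \<tau> = 0"
proof (intro ext)
  fix c x and vs :: "'e list"
  show "contract g (Complex_form \<rho> \<sigma>) \<tau> c x vs = 0 c x vs"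
  proof (cases "c \<in> atlas M \<and> x \<in> cimg c \<and> length vs = 1")
    case True
    then obtain Y where "vs = [Y]" by (auto simp: length_Suc_conv)
    then show ?thesis
      using zero[of c x \<rho> 1 0 Y] zero[of c x \<sigma> 0 1 Y] True by (simp add: contract_def)
  next
    case False
    then have "\<tau> c x (Z # vs) = 0" for Z by (intro is_form_outside[OF \<tau>]) auto
    then show ?thesis by (simp add: contract_def)
  qed
qed

theorem su2_structure: "su2_structure_6 M J g (Complex_form \<rho> \<sigma>) \<omega> (Complex_form R W2)"
  unfolding su2_structure_6_def
proof (intro conjI ballI M dim almost_hermitian_J_g is_form_\<omega> is_form_Complex_form is_form_R forms)
  show "type_k0 M J 1 (Complex_form \<rho> \<sigma>)"
    unfolding type_k0_def
    by (auto simp: length_Suc_conv Complex_form_apply complex_eq_iff J_g_properties(8,9))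
  show "type_k0 M J 2 (Complex_form R W2)"
    unfolding type_k0_def
    by (auto elim!: length_2E simp: Complex_form_apply complex_eq_iff J_g_properties less_2_cases_iff)
  show "of_real_form (\<omega> \<and>\<^sub>F \<omega>) = (1/2) *\<^sub>F (Complex_form R W2 \<and>\<^sub>F cnj_form (Complex_form R W2))"
  proof -
    have "Complex_form R W2 \<and>\<^sub>F cnj_form (Complex_form R W2)
        = Complex_form (W1 \<and>\<^sub>F W1 - (-1) *\<^sub>F (W1 \<and>\<^sub>F W1)) ((-1) *\<^sub>F 0 + 0)"
      unfolding cnj_Complex_form Complex_form_wedge wedge_fscale_right rotated_triple_wedge_relations triple_wedge_relations ..
    then show ?thesis
      by (intro ext) (simp add: rotated_triple_wedge_relations fscale_def Complex_form_apply of_real_form_def complex_eq_iff)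
  qed
  show "nowhere_zero M (\<omega> \<and>\<^sub>F \<omega>)"
    unfolding nowhere_zero_def rotated_triple_wedge_relations
  proof (intro ballI)
    fix c x assume cx: "c \<in> atlas M" "x \<in> cimg c"
    obtain e1 e2 e3 e4 where cf: "coframe_at c x e1 e2 e3 e4" using coframe_at_exists[OF cx] by blast
    note e = coframe_atD[OF cf]
    interpret I: su2_coframe e1 e2 e3 e4 "\<lambda>X. \<rho> c x [X]" "\<lambda>X. \<sigma> c x [X]" a b by (rule e(1))
    obtain E1 where E1: "e1 E1 = 1 \<and> e2 E1 = 0 \<and> e3 E1 = 0 \<and> e4 E1 = 0"
      using I.dual_vector[where ?t1.0=1 and ?t2.0=0 and ?t3.0=0 and ?t4.0=0] by blast
    obtain E2 where E2: "e1 E2 = 0 \<and> e2 E2 = 1 \<and> e3 E2 = 0 \<and> e4 E2 = 0"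
      using I.dual_vector[where ?t1.0=0 and ?t2.0=1 and ?t3.0=0 and ?t4.0=0] by blast
    obtain E3 where E3: "e1 E3 = 0 \<and> e2 E3 = 0 \<and> e3 E3 = 1 \<and> e4 E3 = 0"
      using I.dual_vector[where ?t1.0=0 and ?t2.0=0 and ?t3.0=1 and ?t4.0=0] by blast
    obtain E4 where E4: "e1 E4 = 0 \<and> e2 E4 = 0 \<and> e3 E4 = 0 \<and> e4 E4 = 1"
      using I.dual_vector[where ?t1.0=0 and ?t2.0=0 and ?t3.0=0 and ?t4.0=1] by blast
    have "(W1 \<and>\<^sub>F W1) c x [E1, E2, E3, E4] = 2"
      using is_form_homogeneous[OF forms(3)] E1 E2 E3 E4 by (simp add: wedge_2_2 e(2) I.w1_def)
    then show "\<exists>vs. (W1 \<and>\<^sub>F W1) c x vs \<noteq> 0" by (intro exI[of _ "[E1, E2, E3, E4]"]) simp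
  qed
  show "of_real_form \<omega> \<and>\<^sub>F Complex_form R W2 = 0"
    by (intro ext) (simp add: of_real_form_Complex_form Complex_form_wedge rotated_triple_wedge_relations wedge_0_left Complex_form_apply complex_eq_iff)
  show "Complex_form R W2 \<and>\<^sub>F Complex_form R W2 = 0"
    by (intro ext) (simp add: Complex_form_wedge rotated_triple_wedge_relations triple_wedge_relations Complex_form_apply complex_eq_iff)
  show "contract g (Complex_form \<rho> \<sigma>) (Complex_form R W2) = 0"
    by (rule contract_zero[OF is_form_Complex_form[OF M is_form_R forms(4)]])
      (simp add: Complex_form_apply sharp_in_kernel complex_eq_iff)
  show "contract g (Complex_form \<rho> \<sigma>) (of_real_form \<omega>) = 0"
    by (rule contract_zero[OF is_form_of_real_form[OF M is_form_\<omega>]]) (simp add: of_real_form_def sharp_in_kernel)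
  show "contract g (cnj_form (Complex_form \<rho> \<sigma>)) (Complex_form \<rho> \<sigma>) c x [] = 2" if "c \<in> atlas M" "x \<in> cimg c" for c x
    using sharp_in_kernel(1,2)[OF that, of \<rho> 1 0] sharp_in_kernel(1,2)[OF that, of "(-1) *\<^sub>F \<sigma>" 0 "-1"]
    by (simp add: contract_def cnj_Complex_form Complex_form_apply complex_eq_iff fscale_def)
  show "of_real_form (fundamental_form M J g) =
      of_real_form \<omega> + (\<i>/2) *\<^sub>F (Complex_form \<rho> \<sigma> \<and>\<^sub>F cnj_form (Complex_form \<rho> \<sigma>))"
  proof (intro ext)
    fix c x and vs :: "'e list"
    note h = forms(1,2)[THEN is_form_homogeneous]
    have eq: "Complex_form \<rho> \<sigma> \<and>\<^sub>F cnj_form (Complex_form \<rho> \<sigma>)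
      = Complex_form (\<rho> \<and>\<^sub>F \<rho> + \<sigma> \<and>\<^sub>F \<sigma>) ((-1) *\<^sub>F (\<rho> \<and>\<^sub>F \<sigma>) + \<sigma> \<and>\<^sub>F \<rho>)"
      unfolding cnj_Complex_form Complex_form_wedge wedge_fscale_right Complex_form_eq_iff
      by (auto intro!: ext simp: fscale_def)
    show "of_real_form (fundamental_form M J g) c x vs =
      (of_real_form \<omega> + (\<i>/2) *\<^sub>F (Complex_form \<rho> \<sigma> \<and>\<^sub>F cnj_form (Complex_form \<rho> \<sigma>))) c x vs"
    proof (cases "c \<in> atlas M \<and> x \<in> cimg c \<and> length vs = 2")
      case True
      then obtain X Y where vs: "vs = [X, Y]" by (auto elim: length_2E)
      show ?thesis using True unfolding eq
        by (simp add: vs of_real_form_def fscale_def Complex_form_apply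
            wedge_1_1[OF h(1,1)] wedge_1_1[OF h(2,2)] wedge_1_1[OF h(1,2)] wedge_1_1[OF h(2,1)] fundamental_form_def J_g_properties(7)
            complex_eq_iff diff_divide_distrib algebra_simps)
    next
      case False
      have "(A \<and>\<^sub>F B) c x vs = 0" if "is_form M 1 A" "is_form M 1 B" for A B :: "('a, 'e, real) form"
      proof (cases "c \<in> atlas M \<and> x \<in> cimg c")
        case True
        have "homogeneous 2 (A \<and>\<^sub>F B)" using homogeneous_wedge[OF that[THEN is_form_homogeneous]] by (simp add: numeral_2_eq_2)
        then show ?thesis using False True by (simp add: homogeneousD)
      next
        case False
        then show ?thesis by (auto simp: wedge_def is_form_outside[OF that(1)])
      qed
      then show ?thesis using False forms is_form_outside[OF is_form_\<omega> False] unfolding eq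
        by (auto simp: of_real_form_def fscale_def Complex_form_apply fundamental_form_def complex_eq_iff)
    qed
  qed
qed

end

section \<open>The triple on the product with a circle\<close>

lemma su2_structure_5_wedge:
  assumes "su2_structure_5 P \<eta> \<omega>1 \<omega>2 \<omega>3"
  shows "\<omega>1 \<and>\<^sub>F \<omega>2 = 0" "\<omega>1 \<and>\<^sub>F \<omega>3 = 0" "\<omega>2 \<and>\<^sub>F \<omega>2 = \<omega>1 \<and>\<^sub>F \<omega>1"
proof -
  have "Complex_form \<omega>2 \<omega>3 \<and>\<^sub>F Complex_form \<omega>2 \<omega>3 = 0"
    and "of_real_form \<omega>1 \<and>\<^sub>F Complex_form \<omega>2 \<omega>3 = 0"
    and "Complex_form \<omega>2 \<omega>3 \<and>\<^sub>F cnj_form (Complex_form \<omega>2 \<omega>3) = 2 *\<^sub>F of_real_form (\<omega>1 \<and>\<^sub>F \<omega>1)"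
    using assms by (simp_all add: su2_structure_5_def Let_def)
  note rel = this[unfolded cnj_Complex_form of_real_form_Complex_form Complex_form_wedge wedge_fscale_right wedge_0_left]
  have eq: "Complex_form A B c x vs = Z \<Longrightarrow> A c x vs = Re Z \<and> B c x vs = Im Z" for A B c x vs Z
    by (auto simp: Complex_form_apply)
  note r = rel[THEN fun_cong, THEN fun_cong, THEN fun_cong, THEN eq]
  show "\<omega>1 \<and>\<^sub>F \<omega>2 = 0" "\<omega>1 \<and>\<^sub>F \<omega>3 = 0"
    using r(2) by (auto intro!: ext)
  show "\<omega>2 \<and>\<^sub>F \<omega>2 = \<omega>1 \<and>\<^sub>F \<omega>1"
  proof (intro ext)
    fix c x vs
    show "(\<omega>2 \<and>\<^sub>F \<omega>2) c x vs = (\<omega>1 \<and>\<^sub>F \<omega>1) c x vs"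
      using r(1)[of c x vs] r(3)[of c x vs] by (simp add: fscale_def Complex_form_apply)
  qed
qed

text \<open>The nondegeneracy of \<open>\<eta> \<and> \<omega>1 \<and> \<omega>1\<close> enters through \<open>\<eta> \<noteq> 0\<close>; on \<open>ker \<eta>\<close> the form \<open>\<omega>1\<close> is nondegenerate
  since it tames the complex structure.\<close>

lemma su2_structure_5_coframe:
  fixes P :: "('a, 'e::euclidean_space) manifold"
  assumes P: "su2_structure_5 P \<eta> \<omega>1 \<omega>2 \<omega>3" and c: "c \<in> atlas P" and x: "x \<in> cimg c"
  shows "\<exists>e1 e2 e3 e4.
    adapted_coframe (\<lambda>X Y. \<omega>1 c x [X, Y]) (\<lambda>X Y. \<omega>2 c x [X, Y]) (\<lambda>X Y. \<omega>3 c x [X, Y]) e1 e2 e3 e4 \<and>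
    (\<forall>X. e1 X = 0 \<and> e2 X = 0 \<and> e3 X = 0 \<and> e4 X = 0 \<and> \<eta> c x [X] = 0 \<longrightarrow> X = 0)"
proof -
  have dim: "DIM('e) = 5" and forms: "is_form P 1 \<eta>" "is_form P 2 \<omega>1" "is_form P 2 \<omega>2" "is_form P 2 \<omega>3"
    and nz: "nowhere_zero P (\<eta> \<and>\<^sub>F \<omega>1 \<and>\<^sub>F \<omega>1)" and type: "type_20_wrt_at \<eta> \<omega>1 (Complex_form \<omega>2 \<omega>3) c x"
    using P c x by (simp_all add: su2_structure_5_def Let_def)
  note h = forms(2-4)[THEN is_form_homogeneous]
  have \<eta>: "linear (\<lambda>X. \<eta> c x [X])" using is_form_linear[OF forms(1) c x, of "[0]" 0] by simp
  have \<eta>0: "\<exists>t. \<eta> c x [t] \<noteq> 0"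
  proof (rule ccontr)
    assume "\<nexists>t. \<eta> c x [t] \<noteq> 0"
    then have "\<eta> c x vs = 0" for vs
      using is_form_outside[OF forms(1), of c x vs] by (cases "length vs = 1") (auto simp: length_Suc_conv)
    then have "(\<eta> \<and>\<^sub>F \<omega>1 \<and>\<^sub>F \<omega>1) c x vs = 0" for vs by (simp add: wedge_def[of \<eta>])
    then show False using nz c x by (auto simp: nowhere_zero_def)
  qed
  have bil: "bilinear (\<lambda>X Y. \<omega> c x [X, Y])" if "is_form P 2 \<omega>" for \<omega> :: "('a, 'e, real) form"
    unfolding bilinear_def
    using is_form_linear[OF that c x, of "[0, Y]" 0 for Y] is_form_linear[OF that c x, of "[X, 0]" 1 for X] by simp
  have alt: "\<omega> c x [X, X] = 0" if "is_form P 2 \<omega>" for \<omega> :: "('a, 'e, real) form" and X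
    using is_form_alternating[OF that c x, of "[X, X]" 0 1] by simp
  obtain J where J: "linear J" "\<And>X. \<eta> c x [X] = 0 \<Longrightarrow> \<eta> c x [J X] = 0" "\<And>X. \<eta> c x [X] = 0 \<Longrightarrow> J (J X) = - X"
    "\<And>X Y. \<eta> c x [X] = 0 \<Longrightarrow> \<eta> c x [Y] = 0 \<Longrightarrow> \<omega>1 c x [J X, J Y] = \<omega>1 c x [X, Y]"
    "\<And>X. \<eta> c x [X] = 0 \<Longrightarrow> X \<noteq> 0 \<Longrightarrow> \<omega>1 c x [X, J X] > 0"
    "\<And>X Y. \<eta> c x [X] = 0 \<Longrightarrow> \<eta> c x [Y] = 0 \<Longrightarrow> Complex_form \<omega>2 \<omega>3 c x [J X, Y] = \<i> * Complex_form \<omega>2 \<omega>3 c x [X, Y]"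
    using type unfolding type_20_wrt_at_def Let_def by auto
  have w4: "wedge4 (\<lambda>X Y. \<omega> c x [X, Y]) (\<lambda>X Y. \<tau> c x [X, Y]) t u v z = (\<omega> \<and>\<^sub>F \<tau>) c x [t, u, v, z]"
    if "is_form P 2 \<omega>" "is_form P 2 \<tau>" for \<omega> \<tau> :: "('a, 'e, real) form" and t u v z
    using that[THEN is_form_homogeneous] by (simp add: wedge4_def wedge_2_2)
  show ?thesis
  proof (rule adapted_coframe_exists[OF dim \<eta> \<eta>0 bil bil bil alt alt alt J(1)])
    show "\<omega>2 c x [J X, Y] = - \<omega>3 c x [X, Y]" "\<omega>3 c x [J X, Y] = \<omega>2 c x [X, Y]"
      if "\<eta> c x [X] = 0" "\<eta> c x [Y] = 0" for X Y
      using J(6)[OF that] by (simp_all add: Complex_form_apply complex_eq_iff)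
  qed (use forms J w4 su2_structure_5_wedge[OF P] in simp_all)
qed

text \<open>A coframe of \<open>P\<close> pulls back to the product, where \<open>\<beta>\<close> supplies the missing direction.\<close>

lemma su2_forms_product:
  fixes P :: "('a, 'e::euclidean_space) manifold"
  defines "M \<equiv> prod_manifold P circle"
  assumes P: "su2_structure_5 P \<eta> \<omega>1 \<omega>2 \<omega>3"
    and \<beta>: "is_form circle 1 \<beta>" "nowhere_zero circle \<beta>" and rs: "r \<noteq> 0" "s \<noteq> 0" and ab: "a * a + b * b = 1"
  shows "su2_forms M (r *\<^sub>F pullback M circle snd \<beta>) (s *\<^sub>F pullback M P fst \<eta>)
    (pullback M P fst \<omega>1) (pullback M P fst \<omega>2) (pullback M P fst \<omega>3) a b"
proof (rule su2_forms.intro)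
  have sP: "smooth_manifold P" and dim: "DIM('e) = 5"
    and forms: "is_form P 1 \<eta>" "is_form P 2 \<omega>1" "is_form P 2 \<omega>2" "is_form P 2 \<omega>3"
    using P by (simp_all add: su2_structure_5_def Let_def)
  show sM: "smooth_manifold M" unfolding M_def by (rule smooth_manifold_prod[OF sP smooth_manifold_circle])
  show "DIM('e \<times> real) = 6" using dim by simp
  note fst_lin = chart_linear_fst[OF sP smooth_manifold_circle, folded M_def]
  note snd_lin = chart_linear_snd[OF sP smooth_manifold_circle, folded M_def]
  show "is_form M 1 (r *\<^sub>F pullback M circle snd \<beta>)" "is_form M 1 (s *\<^sub>F pullback M P fst \<eta>)"
    "is_form M 2 (pullback M P fst \<omega>1)" "is_form M 2 (pullback M P fst \<omega>2)" "is_form M 2 (pullback M P fst \<omega>3)"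
    by (intro is_form_fscale sM is_form_pullback[OF fst_lin] is_form_pullback[OF snd_lin] forms \<beta>)+
  fix c x assume c: "c \<in> atlas M" and x: "x \<in> cimg c"
  obtain c1 c2 where c12: "c = prod_chart c1 c2" "c1 \<in> atlas P" "c2 \<in> atlas circle"
    using c unfolding M_def atlas_prod by blast
  have x12: "fst x \<in> cimg c1" "snd x \<in> cimg c2" using x by (auto simp: c12)
  have over: "chart_over fst fst c c1" "chart_over snd snd c c2"
    unfolding c12 by (rule chart_over_fst, rule chart_over_snd)
  have p1: "pullback M P fst \<tau> c x vs = \<tau> c1 (fst x) (map fst vs)" if "is_form P k \<tau>" for k \<tau> vs
    by (rule pullback_chart_over[OF fst_lin that c c12(2) over(1) x])
  have p2: "pullback M circle snd \<beta> c x vs = \<beta> c2 (snd x) (map snd vs)" for vs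
    by (rule pullback_chart_over[OF snd_lin \<beta>(1) c c12(3) over(2) x])
  obtain e1 e2 e3 e4 where
      ad: "adapted_coframe (\<lambda>X Y. \<omega>1 c1 (fst x) [X, Y]) (\<lambda>X Y. \<omega>2 c1 (fst x) [X, Y]) (\<lambda>X Y. \<omega>3 c1 (fst x) [X, Y]) e1 e2 e3 e4"
    and sep: "\<forall>X. e1 X = 0 \<and> e2 X = 0 \<and> e3 X = 0 \<and> e4 X = 0 \<and> \<eta> c1 (fst x) [X] = 0 \<longrightarrow> X = 0"
    using su2_structure_5_coframe[OF P c12(2) x12(1)] by blast
  have \<beta>_sep: "v = 0" if "\<beta> c2 (snd x) [v] = 0" for v
  proof (rule ccontr)
    assume "v \<noteq> 0"
    have lin: "linear (\<lambda>v. \<beta> c2 (snd x) [v])" using is_form_linear[OF \<beta>(1) c12(3) x12(2), of "[0]" 0] by simp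
    have "\<beta> c2 (snd x) vs = 0" for vs
    proof (cases "length vs = 1")
      case True
      then obtain w where "vs = [w]" by (auto simp: length_Suc_conv)
      then show ?thesis using linear_cmul[OF lin, of "w / v" v] that \<open>v \<noteq> 0\<close> by simp
    qed (simp add: is_form_outside[OF \<beta>(1)])
    then show False using \<beta>(2) c12(3) x12(2) by (auto simp: nowhere_zero_def)
  qed
  have "adapted_coframe (\<lambda>X Y. pullback M P fst \<omega>1 c x [X, Y]) (\<lambda>X Y. pullback M P fst \<omega>2 c x [X, Y])
      (\<lambda>X Y. pullback M P fst \<omega>3 c x [X, Y]) (e1 \<circ> fst) (e2 \<circ> fst) (e3 \<circ> fst) (e4 \<circ> fst)"
    using ad linear_compose[OF linear_fst, of e1] linear_compose[OF linear_fst, of e2]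
      linear_compose[OF linear_fst, of e3] linear_compose[OF linear_fst, of e4]
    unfolding adapted_coframe_def p1[OF forms(2)] p1[OF forms(3)] p1[OF forms(4)] by simp
  moreover have "X = 0" if "(e1 \<circ> fst) X = 0" "(e2 \<circ> fst) X = 0" "(e3 \<circ> fst) X = 0" "(e4 \<circ> fst) X = 0"
      "(r *\<^sub>F pullback M circle snd \<beta>) c x [X] = 0" "(s *\<^sub>F pullback M P fst \<eta>) c x [X] = 0" for X
  proof -
    have "\<beta> c2 (snd x) [snd X] = 0" "\<eta> c1 (fst x) [fst X] = 0"
      using that(5,6) rs by (simp_all add: fscale_def p1[OF forms(1)] p2)
    then have "snd X = 0" "fst X = 0" using \<beta>_sep sep that(1-4) by auto
    then show ?thesis by (simp add: prod_eq_iff)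
  qed
  ultimately show "\<exists>e1 e2 e3 e4.
      adapted_coframe (\<lambda>X Y. pullback M P fst \<omega>1 c x [X, Y]) (\<lambda>X Y. pullback M P fst \<omega>2 c x [X, Y])
        (\<lambda>X Y. pullback M P fst \<omega>3 c x [X, Y]) e1 e2 e3 e4 \<and>
      (\<forall>X. e1 X = 0 \<and> e2 X = 0 \<and> e3 X = 0 \<and> e4 X = 0 \<and> (r *\<^sub>F pullback M circle snd \<beta>) c x [X] = 0 \<and>
         (s *\<^sub>F pullback M P fst \<eta>) c x [X] = 0 \<longrightarrow> X = 0)"
    by blast
qed (rule ab)

section \<open>Closed forms on the product\<close>

lemma is_form_differentiable: "is_form M k \<omega> \<Longrightarrow> x \<in> cimg c \<Longrightarrow> (\<lambda>y. \<omega> c y vs) differentiable at x"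
  by (cases "c \<in> atlas M") (simp_all add: smooth_on_differentiable[OF is_form_smooth] is_form_off_atlas)

lemma wedge_differentiable:
  assumes M: "smooth_manifold M" and f: "is_form M k \<omega>" "is_form M l \<tau>" and x: "x \<in> cimg c"
  shows "(\<lambda>y. (\<omega> \<and>\<^sub>F \<tau>) c y vs) differentiable at x"
proof (cases "c \<in> atlas M")
  case True
  have "smooth_on (cimg c) (\<lambda>y. (\<omega> \<and>\<^sub>F \<tau>) c y vs)"
    unfolding wedge_def
    by (intro smooth_on_sum smooth_on_mult smooth_on_const chart_homeomorphism(2)[OF M True] is_form_smooth[OF f(1) True]
        is_form_smooth[OF f(2) True])
  then show ?thesis by (rule smooth_on_differentiable[OF _ x])
next
  case False
  then show ?thesis by (simp add: wedge_def is_form_off_atlas[OF f(1)])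
qed

lemma ext_d_pullback_closed:
  assumes M: "chart_linear M N f L" and \<omega>: "is_form N k \<omega>" and closed: "ext_d \<omega> = 0"
  shows "ext_d (pullback M N f \<omega>) = 0"
proof (intro ext)
  have sM: "smooth_manifold M" and L: "bounded_linear L" using M by (simp_all add: chart_linear_def)
  fix c x vs
  show "ext_d (pullback M N f \<omega>) c x vs = 0 c x vs"
  proof (cases "c \<in> atlas M \<and> x \<in> cimg c")
    case True
    then obtain d where d: "d \<in> atlas N" "chart_over L f c d" using M by (auto simp: chart_linear_def)
    have "ext_d (pullback M N f \<omega>) c x vs = ext_d \<omega> d (L x) (map L vs)"
      using True by (intro ext_d_chart_over[OF L _ _ chart_over_cimg[OF d(2)]]
        pullback_chart_over[OF M \<omega> _ d] is_form_differentiable[OF \<omega>] chart_over_cimg[OF d(2)] chart_homeomorphism[OF sM]) auto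
    then show ?thesis by (simp add: closed)
  next
    case False
    then show ?thesis using ext_d_off_atlas[OF is_form_pullback[OF M \<omega>], of c x vs] by (auto simp: ext_d_def)
  qed
qed

lemma ext_d_pullback_wedge_closed:
  assumes M: "chart_linear M N f L" and \<omega>: "is_form N k \<omega>" and \<tau>: "is_form N l \<tau>" and closed: "ext_d (\<omega> \<and>\<^sub>F \<tau>) = 0"
  shows "ext_d (pullback M N f \<omega> \<and>\<^sub>F pullback M N f \<tau>) = 0"
proof (intro ext)
  have sM: "smooth_manifold M" and sN: "smooth_manifold N" and L: "bounded_linear L"
    using M by (simp_all add: chart_linear_def)
  fix c x vs
  show "ext_d (pullback M N f \<omega> \<and>\<^sub>F pullback M N f \<tau>) c x vs = 0 c x vs"
  proof (cases "c \<in> atlas M \<and> x \<in> cimg c")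
    case True
    then have c: "c \<in> atlas M" and x: "x \<in> cimg c" by auto
    then obtain d where d: "d \<in> atlas N" "chart_over L f c d" using M by (auto simp: chart_linear_def)
    have "ext_d (pullback M N f \<omega> \<and>\<^sub>F pullback M N f \<tau>) c x vs = ext_d (\<omega> \<and>\<^sub>F \<tau>) d (L x) (map L vs)"
    proof (rule ext_d_chart_over[OF L x chart_homeomorphism(2)[OF sM c] chart_over_cimg[OF d(2)]])
      show "(pullback M N f \<omega> \<and>\<^sub>F pullback M N f \<tau>) c y vs = (\<omega> \<and>\<^sub>F \<tau>) d (L y) (map L vs)" if "y \<in> cimg c" for y vs
        by (simp add: wedge_def pullback_chart_over[OF M \<omega> c d that] pullback_chart_over[OF M \<tau> c d that] nths_map)
    qed (simp_all add: wedge_differentiable[OF sN \<omega> \<tau> chart_over_cimg[OF d(2) x]])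
    then show ?thesis by (simp add: closed)
  next
    case False
    then have "c \<notin> atlas M \<or> x \<notin> cimg c" by blast
    then show ?thesis
    proof
      assume "c \<notin> atlas M"
      then have "(pullback M N f \<omega> \<and>\<^sub>F pullback M N f \<tau>) c = (\<lambda>x vs. 0)"
        by (intro ext) (simp add: wedge_def pullback_def)
      then show ?thesis by (simp add: ext_d_def)
    qed (simp add: ext_d_def)
  qed
qed

text \<open>On a one-dimensional space \<open>\<beta>\<close> is determined by its value on the basis vector, and the two terms of
  \<open>d\<beta>(u,v)\<close> are both \<open>u v\<close> times the derivative of that value.\<close>

lemma ext_d_circle:
  fixes \<beta> :: "(complex, real, real) form"
  assumes \<beta>: "is_form circle 1 \<beta>"
  shows "ext_d \<beta> = 0"
proof (rule form_eqI_homogeneous)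
  show "homogeneous 2 (ext_d \<beta>)"
    using homogeneous_ext_d[OF is_form_homogeneous[OF \<beta>]] by (simp add: numeral_2_eq_2)
  show "homogeneous 2 0" by (simp add: homogeneous_def)
  fix c x and vs :: "real list" assume "length vs = 2"
  then obtain u v where vs: "vs = [u, v]" by (rule length_2E)
  show "ext_d \<beta> c x vs = 0 c x vs"
  proof (cases "c \<in> atlas circle \<and> x \<in> cimg c")
    case True
    \<comment> \<open>Also outside of the chart image, where \<open>\<beta>\<close> vanishes by convention; so these are equal functions and
      have the same derivative.\<close>
    have scal: "(\<lambda>y. \<beta> c y [w]) = (\<lambda>y. w * \<beta> c y [1])" for w
    proof
      fix y show "\<beta> c y [w] = w * \<beta> c y [1]"
      proof (cases "y \<in> cimg c")
        case True
        then have "linear (\<lambda>v. \<beta> c y [v])"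
          using is_form_linear[OF \<beta> _ True, of "[0]" 0] \<open>c \<in> atlas circle \<and> x \<in> cimg c\<close> by simp
        from linear_cmul[OF this, of w 1] show ?thesis by simp
      qed (simp add: is_form_outside[OF \<beta>])
    qed
    let ?D = "frechet_derivative (\<lambda>y. \<beta> c y [1]) (at x)"
    have D: "((\<lambda>y. \<beta> c y [1]) has_derivative ?D) (at x)"
      using is_form_has_derivative[OF \<beta>] True by blast
    have fd: "frechet_derivative (\<lambda>y. \<beta> c y [w]) (at x) v = v * (w * ?D 1)" for w v
    proof -
      have "frechet_derivative (\<lambda>y. \<beta> c y [w]) (at x) v = w * ?D v"
        unfolding scal[of w] using fun_cong[OF frechet_derivative_at[OF has_derivative_mult_right[OF D, of w]], of v] by simp
      moreover have "?D v = v * ?D 1" using linear_cmul[OF has_derivative_linear[OF D], of v 1] by simp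
      ultimately show ?thesis by simp
    qed
    have "ext_d \<beta> c x vs = u * (v * ?D 1) - v * (u * ?D 1)"
      using True by (simp only: vs ext_d_2) (subst fd[of v u], subst fd[of u v], rule refl)
    then show ?thesis by simp
  next
    case False
    then show ?thesis using ext_d_off_atlas[OF \<beta>, of c x vs] by (auto simp: ext_d_def)
  qed
qed

section \<open>Solutions of the SUSY equations\<close>

text \<open>The projections combine \<open>Re \<Omega>\<close> and \<open>\<omega>\<close> only, so a rotation in the plane of \<open>W1\<close> and \<open>W3\<close> is the freedom
  needed to make them multiples of \<open>W3\<close> and \<open>W1\<close>.\<close>

lemma projection_forms_rotated:
  assumes F: "su2_forms M \<rho> \<sigma> W1 W2 W3 a b"
    and A: "A = proj_par \<phi> (b *\<^sub>F W1 + (- a) *\<^sub>F W3) (a *\<^sub>F W1 + b *\<^sub>F W3)"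
    and B: "B = proj_perp \<phi> (b *\<^sub>F W1 + (- a) *\<^sub>F W3) (a *\<^sub>F W1 + b *\<^sub>F W3)"
  shows "projection_forms M \<phi> (Complex_form \<rho> \<sigma>) A B W2"
proof -
  interpret su2_forms M \<rho> \<sigma> W1 W2 W3 a b by (rule F)
  show ?thesis unfolding projection_forms_def
    using su2_structure A B unfolding R_def \<omega>_def by (metis Re_Complex_form Im_Complex_form)
qed

text \<open>The rotation is found by solving the definitions of the projections for \<open>\<omega>\<close> and \<open>Re \<Omega>\<close>. For IIA one has
  \<open>Re(\<Omega>)\<^sub>|\<^sub>| = sin \<phi> (sin \<phi> Re \<Omega> + cos \<phi> \<omega>)\<close> and \<open>Re(\<Omega>)\<^sub>\<bottom> = cos \<phi> (cos \<phi> Re \<Omega> - sin \<phi> \<omega>)\<close> with \<open>sin \<phi> = - kpar\<close> and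
  \<open>cos \<phi> = kperp\<close>, so \<open>\<omega> = kpar \<omega>1 + kperp \<omega>3\<close> and \<open>Re \<Omega> = kperp \<omega>1 - kpar \<omega>3\<close>, that is, \<open>a = kpar\<close> and \<open>b = kperp\<close>.
  In the same way IIB leads to \<open>a = - kperp\<close> and \<open>b = kpar\<close>. As \<open>d\<omega>2 = 0\<close>, the \<open>3\<close>-form \<open>H\<close> is zero.\<close>

lemma SUSY_solutions:
  fixes P :: "('a, 'e::euclidean_space) manifold"
  defines "M \<equiv> prod_manifold P circle"
  defines "p \<equiv> (pullback M P fst :: ('a, 'e, real) form \<Rightarrow> _)"
    and "q \<equiv> (pullback M circle snd :: (complex, real, real) form \<Rightarrow> _)"
  assumes hypo: "hypo P \<eta> \<omega>1 \<omega>2 \<omega>3" and d: "ext_d \<eta> = 0" "ext_d \<omega>2 = 0"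
    and \<beta>: "is_form circle 1 \<beta>" "nowhere_zero circle \<beta>"
    and k: "kpar \<in> {0<..<1}" "kperp \<in> {0<..<1}" "kpar\<^sup>2 + kperp\<^sup>2 = 1"
  shows "solves_IIA M kpar kperp (Complex_form (q \<beta>) ((1 / kpar) *\<^sub>F p \<eta>))
           ((- kpar) *\<^sub>F p \<omega>3) (kperp *\<^sub>F p \<omega>1) (p \<omega>2)"
    and "solves_IIB M kpar kperp (Complex_form ((1 / kpar) *\<^sub>F q \<beta>) (p \<eta>))
           (kperp *\<^sub>F p \<omega>3) (kpar *\<^sub>F p \<omega>1) (p \<omega>2)"
proof -
  have P: "su2_structure_5 P \<eta> \<omega>1 \<omega>2 \<omega>3" and closed: "ext_d \<omega>1 = 0" "ext_d (\<omega>3 \<and>\<^sub>F \<eta>) = 0"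
    using hypo by (simp_all add: hypo_def)
  have sP: "smooth_manifold P"
    and forms: "is_form P 1 \<eta>" "is_form P 2 \<omega>1" "is_form P 2 \<omega>2" "is_form P 2 \<omega>3"
    using P by (simp_all add: su2_structure_5_def Let_def)
  have sM: "smooth_manifold M" unfolding M_def by (rule smooth_manifold_prod[OF sP smooth_manifold_circle])
  note fst_lin = chart_linear_fst[OF sP smooth_manifold_circle, folded M_def]
  note snd_lin = chart_linear_snd[OF sP smooth_manifold_circle, folded M_def]
  have formsM: "is_form M 1 (p \<eta>)" "is_form M 2 (p \<omega>1)" "is_form M 2 (p \<omega>2)" "is_form M 2 (p \<omega>3)" "is_form M 1 (q \<beta>)"
    unfolding p_def q_def
    by (rule is_form_pullback[OF fst_lin] is_form_pullback[OF snd_lin], rule forms \<beta>)+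
  have closedM: "ext_d (p \<eta>) = 0" "ext_d (p \<omega>1) = 0" "ext_d (p \<omega>2) = 0" "ext_d (q \<beta>) = 0"
    unfolding p_def q_def
    using ext_d_pullback_closed[OF fst_lin forms(1) d(1)] ext_d_pullback_closed[OF fst_lin forms(2) closed(1)]
      ext_d_pullback_closed[OF fst_lin forms(3) d(2)] ext_d_pullback_closed[OF snd_lin \<beta>(1) ext_d_circle[OF \<beta>(1)]]
    by simp_all
  have d3: "ext_d (p \<omega>3 \<and>\<^sub>F p \<eta>) = 0"
    unfolding p_def by (rule ext_d_pullback_wedge_closed[OF fst_lin forms(4,1) closed(2)])
  have comm: "p \<eta> \<and>\<^sub>F p \<omega>3 = p \<omega>3 \<and>\<^sub>F p \<eta>"
    by (rule wedge_1_2_commute[OF formsM(1,4)[THEN is_form_homogeneous]])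
  have w3: "p \<eta> \<and>\<^sub>F ext_d (p \<omega>3) = 0" by (rule wedge_ext_d_closed[OF formsM(4,1) closedM(1) d3])
  have scale: "ext_d (r *\<^sub>F \<tau>) = r *\<^sub>F ext_d \<tau>" if "is_form M l \<tau>"
    for r l and \<tau> :: "('a \<times> complex, 'e \<times> real, real) form"
    by (rule ext_d_fscale) (rule is_form_differentiable[OF that])
  have scale3: "ext_d (r *\<^sub>F (p \<omega>3 \<and>\<^sub>F p \<eta>)) = 0" for r
    using ext_d_fscale[of "p \<omega>3 \<and>\<^sub>F p \<eta>" r] wedge_differentiable[OF sM formsM(4,1)] d3 by simp
  have k2: "kpar * kpar + kperp * kperp = 1" using k(3) by (simp add: power2_eq_square)
  have k0: "0 < kpar" "kpar < 1" "0 < kperp" "kperp < 1" using k by auto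
  have one_F: "1 *\<^sub>F \<tau> = \<tau>" for \<tau> :: "('c, 'd, real) form" by (intro ext) (simp add: fscale_def)
  show "solves_IIA M kpar kperp (Complex_form (q \<beta>) ((1 / kpar) *\<^sub>F p \<eta>))
           ((- kpar) *\<^sub>F p \<omega>3) (kperp *\<^sub>F p \<omega>1) (p \<omega>2)"
    unfolding solves_IIA_def
  proof (intro conjI exI)
    let ?\<phi> = "- arcsin kpar"
    have sin: "sin ?\<phi> = - kpar" using k0 by (simp add: sin_arcsin)
    have cos: "cos ?\<phi> = kperp"
    proof -
      have "cos ?\<phi> = sqrt (1 - kpar\<^sup>2)" using k0 by (simp add: cos_arcsin)
      also have "1 - kpar\<^sup>2 = kperp\<^sup>2" using k(3) by simp
      finally show ?thesis using k0 by simp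
    qed
    show "kpar = - sin ?\<phi>" "kperp = cos ?\<phi>" by (simp_all only: sin cos minus_minus)
    show "- (pi / 2) < ?\<phi>" using arcsin_lt_bounded[of kpar] k0 by simp
    show "?\<phi> < 0" using arcsin_less_arcsin[of 0 kpar] k0 by simp
    have F: "su2_forms M (q \<beta>) ((1 / kpar) *\<^sub>F p \<eta>) (p \<omega>1) (p \<omega>2) (p \<omega>3) kpar kperp"
      using su2_forms_product[OF P \<beta>, of 1 "1 / kpar" kpar kperp] k0 k2
      unfolding M_def[symmetric] p_def[symmetric] q_def[symmetric] one_F by simp
    have c2: "cos (2 * ?\<phi>) = kperp * kperp - kpar * kpar" and s2: "sin (2 * ?\<phi>) = - 2 * kpar * kperp"
      unfolding cos_double sin_double sin cos by (simp_all add: power2_eq_square)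
    show "projection_forms M ?\<phi> (Complex_form (q \<beta>) ((1 / kpar) *\<^sub>F p \<eta>))
           ((- kpar) *\<^sub>F p \<omega>3) (kperp *\<^sub>F p \<omega>1) (p \<omega>2)"
    proof (rule projection_forms_rotated[OF F])
      show "(- kpar) *\<^sub>F p \<omega>3 = proj_par ?\<phi> (kperp *\<^sub>F p \<omega>1 + (- kpar) *\<^sub>F p \<omega>3) (kpar *\<^sub>F p \<omega>1 + kperp *\<^sub>F p \<omega>3)"
        unfolding proj_par_def c2 s2
      proof (intro ext)
        fix c x vs
        show "((- kpar) *\<^sub>F p \<omega>3) c x vs = ((1/2) *\<^sub>F ((1 - (kperp * kperp - kpar * kpar)) *\<^sub>F (kperp *\<^sub>F p \<omega>1 + (- kpar) *\<^sub>F p \<omega>3)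
            + (- 2 * kpar * kperp) *\<^sub>F (kpar *\<^sub>F p \<omega>1 + kperp *\<^sub>F p \<omega>3))) c x vs"
          using k2 by (simp add: fscale_def) algebra
      qed
      show "kperp *\<^sub>F p \<omega>1 = proj_perp ?\<phi> (kperp *\<^sub>F p \<omega>1 + (- kpar) *\<^sub>F p \<omega>3) (kpar *\<^sub>F p \<omega>1 + kperp *\<^sub>F p \<omega>3)"
        unfolding proj_perp_def c2 s2
      proof (intro ext)
        fix c x vs
        show "(kperp *\<^sub>F p \<omega>1) c x vs = ((1/2) *\<^sub>F ((1 + (kperp * kperp - kpar * kpar)) *\<^sub>F (kperp *\<^sub>F p \<omega>1 + (- kpar) *\<^sub>F p \<omega>3)
            - (- 2 * kpar * kperp) *\<^sub>F (kpar *\<^sub>F p \<omega>1 + kperp *\<^sub>F p \<omega>3))) c x vs"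
          using k2 by (simp add: fscale_def) algebra
      qed
    qed
    show "is_form M 3 (0 :: ('a \<times> complex, 'e \<times> real, real) form)" by (rule is_form_zero)
    have "ext_d ((1 / kpar) *\<^sub>F p \<eta> \<and>\<^sub>F (- kpar) *\<^sub>F p \<omega>3) = 0"
      unfolding wedge_fscale_left wedge_fscale_right fscale_fscale comm by (rule scale3)
    then show "0 \<and>\<^sub>F Re_form (Complex_form (q \<beta>) ((1 / kpar) *\<^sub>F p \<eta>)) = (- (kperp / kpar)) *\<^sub>F
        ext_d (Im_form (Complex_form (q \<beta>) ((1 / kpar) *\<^sub>F p \<eta>)) \<and>\<^sub>F (- kpar) *\<^sub>F p \<omega>3)"
      by (simp add: wedge_0_left)
  qed (simp_all add: closedM scale[OF formsM(1)] scale[OF formsM(2)] wedge_0_right)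
  show "solves_IIB M kpar kperp (Complex_form ((1 / kpar) *\<^sub>F q \<beta>) (p \<eta>))
           (kperp *\<^sub>F p \<omega>3) (kpar *\<^sub>F p \<omega>1) (p \<omega>2)"
    unfolding solves_IIB_def
  proof (intro conjI exI)
    let ?\<phi> = "arcsin kperp"
    have sin: "sin ?\<phi> = kperp" using k0 by (simp add: sin_arcsin)
    have cos: "cos ?\<phi> = kpar"
    proof -
      have "cos ?\<phi> = sqrt (1 - kperp\<^sup>2)" using k0 by (simp add: cos_arcsin)
      also have "1 - kperp\<^sup>2 = kpar\<^sup>2" using k(3) by simp
      finally show ?thesis using k0 by simp
    qed
    show "kpar = cos ?\<phi>" "kperp = sin ?\<phi>" by (simp_all only: sin cos)
    show "?\<phi> < pi / 2" using arcsin_lt_bounded[of kperp] k0 by simp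
    show "0 < ?\<phi>" using arcsin_less_arcsin[of 0 kperp] k0 by simp
    have F: "su2_forms M ((1 / kpar) *\<^sub>F q \<beta>) (p \<eta>) (p \<omega>1) (p \<omega>2) (p \<omega>3) (- kperp) kpar"
      using su2_forms_product[OF P \<beta>, of "1 / kpar" 1 "- kperp" kpar] k0 k2
      unfolding M_def[symmetric] p_def[symmetric] q_def[symmetric] one_F by (simp add: add.commute)
    have c2: "cos (2 * ?\<phi>) = kpar * kpar - kperp * kperp" and s2: "sin (2 * ?\<phi>) = 2 * kpar * kperp"
      unfolding cos_double sin_double sin cos by (simp_all add: power2_eq_square)
    show "projection_forms M ?\<phi> (Complex_form ((1 / kpar) *\<^sub>F q \<beta>) (p \<eta>))
           (kperp *\<^sub>F p \<omega>3) (kpar *\<^sub>F p \<omega>1) (p \<omega>2)"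
    proof (rule projection_forms_rotated[OF F])
      show "kperp *\<^sub>F p \<omega>3 = proj_par ?\<phi> (kpar *\<^sub>F p \<omega>1 + (- (- kperp)) *\<^sub>F p \<omega>3) ((- kperp) *\<^sub>F p \<omega>1 + kpar *\<^sub>F p \<omega>3)"
        unfolding proj_par_def c2 s2
      proof (intro ext)
        fix c x vs
        show "(kperp *\<^sub>F p \<omega>3) c x vs = ((1/2) *\<^sub>F ((1 - (kpar * kpar - kperp * kperp)) *\<^sub>F (kpar *\<^sub>F p \<omega>1 + (- (- kperp)) *\<^sub>F p \<omega>3)
            + (2 * kpar * kperp) *\<^sub>F ((- kperp) *\<^sub>F p \<omega>1 + kpar *\<^sub>F p \<omega>3))) c x vs"
          using k2 by (simp add: fscale_def) algebra
      qed
      show "kpar *\<^sub>F p \<omega>1 = proj_perp ?\<phi> (kpar *\<^sub>F p \<omega>1 + (- (- kperp)) *\<^sub>F p \<omega>3) ((- kperp) *\<^sub>F p \<omega>1 + kpar *\<^sub>F p \<omega>3)"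
        unfolding proj_perp_def c2 s2
      proof (intro ext)
        fix c x vs
        show "(kpar *\<^sub>F p \<omega>1) c x vs = ((1/2) *\<^sub>F ((1 + (kpar * kpar - kperp * kperp)) *\<^sub>F (kpar *\<^sub>F p \<omega>1 + (- (- kperp)) *\<^sub>F p \<omega>3)
            - (2 * kpar * kperp) *\<^sub>F ((- kperp) *\<^sub>F p \<omega>1 + kpar *\<^sub>F p \<omega>3))) c x vs"
          using k2 by (simp add: fscale_def) algebra
      qed
    qed
    show "is_form M 3 (0 :: ('a \<times> complex, 'e \<times> real, real) form)" by (rule is_form_zero)
  qed (simp_all add: closedM scale[OF formsM(2)] scale[OF formsM(4)] scale[OF formsM(5)] wedge_0_right wedge_0_left
      wedge_fscale_right wedge_fscale_left w3)
qed

theorem proposition3p9: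
  fixes P :: "('p, real ^ 5) manifold"
    and \<eta> \<omega>1 \<omega>2 \<omega>3 :: "('p, real ^ 5, real) form"
  assumes "compact_space (mtop P)"
    and "hypo P \<eta> \<omega>1 \<omega>2 \<omega>3"
    and "ext_d \<eta> = 0"
    and "ext_d \<omega>2 = 0"
  defines "M \<equiv> prod_manifold P circle"
  defines "p \<equiv> (pullback M P fst :: ('p, real ^ 5, real) form \<Rightarrow> _)"
    and "q \<equiv> (pullback M circle snd :: (complex, real, real) form \<Rightarrow> _)"
  shows "(\<exists>kpar\<in>{0<..<1}. \<exists>kperp\<in>{0<..<1}. kpar\<^sup>2 + kperp\<^sup>2 = 1 \<and>
            (\<exists>\<alpha> A B C. solves_IIA M kpar kperp \<alpha> A B C))
       \<and> (\<exists>kpar\<in>{0<..<1}. \<exists>kperp\<in>{0<..<1}. kpar\<^sup>2 + kperp\<^sup>2 = 1 \<and>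
            (\<exists>\<alpha> A B C. solves_IIB M kpar kperp \<alpha> A B C))
       \<and> (\<forall>\<beta>. \<forall>kpar\<in>{0<..<1}. \<forall>kperp\<in>{0<..<1}.
            is_form circle 1 \<beta> \<and> nowhere_zero circle \<beta> \<and> kpar\<^sup>2 + kperp\<^sup>2 = 1 \<longrightarrow>
            solves_IIA M kpar kperp
              (Complex_form (q \<beta>) ((1 / kpar) *\<^sub>F p \<eta>))
              ((- kpar) *\<^sub>F p \<omega>3) (kperp *\<^sub>F p \<omega>1) (p \<omega>2) \<and>
            solves_IIB M kpar kperp
              (Complex_form ((1 / kpar) *\<^sub>F q \<beta>) (p \<eta>))
              (kperp *\<^sub>F p \<omega>3) (kpar *\<^sub>F p \<omega>1) (p \<omega>2))"
proof (intro conjI)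
  \<comment> \<open>For existence alone any admissible constants will do; a Pythagorean triple provides them.\<close>
  note sol = SUSY_solutions[OF assms(2-4), folded M_def, folded p_def q_def]
  have k: "3/5 \<in> {0<..<1::real}" "4/5 \<in> {0<..<1::real}" "(3/5)\<^sup>2 + (4/5)\<^sup>2 = (1::real)"
    by (simp_all add: power2_eq_square)
  note angle = sol[OF is_form_angle_form nowhere_zero_angle_form k]
  show "\<exists>kpar\<in>{0<..<1}. \<exists>kperp\<in>{0<..<1}. kpar\<^sup>2 + kperp\<^sup>2 = 1 \<and> (\<exists>\<alpha> A B C. solves_IIA M kpar kperp \<alpha> A B C)"
    using k angle(1) by blast
  show "\<exists>kpar\<in>{0<..<1}. \<exists>kperp\<in>{0<..<1}. kpar\<^sup>2 + kperp\<^sup>2 = 1 \<and> (\<exists>\<alpha> A B C. solves_IIB M kpar kperp \<alpha> A B C)"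
    using k angle(2) by blast
  show "\<forall>\<beta>. \<forall>kpar\<in>{0<..<1}. \<forall>kperp\<in>{0<..<1}.
      is_form circle 1 \<beta> \<and> nowhere_zero circle \<beta> \<and> kpar\<^sup>2 + kperp\<^sup>2 = 1 \<longrightarrow>
      solves_IIA M kpar kperp (Complex_form (q \<beta>) ((1 / kpar) *\<^sub>F p \<eta>))
        ((- kpar) *\<^sub>F p \<omega>3) (kperp *\<^sub>F p \<omega>1) (p \<omega>2) \<and>
      solves_IIB M kpar kperp (Complex_form ((1 / kpar) *\<^sub>F q \<beta>) (p \<eta>))
        (kperp *\<^sub>F p \<omega>3) (kpar *\<^sub>F p \<omega>1) (p \<omega>2)"
    by (intro allI ballI impI conjI; elim conjE; rule sol; assumption)
qed

end
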